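(* Let $(q_n)_{n\ge0}$ be a sequence of integers $q_n\ge2$, let $h_0=1$, $h_{n+1}=q_nh_n$, and suppose that $q_n/h_n\to\infty$ as $n\to\infty$. Let $\alpha_{n,y}$ ($n\ge0$, $0\le y\le q_n-1$) be independent random variables, $\alpha_{n,y}$ being uniformly distributed on $\mathbb{Z}_{h_n}=\{0,\dots,h_n-1\}$. Then almost surely the iceberg transformation $T$ defined by $(q_n)$ and the rotations $(\alpha_{n,y})$ has simple spectrum.
   Context: Iceberg transformation (without spacers): let $q_n\ge 2$ be integers, $h_0=1$, $h_{n+1}=q_nh_n$, and let $\alpha_{n,y}\in\{0,\dots,h_n-1\}$ for $n\ge0$, $0\le y\le q_n-1$. Let $X_n=\{0,1,\dots,h_n-1\}$ (identified with $\mathbb{Z}/h_n\mathbb{Z}$) with uniform probability measure $\mu_n$. Define $\phi_n:X_{n+1}\to X_n$ by $\phi_n(yh_n+t)=t-\alpha_{n,y} \pmod{h_n}$ for $0\le t<h_n$, $0\le y\le q_n-1$. Let $X=\{x=(x_0,x_1,\dots): x_n\in X_n,\ \phi_n(x_{n+1})=x_n \text{ for all } n\}$ be the inverse limit, with the Borel probability measure $\mu$ satisfying $\mu(\{x: x_n=t\})=h_n^{-1}$ for all $n$ and $t\in X_n$. A point $x$ is regular if there is $n_0$ such that $\phi_n(x_{n+1}+1)=x_n+1$ for all $n\ge n_0$ (where $x_n+1$ is taken modulo $h_n$); $\mu$-almost every point is regular. For regular $x$, $Tx$ is the point of $X$ with $(Tx)_n=x_n+1 \pmod{h_n}$ for all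 $n\ge n_0$, the coordinates with $n<n_0$ being determined by $(Tx)_n=\phi_n((Tx)_{n+1})$. The Koopman operator is $\hat T f(x)=f(Tx)$ on $L^2(X,\mu)$. $T$ has simple spectrum if there is $e_0\in L^2(X,\mu)$ such that the closed linear span of $\{\hat T^k e_0: k\in\mathbb{Z}\}$ is all of $L^2(X,\mu)$. *)

theory Defs
  imports "HOL-Probability.Probability"
begin

primrec iceberg_height :: "(nat \<Rightarrow> nat) \<Rightarrow> nat \<Rightarrow> nat" where
  "iceberg_height q 0 = 1"
| "iceberg_height q (Suc n) = q n * iceberg_height q n"

text \<open>The map \<open>X\<^sub>n\<^sub>+\<^sub>1 \<Rightarrow> X\<^sub>n\<close>, \<open>y h\<^sub>n + t \<mapsto> t - \<alpha>\<^sub>n\<^sub>,\<^sub>y (mod h\<^sub>n)\<close>. The subtraction is performed on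
  integers, where \<open>mod\<close> returns the representative in \<open>{0,\<dots>,h\<^sub>n-1}\<close>.\<close>

definition iceberg_proj :: "(nat \<Rightarrow> nat) \<Rightarrow> (nat \<Rightarrow> nat \<Rightarrow> nat) \<Rightarrow> nat \<Rightarrow> nat \<Rightarrow> nat" where
  "iceberg_proj q \<alpha> n u =
     (let y = u div iceberg_height q n; t = u mod iceberg_height q n
      in nat ((int t - int (\<alpha> n y)) mod int (iceberg_height q n)))"

definition iceberg_space :: "(nat \<Rightarrow> nat) \<Rightarrow> (nat \<Rightarrow> nat \<Rightarrow> nat) \<Rightarrow> (nat \<Rightarrow> nat) set" where
  "iceberg_space q \<alpha> =
     {x. \<forall>n. x n \<in> {..<iceberg_height q n} \<and> iceberg_proj q \<alpha> n (x (Suc n)) = x n}"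

text \<open>The topology on \<open>nat \<Rightarrow> nat\<close> is the product of the discrete topologies, so \<open>restrict_space borel\<close>
  is the Borel \<open>\<sigma>\<close>-algebra of the inverse limit. Existence and uniqueness of the measure are
  established in \<open>ex1_iceberg_measure\<close> below.\<close>

definition is_iceberg_measure ::
  "(nat \<Rightarrow> nat) \<Rightarrow> (nat \<Rightarrow> nat \<Rightarrow> nat) \<Rightarrow> (nat \<Rightarrow> nat) measure \<Rightarrow> bool" where
  "is_iceberg_measure q \<alpha> \<mu> \<longleftrightarrow>
     prob_space \<mu> \<and> sets \<mu> = sets (restrict_space borel (iceberg_space q \<alpha>)) \<and>
     (\<forall>n. \<forall>t<iceberg_height q n. measure \<mu> {x \<in> iceberg_space q \<alpha>. x n = t} = 1 / real (iceberg_height q n))"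

definition iceberg_measure ::
  "(nat \<Rightarrow> nat) \<Rightarrow> (nat \<Rightarrow> nat \<Rightarrow> nat) \<Rightarrow> (nat \<Rightarrow> nat) measure" where
  "iceberg_measure q \<alpha> = (THE \<mu>. is_iceberg_measure q \<alpha> \<mu>)"

definition iceberg_regular_from ::
  "(nat \<Rightarrow> nat) \<Rightarrow> (nat \<Rightarrow> nat \<Rightarrow> nat) \<Rightarrow> nat \<Rightarrow> (nat \<Rightarrow> nat) \<Rightarrow> bool" where
  "iceberg_regular_from q \<alpha> n0 x \<longleftrightarrow>
     (\<forall>n\<ge>n0. iceberg_proj q \<alpha> n ((x (Suc n) + 1) mod iceberg_height q (Suc n)) = (x n + 1) mod iceberg_height q n)"

definition iceberg_regular :: "(nat \<Rightarrow> nat) \<Rightarrow> (nat \<Rightarrow> nat \<Rightarrow> nat) \<Rightarrow> (nat \<Rightarrow> nat) set" where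
  "iceberg_regular q \<alpha> = {x \<in> iceberg_space q \<alpha>. \<exists>n0. iceberg_regular_from q \<alpha> n0 x}"

text \<open>The two transformations below are extended by the identity to the null sets on which they
  are not defined; see \<open>AE_regular\<close>, \<open>AE_image_regular\<close> and \<open>inj_on_T\<close> below.\<close>

definition iceberg_map ::
  "(nat \<Rightarrow> nat) \<Rightarrow> (nat \<Rightarrow> nat \<Rightarrow> nat) \<Rightarrow> (nat \<Rightarrow> nat) \<Rightarrow> (nat \<Rightarrow> nat)" where
  "iceberg_map q \<alpha> x =
     (if x \<in> iceberg_regular q \<alpha>
      then THE z. z \<in> iceberg_space q \<alpha> \<and>
             (\<exists>n0. iceberg_regular_from q \<alpha> n0 x \<and> (\<forall>n\<ge>n0. z n = (x n + 1) mod iceberg_height q n))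
      else x)"

definition iceberg_inv ::
  "(nat \<Rightarrow> nat) \<Rightarrow> (nat \<Rightarrow> nat \<Rightarrow> nat) \<Rightarrow> (nat \<Rightarrow> nat) \<Rightarrow> (nat \<Rightarrow> nat)" where
  "iceberg_inv q \<alpha> z =
     (if z \<in> iceberg_map q \<alpha> ` iceberg_regular q \<alpha>
      then inv_into (iceberg_regular q \<alpha>) (iceberg_map q \<alpha>) z
      else z)"

text \<open>Elements of complex \<open>L\<^sup>2\<close> are handled through representatives.\<close>

definition L2_funs :: "'a measure \<Rightarrow> ('a \<Rightarrow> complex) set" where
  "L2_funs M = {f \<in> borel_measurable M. integrable M (\<lambda>x. (cmod (f x))\<^sup>2)}"

definition L2_dist :: "'a measure \<Rightarrow> ('a \<Rightarrow> complex) \<Rightarrow> ('a \<Rightarrow> complex) \<Rightarrow> real" where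
  "L2_dist M f g = sqrt (\<integral>x. (cmod (f x - g x))\<^sup>2 \<partial>M)"

definition complex_fun_span :: "('a \<Rightarrow> complex) set \<Rightarrow> ('a \<Rightarrow> complex) set" where
  "complex_fun_span S = {(\<lambda>x. \<Sum>g\<in>F. c g * g x) | F c. finite F \<and> F \<subseteq> S}"

text \<open>The restriction \<open>g \<in> L2_funs M\<close> is automatic when \<open>S \<subseteq> L2_funs M\<close>; it ensures that \<open>L2_dist\<close> is
  only applied where its integral is meaningful.\<close>

definition L2_closed_span :: "'a measure \<Rightarrow> ('a \<Rightarrow> complex) set \<Rightarrow> ('a \<Rightarrow> complex) set" where
  "L2_closed_span M S =
     {f \<in> L2_funs M. \<forall>\<epsilon>>0. \<exists>g \<in> complex_fun_span S \<inter> L2_funs M. L2_dist M f g < \<epsilon>}"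

text \<open>Integer powers of the Koopman operator of \<open>T\<close>, where \<open>S\<close> is the almost everywhere inverse of \<open>T\<close>.\<close>

definition koopman_power ::
  "('a \<Rightarrow> 'a) \<Rightarrow> ('a \<Rightarrow> 'a) \<Rightarrow> int \<Rightarrow> ('a \<Rightarrow> complex) \<Rightarrow> ('a \<Rightarrow> complex)" where
  "koopman_power T S k f =
     (if 0 \<le> k then f \<circ> (T ^^ nat k) else f \<circ> (S ^^ nat (- k)))"

definition simple_spectrum :: "'a measure \<Rightarrow> ('a \<Rightarrow> 'a) \<Rightarrow> ('a \<Rightarrow> 'a) \<Rightarrow> bool" where
  "simple_spectrum M T S \<longleftrightarrow>
     (\<exists>e0 \<in> L2_funs M. L2_closed_span M (range (\<lambda>k::int. koopman_power T S k e0)) = L2_funs M)"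

definition iceberg_simple_spectrum :: "(nat \<Rightarrow> nat) \<Rightarrow> (nat \<Rightarrow> nat \<Rightarrow> nat) \<Rightarrow> bool" where
  "iceberg_simple_spectrum q \<alpha> \<longleftrightarrow>
     simple_spectrum (iceberg_measure q \<alpha>) (iceberg_map q \<alpha>) (iceberg_inv q \<alpha>)"

locale iceberg =
  fixes q :: "nat \<Rightarrow> nat" and \<alpha> :: "nat \<Rightarrow> nat \<Rightarrow> nat"
  assumes q_ge_2: "\<And>n. 2 \<le> q n"
    and \<alpha>_less: "\<And>n y. y < q n \<Longrightarrow> \<alpha> n y < iceberg_height q n"
begin

abbreviation "h \<equiv> iceberg_height q"
abbreviation "\<phi> \<equiv> iceberg_proj q \<alpha>"
abbreviation "X \<equiv> iceberg_space q \<alpha>"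
abbreviation "R \<equiv> iceberg_regular q \<alpha>"
abbreviation "T \<equiv> iceberg_map q \<alpha>"
abbreviation "\<mu> \<equiv> iceberg_measure q \<alpha>"

lemma h_pos: "0 < h n"
proof (induction n)
  case (Suc n) then show ?case using q_ge_2[of n] by simp
qed simp

lemma h_ge: "2 ^ n \<le> h n"
proof (induction n)
  case (Suc n) then show ?case using mult_mono[OF q_ge_2[of n] Suc] by simp
qed simp

lemma \<phi>_less: "\<phi> n u < h n"
  using h_pos[of n] by (simp add: iceberg_proj_def Let_def nat_less_iff)

lemma \<phi>_eq: "\<phi> n (y * h n + s) = nat ((int s - int (\<alpha> n y)) mod int (h n))" if "s < h n"
  using that by (simp add: iceberg_proj_def)

lemma X_eqI:
  assumes "z \<in> X" "z' \<in> X" "\<And>n. n \<ge> N \<Longrightarrow> z n = z' n"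
  shows "z = z'"
proof -
  have "z n = z' n" if "n \<le> N" for n
    using that
  proof (induction rule: inc_induct)
    case (step n)
    then show ?case using assms(1,2) unfolding iceberg_space_def
      by (metis (mono_tags, lifting) mem_Collect_eq)
  qed (simp add: assms(3))
  then show ?thesis using assms(3) by (metis ext nle_le)
qed

lemma X_extend:
  assumes "\<And>n. n \<ge> N \<Longrightarrow> w n < h n" "\<And>n. n \<ge> N \<Longrightarrow> \<phi> n (w (Suc n)) = w n"
  shows "\<exists>z\<in>X. \<forall>n\<ge>N. z n = w n"
  using assms
proof (induction N arbitrary: w)
  case 0
  then show ?case by (intro bexI[of _ w]) (auto simp: iceberg_space_def)
next
  case (Suc N)
  have "\<exists>z\<in>X. \<forall>n\<ge>N. z n = (w(N := \<phi> N (w (Suc N)))) n"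
    using Suc.prems by (intro Suc.IH) (auto simp: \<phi>_less)
  then obtain z where "z \<in> X" "\<And>n. n \<ge> N \<Longrightarrow> z n = (w(N := \<phi> N (w (Suc N)))) n" by blast
  then show ?case by (intro bexI[of _ z]) auto
qed

lemma T_char:
  assumes "x \<in> R"
  shows "T x \<in> X" "\<forall>\<^sub>F n in sequentially. T x n = (x n + 1) mod h n"
    "iceberg_regular_from q \<alpha> n0 x \<Longrightarrow> n \<ge> n0 \<Longrightarrow> T x n = (x n + 1) mod h n"
proof -
  let ?P = "\<lambda>n0 z. iceberg_regular_from q \<alpha> n0 x \<and> (\<forall>n\<ge>n0. z n = (x n + 1) mod h n)"
  have ex: "\<exists>z\<in>X. ?P n0 z" if r: "iceberg_regular_from q \<alpha> n0 x" for n0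
  proof -
    have "\<exists>z\<in>X. \<forall>n\<ge>n0. z n = (x n + 1) mod h n"
      by (rule X_extend) (use r h_pos in \<open>auto simp: iceberg_regular_from_def\<close>)
    then show ?thesis using r by blast
  qed
  have uniq: "z = z'" if "z \<in> X" "z' \<in> X" "?P n0 z" "?P n1 z'" for z z' n0 n1
    using that by (intro X_eqI[of z z' "max n0 n1"]) auto
  have T: "T x = z" if "z \<in> X" "?P n0 z" for z n0
    unfolding iceberg_map_def using assms that uniq by (auto intro!: the_equality)
  obtain m z where m: "iceberg_regular_from q \<alpha> m x" "z \<in> X" "?P m z"
    using assms ex unfolding iceberg_regular_def by blast
  show "T x \<in> X" using T m by blast
  show "\<forall>\<^sub>F n in sequentially. T x n = (x n + 1) mod h n"
    using T m by (auto simp: eventually_sequentially)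
  show "iceberg_regular_from q \<alpha> n0 x \<Longrightarrow> n \<ge> n0 \<Longrightarrow> T x n = (x n + 1) mod h n"
    using ex[of n0] T by blast
qed

lemma inj_on_T: "inj_on T R"
proof (rule inj_onI)
  fix x x' assume x: "x \<in> R" "x' \<in> R" and eq: "T x = T x'"
  have "\<forall>\<^sub>F n in sequentially. x n = x' n"
    using T_char(2)[OF x(1)] T_char(2)[OF x(2)]
  proof eventually_elim
    case (elim n)
    have "x n < h n" "x' n < h n" using x by (auto simp: iceberg_regular_def iceberg_space_def)
    then show ?case using elim eq by (auto simp: mod_Suc split: if_splits)
  qed
  then show "x = x'" using x X_eqI[of x x'] unfolding eventually_sequentially
    by (auto simp: iceberg_regular_def)
qed

lemma inv_T: "x \<in> R \<Longrightarrow> iceberg_inv q \<alpha> (T x) = x"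
  by (simp add: iceberg_inv_def inj_on_T)

lemma cylinder_sets: "{x\<in>X. x n = t} \<in> sets (restrict_space borel X)"
proof -
  have "{x\<in>X. x n = t} = X \<inter> {x. x n = t}" by auto
  moreover have "{x. x n = t} \<in> sets (borel :: (nat \<Rightarrow> nat) measure)"
  proof -
    have "(\<lambda>x. x n) \<in> borel_measurable (borel :: (nat \<Rightarrow> nat) measure)"
      by (intro borel_measurable_continuous_onI continuous_on_product_coordinates)
    then have "(\<lambda>x. x n) -` {t} \<inter> space borel \<in> sets (borel :: (nat \<Rightarrow> nat) measure)"
      by (rule measurable_sets) simp
    then show ?thesis by (simp add: vimage_def)
  qed
  ultimately show ?thesis by (auto simp: sets_restrict_space)
qed

lemma sets_restrict_eq:
  "sets (restrict_space borel X) = sigma_sets X (insert {} {{x\<in>X. x n = t} |n t. t < h n})"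
proof -
  let ?E = "insert {} {{x\<in>X. x n = t} |n t. t < h n}"
  have E: "?E \<subseteq> Pow X" by auto
  have 1: "sets (restrict_space borel X) \<subseteq> sets (sigma X ?E)"
  proof
    fix A assume "A \<in> sets (restrict_space borel X)"
    then obtain B where B: "B \<in> sets (borel :: (nat \<Rightarrow> nat) measure)" "A = X \<inter> B"
      by (auto simp: sets_restrict_space)
    have "(\<lambda>x. x) \<in> measurable (sigma X ?E) (PiM UNIV (\<lambda>_. borel :: nat measure))"
    proof (rule measurable_PiM_single')
      fix i :: nat
      show "(\<lambda>x. x i) \<in> borel_measurable (sigma X ?E)"
      proof (subst measurable_cong_sets[OF refl, of _ "count_space UNIV"])
        have "(\<lambda>x. x i) -` {t} \<inter> X \<in> sigma_sets X ?E" for t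
        proof (cases "t < h i")
          case True
          have "(\<lambda>x. x i) -` {t} \<inter> X = {x\<in>X. x i = t}" by auto
          then show ?thesis using True by (auto intro!: sigma_sets.Basic)
        next
          case False
          then have "(\<lambda>x. x i) -` {t} \<inter> X = {}" by (auto simp: iceberg_space_def)
          then show ?thesis by (auto intro: sigma_sets.Empty)
        qed
        then show "(\<lambda>x. x i) \<in> measurable (sigma X ?E) (count_space UNIV)"
          using E by (subst measurable_count_space_eq_countable) (auto simp: space_measure_of_conv)
      qed (simp add: sets_borel_eq_count_space)
    qed auto
    then have "(\<lambda>x. x) \<in> measurable (sigma X ?E) borel"
      by (simp add: measurable_cong_sets[OF refl sets_PiM_equal_borel])
    from measurable_sets[OF this B(1)] show "A \<in> sets (sigma X ?E)"
      using B(2) E by (simp add: space_measure_of_conv Int_commute)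
  qed
  have 2: "sigma_sets X ?E \<subseteq> sets (restrict_space borel X)"
    using sets.sigma_sets_subset[of ?E "restrict_space borel X"] cylinder_sets
    by (auto simp: space_restrict_space)
  show ?thesis using 1 2 E by (simp add: sets_measure_of)
qed

lemma X_nested:
  assumes "x \<in> X" "x' \<in> X" "x m = x' m" "n \<le> m"
  shows "x n = x' n"
  using assms(4)
proof (induction rule: inc_induct)
  case (step n)
  then show ?case using assms(1,2) unfolding iceberg_space_def
    by (metis (mono_tags, lifting) mem_Collect_eq)
qed (simp add: assms(3))

lemma iceberg_measure_unique:
  assumes "is_iceberg_measure q \<alpha> M" "is_iceberg_measure q \<alpha> N"
  shows "M = N"
proof (rule measure_eqI_generator_eq)
  let ?E = "insert {} {{x\<in>X. x n = t} |n t. t < h n}"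
  note M = assms(1)[unfolded is_iceberg_measure_def]
  note N = assms(2)[unfolded is_iceberg_measure_def]
  interpret M: prob_space M using M by simp
  interpret N: prob_space N using N by simp
  have *: "{x\<in>X. x n = t} \<inter> {x\<in>X. x m = s} \<in> {{}, {x\<in>X. x m = s}}" if "n \<le> m" for n m s t
    using X_nested[OF _ _ _ that] by (smt (verit) Collect_cong Int_def empty_Collect_eq insertCI mem_Collect_eq)
  show "Int_stable ?E"
  proof (rule Int_stableI)
    fix A B assume AB: "A \<in> ?E" "B \<in> ?E"
    show "A \<inter> B \<in> ?E"
    proof (cases "A = {} \<or> B = {}")
      case True then show ?thesis by auto
    next
      case False
      then obtain n t m s where A: "A = {x\<in>X. x n = t}" "t < h n" and B: "B = {x\<in>X. x m = s}" "s < h m"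
        using AB by blast
      have "A \<inter> B \<in> {{}, A, B}"
        using *[of n m t s] *[of m n s t] A(1) B(1) by (cases "n \<le> m") (auto simp: Int_commute)
      then show ?thesis using AB by auto
    qed
  qed
  show "?E \<subseteq> Pow X" by auto
  show "sets M = sigma_sets X ?E" "sets N = sigma_sets X ?E"
    using M N sets_restrict_eq by auto
  show "emeasure M A = emeasure N A" if "A \<in> ?E" for A
    using that M N by (auto simp: M.emeasure_eq_measure N.emeasure_eq_measure)
  have "x 0 < h 0" if "x \<in> X" for x using that unfolding iceberg_space_def by blast
  then have "X = {x\<in>X. x 0 = 0}" by auto
  then have "X \<in> {{x\<in>X. x n = t} |n t. t < h n}" using h_pos by blast
  then show "range (\<lambda>_::nat. X) \<subseteq> ?E" by auto
  show "(\<Union>i::nat. X) = X" by auto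
  show "emeasure M X \<noteq> \<infinity>" for i :: nat by simp
qed

text \<open>Existence: the measure is the image of the product of the uniform measures on \<open>{..<q n}\<close>.\<close>

primrec coords :: "(nat \<Rightarrow> nat) \<Rightarrow> nat \<Rightarrow> nat" where
  "coords d 0 = 0"
| "coords d (Suc n) = d n * h n + (coords d n + \<alpha> n (d n)) mod h n"

lemma path_less: "\<forall>i<n. d i < q i \<Longrightarrow> coords d n < h n"
proof (induction n)
  case (Suc n)
  have "d n * h n + (coords d n + \<alpha> n (d n)) mod h n < (d n + 1) * h n"
    using h_pos[of n] by simp
  also have "\<dots> \<le> q n * h n" using Suc.prems by (intro mult_right_mono) (auto simp: Suc_le_eq)
  finally show ?case by simp
qed simp

lemma shift_inverse:
  assumes "s < h n" "p < h n"
  shows "(p + a) mod h n = s \<longleftrightarrow> p = nat ((int s - int a) mod int (h n))"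
proof -
  have "(p + a) mod h n = s \<longleftrightarrow> (int p + int a) mod int (h n) = int s"
    by (metis of_nat_add of_nat_eq_iff of_nat_mod)
  also have "\<dots> \<longleftrightarrow> (int p + int a) mod int (h n) = int s mod int (h n)"
    using assms by simp
  also have "\<dots> \<longleftrightarrow> int p mod int (h n) = (int s - int a) mod int (h n)"
    by (simp add: mod_eq_dvd_iff algebra_simps)
  also have "\<dots> \<longleftrightarrow> p = nat ((int s - int a) mod int (h n))"
    using assms h_pos[of n] by auto
  finally show ?thesis .
qed

lemma path_in_X: "\<forall>i. d i < q i \<Longrightarrow> coords d \<in> X"
proof -
  assume d: "\<forall>i. d i < q i"
  have "\<phi> n (coords d (Suc n)) = coords d n" for n
    using shift_inverse[of "(coords d n + \<alpha> n (d n)) mod h n" n "coords d n" "\<alpha> n (d n)"]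
      h_pos[of n] path_less[of n d] d by (simp add: \<phi>_eq)
  then show ?thesis using path_less d by (simp add: iceberg_space_def del: coords.simps)
qed

lemma path_prefix:
  "t < h n \<Longrightarrow> \<exists>c. (\<forall>i<n. c i < q i) \<and>
     (\<forall>d. (\<forall>i. d i < q i) \<longrightarrow> coords d n = t \<longleftrightarrow> (\<forall>i<n. d i = c i))"
proof (induction n arbitrary: t)
  case (Suc n)
  define y s where "y = t div h n" and "s = t mod h n"
  have s: "s < h n" using h_pos by (simp add: s_def)
  have y: "y < q n" using Suc.prems by (simp add: y_def less_mult_imp_div_less)
  have t: "t = y * h n + s" unfolding y_def s_def by (rule div_mult_mod_eq[symmetric])
  let ?t = "nat ((int s - int (\<alpha> n y)) mod int (h n))"
  have "?t < h n" using h_pos[of n] by (simp add: nat_less_iff)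
  from Suc.IH[OF this] obtain c where c: "\<forall>i<n. c i < q i"
    "\<And>d. (\<forall>i. d i < q i) \<Longrightarrow> coords d n = ?t \<longleftrightarrow> (\<forall>i<n. d i = c i)" by blast
  have "coords d (Suc n) = t \<longleftrightarrow> (\<forall>i<Suc n. d i = (c(n := y)) i)" if d: "\<forall>i. d i < q i" for d
  proof -
    have "coords d (Suc n) = t \<longleftrightarrow> d n = y \<and> (coords d n + \<alpha> n (d n)) mod h n = s"
    proof
      assume "coords d (Suc n) = t"
      then show "d n = y \<and> (coords d n + \<alpha> n (d n)) mod h n = s"
        using h_pos[of n] by (auto simp: y_def s_def)
    qed (auto simp: t)
    also have "\<dots> \<longleftrightarrow> d n = y \<and> coords d n = ?t"
      using shift_inverse[OF s path_less[of n d], of "\<alpha> n y"] d by auto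
    also have "\<dots> \<longleftrightarrow> (\<forall>i<Suc n. d i = (c(n := y)) i)"
      using c(2)[OF d] by (auto simp: less_Suc_eq)
    finally show ?thesis .
  qed
  moreover have "\<forall>i<Suc n. (c(n := y)) i < q i" using c(1) y by (auto simp: less_Suc_eq)
  ultimately show ?case by blast
qed simp

lemma iceberg_measure_exists: "\<exists>M. is_iceberg_measure q \<alpha> M"
proof -
  define U where "U = (\<lambda>n. uniform_count_measure {..<q n})"
  have U: "prob_space (U n)" for n
    unfolding U_def using q_ge_2[of n] by (intro prob_space_uniform_count_measure) (auto simp: lessThan_empty_iff)
  interpret product_prob_space U UNIV by (intro product_prob_spaceI U)
  let ?D = "PiM UNIV U"
  have spU: "space (U n) = {..<q n}" "sets (U n) = Pow {..<q n}" for n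
    by (simp_all add: U_def space_uniform_count_measure sets_uniform_count_measure)
  have sp: "d \<in> space ?D \<longleftrightarrow> (\<forall>i. d i < q i)" for d
    by (auto simp: space_PiM spU PiE_def Pi_def)
  have emU: "measure (U i) {a} = 1 / real (q i)" if "a < q i" for i a
    using that by (simp add: U_def measure_uniform_count_measure)
  have h_prod: "real (h n) = (\<Prod>i<n. real (q i))" for n by (induction n) auto
  have pre: "{d\<in>space ?D. coords d n = t} \<in> sets ?D \<and> measure ?D {d\<in>space ?D. coords d n = t} = 1 / h n"
    if t: "t < h n" for n t
  proof -
    obtain c where c: "\<forall>i<n. c i < q i"
      "\<And>d. (\<forall>i. d i < q i) \<Longrightarrow> coords d n = t \<longleftrightarrow> (\<forall>i<n. d i = c i)" using path_prefix[OF t] by blast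
    have eq: "{d\<in>space ?D. coords d n = t} = prod_emb UNIV U {..<n} (PiE {..<n} (\<lambda>i. {c i}))"
    proof (intro set_eqI)
      fix d
      have "d \<in> prod_emb UNIV U {..<n} (PiE {..<n} (\<lambda>i. {c i})) \<longleftrightarrow>
          d \<in> space ?D \<and> (\<forall>i<n. d i = c i)"
        by (auto simp: prod_emb_def space_PiM PiE_iff restrict_def extensional_def)
      also have "\<dots> \<longleftrightarrow> d \<in> space ?D \<and> coords d n = t" using c(2)[of d] sp[of d] by blast
      finally show "d \<in> {d\<in>space ?D. coords d n = t} \<longleftrightarrow>
          d \<in> prod_emb UNIV U {..<n} (PiE {..<n} (\<lambda>i. {c i}))" by blast
    qed
    have s: "{c i} \<in> sets (U i)" if "i \<in> {..<n}" for i using that c(1) by (simp add: spU)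
    have "measure ?D {d\<in>space ?D. coords d n = t} = (\<Prod>i<n. measure (U i) {c i})"
      unfolding eq by (rule measure_PiM_emb) (use s in auto)
    also have "\<dots> = 1 / h n" using c(1) by (simp add: emU h_prod prod_dividef)
    finally show ?thesis using eq s by (auto intro!: sets_PiM_I)
  qed
  have meas_n: "(\<lambda>d. coords d n) \<in> borel_measurable ?D" for n
  proof (subst measurable_cong_sets[OF refl, of _ "count_space UNIV"])
    have "(\<lambda>d. coords d n) -` {t} \<inter> space ?D \<in> sets ?D" for t
    proof -
      have e: "(\<lambda>d. coords d n) -` {t} \<inter> space ?D = {d\<in>space ?D. coords d n = t}" by auto
      show ?thesis
      proof (cases "t < h n")
        case True then show ?thesis using pre e by simp
      next
        case False
        then have "{d\<in>space ?D. coords d n = t} = {}" using path_less[of n] by (auto simp: sp)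
        then show ?thesis unfolding e by (simp only: sets.empty_sets)
      qed
    qed
    then show "(\<lambda>d. coords d n) \<in> measurable ?D (count_space UNIV)"
      by (subst measurable_count_space_eq_countable) auto
  qed (simp add: sets_borel_eq_count_space)
  have "coords \<in> measurable ?D (PiM UNIV (\<lambda>_. borel :: nat measure))"
    by (rule measurable_PiM_single') (use meas_n in auto)
  then have "coords \<in> measurable ?D borel"
    by (simp add: measurable_cong_sets[OF refl sets_PiM_equal_borel])
  then have meas: "coords \<in> measurable ?D (restrict_space borel X)"
    using path_in_X sp by (intro measurable_restrict_space2) auto
  let ?M = "distr ?D (restrict_space borel X) coords"
  have "measure ?M {x\<in>X. x n = t} = 1 / real (h n)" if "t < h n" for n t
  proof -
    have "coords -` {x\<in>X. x n = t} \<inter> space ?D = {d\<in>space ?D. coords d n = t}"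
      using path_in_X sp by auto
    then show ?thesis using pre[OF that] by (simp add: measure_distr[OF meas cylinder_sets])
  qed
  then have "is_iceberg_measure q \<alpha> ?M"
    using P.prob_space_distr[OF meas] by (simp add: is_iceberg_measure_def)
  then show ?thesis by blast
qed

theorem ex1_iceberg_measure: "\<exists>!M. is_iceberg_measure q \<alpha> M"
  using iceberg_measure_exists iceberg_measure_unique by blast

lemma is_iceberg_measure: "is_iceberg_measure q \<alpha> \<mu>"
  unfolding iceberg_measure_def by (rule theI') (rule ex1_iceberg_measure)

lemma AE_eventually_neq:
  assumes c: "\<And>n. c n < h n"
  shows "AE x in \<mu>. x \<in> X \<and> (\<forall>\<^sub>F n in sequentially. x (Suc n) mod h n \<noteq> c n)"
proof -
  note mu = is_iceberg_measure[unfolded is_iceberg_measure_def]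
  interpret prob_space \<mu> using mu by blast
  have sets_mu: "sets \<mu> = sets (restrict_space borel X)" using mu by blast
  have space_mu: "space \<mu> = X"
    using sets_eq_imp_space_eq[OF sets_mu] by (simp add: space_restrict_space)
  define A where "A n = {x\<in>X. x (Suc n) mod h n = c n}" for n
  define B where "B n y = {x\<in>X. x (Suc n) = y * h n + c n}" for n y
  have lt: "y * h n + c n < h (Suc n)" if "y < q n" for n y
  proof -
    have "y * h n + c n < (y + 1) * h n" using c by simp
    also have "\<dots> \<le> q n * h n" using that by (intro mult_right_mono) auto
    finally show ?thesis by simp
  qed
  have A_eq: "A n = (\<Union>y<q n. B n y)" for n
  proof (intro set_eqI iffI)
    fix x assume x: "x \<in> A n"
    then have "x (Suc n) < h (Suc n)" unfolding A_def iceberg_space_def by blast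
    then have "x (Suc n) div h n < q n" by (simp add: less_mult_imp_div_less)
    moreover have "x (Suc n) = (x (Suc n) div h n) * h n + c n"
      using x div_mult_mod_eq[of "x (Suc n)" "h n"] by (simp add: A_def)
    ultimately show "x \<in> (\<Union>y<q n. B n y)" using x by (auto simp: A_def B_def)
  qed (use c in \<open>auto simp: A_def B_def\<close>)
  have B_sets: "B n y \<in> sets \<mu>" for n y
    unfolding B_def sets_mu by (rule cylinder_sets)
  have "measure \<mu> (A n) = (\<Sum>y<q n. measure \<mu> (B n y))" for n
    unfolding A_eq using h_pos[of n] B_sets
    by (intro finite_measure_finite_Union) (auto simp: disjoint_family_on_def B_def)
  also have "(\<Sum>y<q n. measure \<mu> (B n y)) = (\<Sum>y<q n. 1 / real (h (Suc n)))" for n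
    unfolding B_def using mu lt by (intro sum.cong) auto
  also have "(\<Sum>y<q n. 1 / real (h (Suc n))) = 1 / real (h n)" for n
    using q_ge_2[of n] by simp
  finally have meas_A: "measure \<mu> (A n) = 1 / real (h n)" for n .
  have le: "1 / real (h n) \<le> (1/2) ^ n" for n
  proof -
    have "(2::real) ^ n \<le> real (h n)" using h_ge[of n] by (metis of_nat_le_iff of_nat_numeral of_nat_power)
    then show ?thesis by (simp add: power_one_over frac_le)
  qed
  have "AE x in \<mu>. \<forall>\<^sub>F n in sequentially. x \<in> space \<mu> - A n"
  proof (rule borel_cantelli_AE1)
    show "A n \<in> sets \<mu>" for n unfolding A_eq using B_sets by auto
    show "emeasure \<mu> (A n) < \<infinity>" for n by (simp add: less_top[symmetric])
    show "summable (\<lambda>n. measure \<mu> (A n))"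
      by (rule summable_comparison_test'[OF summable_geometric[of "1/2::real"], of 0])
         (use le in \<open>auto simp: meas_A\<close>)
  qed
  then show ?thesis
  proof (rule AE_mp, intro AE_I2 impI)
    fix x assume "x \<in> space \<mu>" and ev: "\<forall>\<^sub>F n in sequentially. x \<in> space \<mu> - A n"
    then show "x \<in> X \<and> (\<forall>\<^sub>F n in sequentially. x (Suc n) mod h n \<noteq> c n)"
      using space_mu by (auto simp: A_def elim: eventually_mono)
  qed
qed

lemma \<phi>_step:
  assumes "Suc (u mod h n) < h n"
  shows "\<phi> n (Suc u) = Suc (\<phi> n u) mod h n"
proof -
  have m: "Suc u mod h n = Suc (u mod h n)" and d: "Suc u div h n = u div h n"
    using assms by (auto simp: mod_Suc div_Suc)
  let ?i = "int (u mod h n) - int (\<alpha> n (u div h n))"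
  have "(?i + 1) mod int (h n) = (?i mod int (h n) + 1) mod int (h n)"
    by (simp add: mod_add_left_eq)
  also have "nat \<dots> = Suc (nat (?i mod int (h n))) mod h n"
    using h_pos[of n] by (simp add: nat_mod_distrib nat_add_distrib)
  finally show ?thesis by (simp add: iceberg_proj_def m d algebra_simps)
qed

theorem AE_regular: "AE x in \<mu>. x \<in> R"
proof -
  have "AE x in \<mu>. x \<in> X \<and> (\<forall>\<^sub>F n in sequentially. x (Suc n) mod h n \<noteq> h n - 1)"
    by (rule AE_eventually_neq) (use h_pos in simp)
  then show ?thesis
  proof eventually_elim
    case (elim x)
    then obtain N where N: "\<And>n. n \<ge> N \<Longrightarrow> x (Suc n) mod h n \<noteq> h n - 1"
      by (auto simp: eventually_sequentially)
    have "\<phi> n ((x (Suc n) + 1) mod h (Suc n)) = (x n + 1) mod h n" if n: "n \<ge> N" for n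
    proof -
      have s: "Suc (x (Suc n) mod h n) < h n"
        using N[OF n] mod_less_divisor[OF h_pos, of "x (Suc n)" n] by linarith
      have x: "x (Suc n) < h (Suc n)" "\<phi> n (x (Suc n)) = x n"
        using elim by (auto simp: iceberg_space_def simp del: iceberg_height.simps)
      have "Suc (x (Suc n)) \<noteq> h (Suc n)"
      proof
        assume "Suc (x (Suc n)) = h (Suc n)"
        then have "Suc (x (Suc n)) mod h n = 0" by simp
        then show False using s by (simp add: mod_Suc)
      qed
      then have "(x (Suc n) + 1) mod h (Suc n) = Suc (x (Suc n))" using x(1) by simp
      then show ?thesis using \<phi>_step[OF s] x(2) by simp
    qed
    then show ?case using elim by (auto simp: iceberg_regular_def iceberg_regular_from_def)
  qed
qed

theorem AE_image_regular: "AE x in \<mu>. x \<in> T ` R"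
proof -
  have "AE x in \<mu>. x \<in> X \<and> (\<forall>\<^sub>F n in sequentially. x (Suc n) mod h n \<noteq> 0)"
    by (rule AE_eventually_neq) (use h_pos in simp)
  then show ?thesis
  proof eventually_elim
    case (elim x)
    then obtain N where N: "\<And>n. n \<ge> N \<Longrightarrow> x (Suc n) mod h n \<noteq> 0"
      by (auto simp: eventually_sequentially)
    have x: "x n < h n" "\<phi> n (x (Suc n)) = x n" for n
      using elim by (auto simp: iceberg_space_def)
    define w where "w n = (if x n = 0 then h n - 1 else x n - 1)" for n
    have w_less: "w n < h n" for n using x(1)[of n] h_pos[of n] by (auto simp: w_def)
    have w_Suc: "Suc (w n) mod h n = x n" for n
      using x(1)[of n] h_pos[of n] by (auto simp: w_def)
    have w_\<phi>: "\<phi> n (w (Suc n)) = w n" if n: "n \<ge> N" for n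
    proof -
      have "x (Suc n) \<noteq> 0" using N[OF n] by (metis mod_0)
      then have w: "Suc (w (Suc n)) = x (Suc n)" by (simp add: w_def)
      have s: "Suc (w (Suc n) mod h n) < h n"
        using N[OF n] mod_less_divisor[OF h_pos, of "w (Suc n)" n] w
        by (metis Suc_lessI mod_Suc)
      have "Suc (\<phi> n (w (Suc n))) mod h n = Suc (w n) mod h n"
        using \<phi>_step[OF s] w x(2)[of n] w_Suc[of n] by simp
      then show ?thesis using \<phi>_less[of n "w (Suc n)"] w_less[of n]
        by (auto simp: mod_Suc split: if_splits)
    qed
    obtain z where z: "z \<in> X" "\<And>n. n \<ge> N \<Longrightarrow> z n = w n"
      using X_extend[of N w] w_less w_\<phi> by blast
    have "iceberg_regular_from q \<alpha> N z"
      unfolding iceberg_regular_from_def using z(2) w_Suc x(2) by (simp del: iceberg_height.simps)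
    then have zR: "z \<in> R" and "\<And>n. n \<ge> N \<Longrightarrow> T z n = x n"
      using z T_char(3)[of z N] w_Suc by (auto simp: iceberg_regular_def)
    then have "T z = x" using X_eqI[of "T z" x N] T_char(1)[OF zR] elim by blast
    then show ?case using zR by blast
  qed
qed

end

end

theory Submission
  imports Defs
begin

text \<open>For \<open>e, g \<in> L\<^sup>2\<close> and \<open>K > 0\<close> let \<open>A\<^sub>w e = 1/K \<Sum>\<^sub>t\<^sub><\<^sub>K \<zeta>\<^sup>w\<^sup>t e \<circ> T\<^sup>t\<close>, where \<open>\<zeta>\<close> is a primitive \<open>K\<close>-th root of unity.
  Since \<open>\<Sum>\<^sub>w A\<^sub>w\<^sup>* A\<^sub>w = 1\<close>, approximating \<open>g\<close> by the cyclic space of \<open>e + \<lambda> g\<close> can be done separately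
  in each frequency band, and for some small real \<open>\<lambda>\<close> the error is controlled by
  \<open>\<Sum>\<^sub>w \<parallel>A\<^sub>w e \<and> A\<^sub>w g\<parallel>\<close>. If the infimum over \<open>K\<close> of these sums is \<open>0\<close> for all functions of finitely many
  coordinates, a cyclic vector arises as a uniformly convergent series of small multiples of cylinder functions.

  The sums are estimated on the cyclic groups of order \<open>h\<^sub>n\<close>. A word of level \<open>n + 1\<close> is a concatenation of
  \<open>q\<^sub>n\<close> independent uniform rotations of a word of level \<open>n\<close>, so its windows are sums of independent
  centered vectors \<open>a\<^sub>y \<in> \<complex>\<^sup>2\<close>. The products \<open>a\<^sub>y \<and> a\<^sub>y\<^sub>'\<close> are pairwise orthogonal, hence the mean square of the
  area at level \<open>n + 1\<close> is an explicit multiple, at most \<open>2/3\<close>, of the area at level \<open>n\<close>, and the expected sum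
  decays geometrically up to an error \<open>2 / \<surd>q\<^sub>n\<close> from incomplete blocks.\<close>

section \<open>The geometry of \<open>L\<^sup>2\<close>\<close>

text \<open>Over \<open>K\<close> steps \<open>T\<close> follows the cyclic shift of order
  \<open>h m\<close> except on a set of measure at most \<open>2 * K / h m\<close>. A window as long
  as the whole word, for which the factor 2/3 is available, is therefore too long for
  \<open>T\<close>. Hence two kinds of windows: complete words up to level \<open>N\<close>, and at
  level \<open>N + 1\<close> windows of \<open>K = L * h N\<close> letters, where \<open>L\<close>
  grows but \<open>L / q N\<close> tends to 0; this last step does not contract, it only costs
  \<open>2 / sqrt L\<close>. All steps use the same \<open>K\<close> frequencies, which makes them
  comparable, since Parseval holds for every window of at most \<open>K\<close> letters.

  The factor 2/3 is the mean of 1 - (1 - 2x)^2 over [0, 1]. Two complete windows shifted by a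
  fraction x of the word share nearly all blocks, with one phase on a fraction x and another on 1 -
  x, so their correlation is about |1 - 2x| or more at every frequency.

  The window sums have mean zero only for centered words, so indicators are replaced by centered
  ones. Convergence of the expected sums to 0 yields, almost surely, small sums at infinitely many
  levels, which is enough for the infimum over \<open>K\<close>.\<close>

definition L2_inner :: "'a measure \<Rightarrow> ('a \<Rightarrow> complex) \<Rightarrow> ('a \<Rightarrow> complex) \<Rightarrow> complex" where
  "L2_inner M f g = (\<integral>x. f x * cnj (g x) \<partial>M)"

definition L2_nsq :: "'a measure \<Rightarrow> ('a \<Rightarrow> complex) \<Rightarrow> real" where
  "L2_nsq M f = (\<integral>x. (cmod (f x))\<^sup>2 \<partial>M)"

definition L2_norm :: "'a measure \<Rightarrow> ('a \<Rightarrow> complex) \<Rightarrow> real" where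
  "L2_norm M f = sqrt (L2_nsq M f)"

text \<open>The norm of \<open>u \<and> v\<close> in the exterior square of \<open>L\<^sup>2\<close>.\<close>

definition L2_area :: "'a measure \<Rightarrow> ('a \<Rightarrow> complex) \<Rightarrow> ('a \<Rightarrow> complex) \<Rightarrow> real" where
  "L2_area M u v = sqrt (L2_nsq M u * L2_nsq M v - (cmod (L2_inner M u v))\<^sup>2)"

lemma L2_dist_norm: "L2_dist M f g = L2_norm M (\<lambda>x. f x - g x)"
  by (simp add: L2_dist_def L2_norm_def L2_nsq_def)

lemma L2_nsq_nonneg [simp]: "0 \<le> L2_nsq M f"
  by (simp add: L2_nsq_def)

lemma L2_norm_nonneg [simp]: "0 \<le> L2_norm M f"
  by (simp add: L2_norm_def)

lemma L2_norm_sq: "(L2_norm M f)\<^sup>2 = L2_nsq M f"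
  by (simp add: L2_norm_def)

lemma L2_meas: "f \<in> L2_funs M \<Longrightarrow> f \<in> borel_measurable M"
  by (simp add: L2_funs_def)

lemma L2_int: "f \<in> L2_funs M \<Longrightarrow> integrable M (\<lambda>x. (cmod (f x))\<^sup>2)"
  by (simp add: L2_funs_def)

lemma measurable_cnj [measurable (raw)]:
  assumes "g \<in> borel_measurable M" shows "(\<lambda>x. cnj (g x)) \<in> borel_measurable M"
  by (rule measurable_compose[OF assms]) (intro borel_measurable_continuous_onI continuous_intros)

lemma L2_mult_int:
  assumes f: "f \<in> L2_funs M" and g: "g \<in> L2_funs M"
  shows "integrable M (\<lambda>x. f x * cnj (g x))"
proof (rule Bochner_Integration.integrable_bound)
  show "integrable M (\<lambda>x. (cmod (f x))\<^sup>2 + (cmod (g x))\<^sup>2)"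
    using f g by (intro Bochner_Integration.integrable_add L2_int)
  show "(\<lambda>x. f x * cnj (g x)) \<in> borel_measurable M"
    by (intro borel_measurable_times measurable_cnj L2_meas assms)
  have "a * b \<le> a\<^sup>2 + b\<^sup>2" if "0 \<le> a" "0 \<le> b" for a b :: real
  proof -
    have "2 * (a * b) \<le> a\<^sup>2 + b\<^sup>2" using sum_squares_bound[of a b] by (simp add: algebra_simps)
    then show ?thesis using mult_nonneg_nonneg[OF that] by linarith
  qed
  then show "AE x in M. norm (f x * cnj (g x)) \<le> norm ((cmod (f x))\<^sup>2 + (cmod (g x))\<^sup>2)"
    by (simp add: norm_mult)
qed

lemma cmod_sq_lincomb:
  "(cmod (a * p + b * q))\<^sup>2 =
     (cmod a)\<^sup>2 * (cmod p)\<^sup>2 + (cmod b)\<^sup>2 * (cmod q)\<^sup>2 + 2 * Re (a * cnj b * (p * cnj q))"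
proof -
  have "complex_of_real ((cmod (a * p + b * q))\<^sup>2) = (a * p + b * q) * cnj (a * p + b * q)"
    by (simp only: complex_norm_square)
  also have "\<dots> = (a * cnj a) * (p * cnj p) + (b * cnj b) * (q * cnj q) +
      (a * cnj b * (p * cnj q) + cnj (a * cnj b * (p * cnj q)))"
    by (simp add: algebra_simps)
  also have "\<dots> = complex_of_real ((cmod a)\<^sup>2 * (cmod p)\<^sup>2 + (cmod b)\<^sup>2 * (cmod q)\<^sup>2 + 2 * Re (a * cnj b * (p * cnj q)))"
    by (simp only: complex_norm_square complex_add_cnj of_real_add of_real_mult)
  finally show ?thesis by (simp only: of_real_eq_iff)
qed

lemma L2_lincomb:
  assumes f: "f \<in> L2_funs M" and g: "g \<in> L2_funs M"
  shows "(\<lambda>x. a * f x + b * g x) \<in> L2_funs M"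
    and "L2_nsq M (\<lambda>x. a * f x + b * g x) =
      (cmod a)\<^sup>2 * L2_nsq M f + (cmod b)\<^sup>2 * L2_nsq M g + 2 * Re (a * cnj b * L2_inner M f g)"
proof -
  note int = L2_int[OF f] L2_int[OF g] L2_mult_int[OF f g]
  have [measurable]: "f \<in> borel_measurable M" "g \<in> borel_measurable M" using f g by (auto dest: L2_meas)
  have "(\<lambda>x. a * f x + b * g x) \<in> borel_measurable M" by measurable
  moreover have "integrable M (\<lambda>x. (cmod (a * f x + b * g x))\<^sup>2)"
    unfolding cmod_sq_lincomb using int
    by (intro Bochner_Integration.integrable_add integrable_mult_right integrable_Re) auto
  ultimately show "(\<lambda>x. a * f x + b * g x) \<in> L2_funs M" by (simp add: L2_funs_def)
  have i3: "integrable M (\<lambda>x. 2 * Re (a * cnj b * (f x * cnj (g x))))"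
    using int by (intro integrable_mult_right integrable_Re) auto
  have "(\<integral>x. Re (a * cnj b * (f x * cnj (g x))) \<partial>M) = Re (\<integral>x. a * cnj b * (f x * cnj (g x)) \<partial>M)"
    using int by (intro integral_Re integrable_mult_right) auto
  then have 3: "(\<integral>x. Re (a * cnj b * (f x * cnj (g x))) \<partial>M) = Re (a * cnj b * L2_inner M f g)"
    by (simp only: L2_inner_def integral_mult_right_zero)
  show "L2_nsq M (\<lambda>x. a * f x + b * g x) =
      (cmod a)\<^sup>2 * L2_nsq M f + (cmod b)\<^sup>2 * L2_nsq M g + 2 * Re (a * cnj b * L2_inner M f g)"
    unfolding L2_nsq_def cmod_sq_lincomb
    by (subst Bochner_Integration.integral_add;
        (subst Bochner_Integration.integral_add)?) (use int i3 in \<open>simp_all only: 3 integral_mult_right_zero integrable_mult_right Bochner_Integration.integrable_add\<close>)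
qed

lemma L2_scale:
  assumes "f \<in> L2_funs M"
  shows "(\<lambda>x. a * f x) \<in> L2_funs M" "L2_nsq M (\<lambda>x. a * f x) = (cmod a)\<^sup>2 * L2_nsq M f"
    "L2_norm M (\<lambda>x. a * f x) = cmod a * L2_norm M f"
  using L2_lincomb[OF assms assms, of a 0] by (simp_all add: L2_norm_def real_sqrt_mult)

lemma L2_add: "f \<in> L2_funs M \<Longrightarrow> g \<in> L2_funs M \<Longrightarrow> (\<lambda>x. f x + g x) \<in> L2_funs M"
  using L2_lincomb(1)[of f M g 1 1] by simp

lemma L2_diff: "f \<in> L2_funs M \<Longrightarrow> g \<in> L2_funs M \<Longrightarrow> (\<lambda>x. f x - g x) \<in> L2_funs M"
  using L2_lincomb(1)[of f M g 1 "-1"] by simp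

lemma L2_zero: "(\<lambda>x. 0) \<in> L2_funs M"
  by (simp add: L2_funs_def)

lemma L2_sum: "(\<And>i. i \<in> I \<Longrightarrow> f i \<in> L2_funs M) \<Longrightarrow> (\<lambda>x. \<Sum>i\<in>I. f i x) \<in> L2_funs M"
  by (induction I rule: infinite_finite_induct) (auto simp: L2_zero intro: L2_add)

lemma L2_inner_cnj: "L2_inner M g f = cnj (L2_inner M f g)"
  unfolding L2_inner_def by (subst Bochner_Integration.integral_cnj[symmetric]) (simp add: mult.commute)

lemma L2_inner_self: "L2_inner M f f = complex_of_real (L2_nsq M f)"
  unfolding L2_inner_def L2_nsq_def
  by (simp only: complex_norm_square[symmetric] integral_complex_of_real)

lemma L2_inner_add_left:
  assumes "f \<in> L2_funs M" "f' \<in> L2_funs M" "g \<in> L2_funs M"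
  shows "L2_inner M (\<lambda>x. f x + f' x) g = L2_inner M f g + L2_inner M f' g"
  unfolding L2_inner_def using assms by (simp add: L2_mult_int distrib_right)

lemma L2_inner_scale_left: "L2_inner M (\<lambda>x. a * f x) g = a * L2_inner M f g"
  unfolding L2_inner_def by (simp only: mult.assoc integral_mult_right_zero)

lemma L2_inner_sum_left:
  assumes "\<And>i. i \<in> I \<Longrightarrow> f i \<in> L2_funs M" "g \<in> L2_funs M"
  shows "L2_inner M (\<lambda>x. \<Sum>i\<in>I. f i x) g = (\<Sum>i\<in>I. L2_inner M (f i) g)"
  unfolding L2_inner_def sum_distrib_right using assms
  by (intro Bochner_Integration.integral_sum L2_mult_int)

lemma L2_inner_sum_right:
  assumes "\<And>i. i \<in> I \<Longrightarrow> f i \<in> L2_funs M" "g \<in> L2_funs M"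
  shows "L2_inner M g (\<lambda>x. \<Sum>i\<in>I. f i x) = (\<Sum>i\<in>I. L2_inner M g (f i))"
proof -
  have "L2_inner M g (\<lambda>x. \<Sum>i\<in>I. f i x) = cnj (\<Sum>i\<in>I. L2_inner M (f i) g)"
    by (subst L2_inner_cnj) (simp only: L2_inner_sum_left[OF assms])
  then show ?thesis by (simp add: L2_inner_cnj[of M g])
qed

lemma L2_inner_scale_right: "L2_inner M g (\<lambda>x. a * f x) = cnj a * L2_inner M g f"
  by (subst L2_inner_cnj) (simp add: L2_inner_scale_left L2_inner_cnj[of M g])

text \<open>The vector \<open>\<parallel>v\<parallel>\<^sup>2 u - \<langle>u,v\<rangle> v\<close> is \<open>\<parallel>v\<parallel>\<^sup>2\<close> times the component of \<open>u\<close> orthogonal to \<open>v\<close>.\<close>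

lemma L2_perp:
  assumes u: "u \<in> L2_funs M" and v: "v \<in> L2_funs M"
  shows "L2_nsq M (\<lambda>x. of_real (L2_nsq M v) * u x + (- L2_inner M u v) * v x) =
    L2_nsq M v * (L2_nsq M u * L2_nsq M v - (cmod (L2_inner M u v))\<^sup>2)"
proof -
  let ?i = "L2_inner M u v"
  have "Re (of_real (L2_nsq M v) * cnj (- ?i) * ?i) = - L2_nsq M v * (cmod ?i)\<^sup>2"
    unfolding cmod_power2 by (simp add: power2_eq_square algebra_simps)
  then show ?thesis
    by (subst L2_lincomb(2)[OF u v]) (simp add: power2_eq_square algebra_simps)
qed

lemma L2_Cauchy_Schwarz_sq:
  assumes u: "u \<in> L2_funs M" and v: "v \<in> L2_funs M"
  shows "(cmod (L2_inner M u v))\<^sup>2 \<le> L2_nsq M u * L2_nsq M v"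
proof (cases "L2_nsq M v = 0")
  case True
  then have "AE x in M. (cmod (v x))\<^sup>2 = 0"
    unfolding L2_nsq_def using L2_int[OF v] by (subst (asm) integral_nonneg_eq_0_iff_AE) auto
  then have "L2_inner M u v = (\<integral>x. 0 \<partial>M)"
    unfolding L2_inner_def using L2_mult_int[OF u v] by (intro integral_cong_AE) auto
  then show ?thesis using True by simp
next
  case False
  then have "0 < L2_nsq M v" using L2_nsq_nonneg[of M v] by linarith
  moreover have "0 \<le> L2_nsq M v * (L2_nsq M u * L2_nsq M v - (cmod (L2_inner M u v))\<^sup>2)"
    unfolding L2_perp[OF u v, symmetric] by simp
  ultimately show ?thesis by (simp add: zero_le_mult_iff)
qed

lemma L2_Cauchy_Schwarz:
  assumes "u \<in> L2_funs M" "v \<in> L2_funs M"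
  shows "cmod (L2_inner M u v) \<le> L2_norm M u * L2_norm M v"
  using real_sqrt_le_mono[OF L2_Cauchy_Schwarz_sq[OF assms]] by (simp add: L2_norm_def real_sqrt_mult)

lemma L2_norm_triangle:
  assumes u: "u \<in> L2_funs M" and v: "v \<in> L2_funs M"
  shows "L2_norm M (\<lambda>x. u x + v x) \<le> L2_norm M u + L2_norm M v"
proof (rule power2_le_imp_le)
  have "(L2_norm M (\<lambda>x. u x + v x))\<^sup>2 = L2_nsq M u + L2_nsq M v + 2 * Re (L2_inner M u v)"
    using L2_lincomb(2)[OF u v, of 1 1] by (simp add: L2_norm_sq)
  also have "\<dots> \<le> L2_nsq M u + L2_nsq M v + 2 * (L2_norm M u * L2_norm M v)"
    using L2_Cauchy_Schwarz[OF u v] complex_Re_le_cmod[of "L2_inner M u v"] by linarith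
  finally show "(L2_norm M (\<lambda>x. u x + v x))\<^sup>2 \<le> (L2_norm M u + L2_norm M v)\<^sup>2"
    by (simp add: power2_sum L2_norm_sq)
qed simp

lemma L2_norm_sum_le:
  assumes "finite I" "\<And>i. i \<in> I \<Longrightarrow> f i \<in> L2_funs M"
  shows "L2_norm M (\<lambda>x. \<Sum>i\<in>I. f i x) \<le> (\<Sum>i\<in>I. L2_norm M (f i))"
  using assms
proof (induction I)
  case empty
  then show ?case by (simp add: L2_norm_def L2_nsq_def)
next
  case (insert i I)
  then show ?case
    using L2_norm_triangle[of "f i" M "\<lambda>x. \<Sum>i\<in>I. f i x"] L2_sum[of I f M] by auto
qed

lemma L2_nsq_cong_AE:
  assumes "f \<in> borel_measurable M" "g \<in> borel_measurable M" "AE x in M. f x = g x"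
  shows "L2_nsq M f = L2_nsq M g"
  unfolding L2_nsq_def
proof (rule integral_cong_AE)
  show "AE x in M. (cmod (f x))\<^sup>2 = (cmod (g x))\<^sup>2" using assms(3) by auto
qed (use assms in measurable)

lemma L2_inner_cong_AE:
  assumes [measurable]: "f \<in> borel_measurable M" "f' \<in> borel_measurable M"
    "g \<in> borel_measurable M" "g' \<in> borel_measurable M"
    and "AE x in M. f x = f' x" "AE x in M. g x = g' x"
  shows "L2_inner M f g = L2_inner M f' g'"
  unfolding L2_inner_def
proof (rule integral_cong_AE)
  show "AE x in M. f x * cnj (g x) = f' x * cnj (g' x)" using assms(5,6) by auto
qed measurable

lemma L2_bounded:
  assumes "finite_measure M" "f \<in> borel_measurable M" "\<And>x. x \<in> space M \<Longrightarrow> cmod (f x) \<le> B"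
  shows "f \<in> L2_funs M"
proof -
  interpret finite_measure M by fact
  have "integrable M (\<lambda>x. (cmod (f x))\<^sup>2)"
  proof (rule integrable_const_bound)
    show "AE x in M. norm ((cmod (f x))\<^sup>2) \<le> B\<^sup>2" using assms(3) by (auto intro!: AE_I2 power_mono)
  qed (use assms(2) in measurable)
  then show ?thesis using assms(2) by (simp add: L2_funs_def)
qed

lemma L2_nsq_bound:
  assumes "prob_space M" "f \<in> borel_measurable M" "\<And>x. x \<in> space M \<Longrightarrow> (cmod (f x))\<^sup>2 \<le> B"
  shows "L2_nsq M f \<le> B"
proof -
  interpret prob_space M by fact
  have "integrable M (\<lambda>x. (cmod (f x))\<^sup>2)"
    by (rule integrable_const_bound[of _ B]) (use assms(2,3) in \<open>auto intro!: AE_I2 borel_measurable_power borel_measurable_norm measurable_compose[OF _ borel_measurable_norm]\<close>)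
  then have "L2_nsq M f \<le> (\<integral>x. B \<partial>M)" unfolding L2_nsq_def
    by (rule integral_mono) (use assms(3) in auto)
  then show ?thesis by (simp add: prob_space)
qed

section \<open>Areas of pairs of vectors\<close>

lemma L2_area_nonneg:
  assumes "u \<in> L2_funs M" "v \<in> L2_funs M" shows "0 \<le> L2_area M u v"
  using L2_Cauchy_Schwarz_sq[OF assms] by (simp add: L2_area_def)

lemma L2_area_sq:
  assumes "u \<in> L2_funs M" "v \<in> L2_funs M"
  shows "(L2_area M u v)\<^sup>2 = L2_nsq M u * L2_nsq M v - (cmod (L2_inner M u v))\<^sup>2"
  using L2_Cauchy_Schwarz_sq[OF assms] by (simp add: L2_area_def)

lemma L2_area_le:
  assumes "u \<in> L2_funs M" "v \<in> L2_funs M" shows "L2_area M u v \<le> L2_norm M u * L2_norm M v"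
  unfolding L2_area_def L2_norm_def real_sqrt_mult[symmetric] by simp

lemma L2_area_commute: "L2_area M u v = L2_area M v u"
  unfolding L2_area_def by (subst L2_inner_cnj) (simp add: mult.commute)

lemma L2_area_perp:
  assumes u: "u \<in> L2_funs M" and v: "v \<in> L2_funs M"
  shows "L2_norm M v * L2_area M u v =
    L2_norm M (\<lambda>x. of_real (L2_nsq M v) * u x + (- L2_inner M u v) * v x)"
  unfolding L2_norm_def L2_perp[OF u v] L2_area_def by (simp add: real_sqrt_mult)

text \<open>For fixed \<open>v\<close> the component of \<open>u\<close> orthogonal to
  \<open>v\<close> depends linearly on \<open>u\<close>. Up to the norm of \<open>v\<close> the area
  is the norm of that component, so it inherits the triangle inequality.\<close>

lemma L2_area_triangle:
  assumes u: "u \<in> L2_funs M" and u': "u' \<in> L2_funs M" and v: "v \<in> L2_funs M"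
  shows "L2_area M (\<lambda>x. u x + u' x) v \<le> L2_area M u v + L2_area M u' v"
proof (cases "L2_nsq M v = 0")
  case True
  then show ?thesis
    using L2_area_nonneg[OF u v] L2_area_nonneg[OF u' v] by (simp add: L2_area_def)
next
  case False
  then have pos: "0 < L2_norm M v" by (simp add: L2_norm_def order_less_le)
  let ?p = "\<lambda>u x. of_real (L2_nsq M v) * u x + (- L2_inner M u v) * v x"
  have eq: "?p (\<lambda>x. u x + u' x) = (\<lambda>x. ?p u x + ?p u' x)"
    by (simp add: L2_inner_add_left[OF u u' v] algebra_simps)
  have "L2_norm M v * L2_area M (\<lambda>x. u x + u' x) v = L2_norm M (\<lambda>x. ?p u x + ?p u' x)"
    unfolding L2_area_perp[OF L2_add[OF u u'] v] eq ..
  also have "\<dots> \<le> L2_norm M (?p u) + L2_norm M (?p u')"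
    by (intro L2_norm_triangle L2_lincomb(1) u u' v)
  also have "\<dots> = L2_norm M v * (L2_area M u v + L2_area M u' v)"
    unfolding L2_area_perp[OF u v, symmetric] L2_area_perp[OF u' v, symmetric] by (simp add: algebra_simps)
  finally show ?thesis using pos by simp
qed

lemma L2_area_scale:
  assumes u: "u \<in> L2_funs M" shows "L2_area M (\<lambda>x. a * u x) v = cmod a * L2_area M u v"
proof -
  have "L2_area M (\<lambda>x. a * u x) v = sqrt ((cmod a)\<^sup>2 * (L2_nsq M u * L2_nsq M v - (cmod (L2_inner M u v))\<^sup>2))"
    unfolding L2_area_def L2_scale[OF u] L2_inner_scale_left
    by (simp add: norm_mult power_mult_distrib algebra_simps)
  then show ?thesis unfolding L2_area_def real_sqrt_mult by simp
qed

text \<open>One factor is replaced at a time, so each error is a product of a difference and a norm.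
  Summed over frequencies, such products are controlled by Parseval through
  \<open>sum_L2_norm_prod_le\<close>.\<close>

lemma L2_area_perturb:
  assumes u: "u \<in> L2_funs M" and u': "u' \<in> L2_funs M" and v: "v \<in> L2_funs M" and v': "v' \<in> L2_funs M"
  shows "L2_area M u v \<le> L2_area M u' v' + L2_norm M (\<lambda>x. u x - u' x) * L2_norm M v +
    L2_norm M u' * L2_norm M (\<lambda>x. v x - v' x)"
proof -
  have "L2_area M u v \<le> L2_area M (\<lambda>x. u x - u' x) v + L2_area M u' v"
    using L2_area_triangle[OF L2_diff[OF u u'] u' v] by simp
  moreover have "L2_area M u' v \<le> L2_area M u' (\<lambda>x. v x - v' x) + L2_area M u' v'"
    using L2_area_triangle[OF L2_diff[OF v v'] v' u'] by (simp add: L2_area_commute[of M u'])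
  moreover have "L2_area M (\<lambda>x. u x - u' x) v \<le> L2_norm M (\<lambda>x. u x - u' x) * L2_norm M v"
    by (intro L2_area_le L2_diff assms)
  moreover have "L2_area M u' (\<lambda>x. v x - v' x) \<le> L2_norm M u' * L2_norm M (\<lambda>x. v x - v' x)"
    by (intro L2_area_le L2_diff assms)
  ultimately show ?thesis by linarith
qed

text \<open>Elimination of \<open>v\<close> by \<open>u + \<lambda> v\<close>: completing the square in \<open>\<lambda>\<close> shows that the residual is small
  unless \<open>\<lambda>\<close> is close to one exceptional value.\<close>

lemma L2_residual:
  assumes u: "u \<in> L2_funs M" and v: "v \<in> L2_funs M" and s: "0 < s"
  shows "\<exists>l0. \<forall>l::real. \<exists>p. L2_nsq M (\<lambda>x. v x - p * (u x + of_real l * v x)) \<le>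
     (if \<bar>l - l0\<bar> < s / 2 then L2_nsq M v else L2_area M u v / s)"
proof -
  let ?b = "L2_nsq M v" and ?i = "L2_inner M u v" and ?A = "L2_area M u v"
  \<comment> \<open>The real parameter at which \<open>u + l v\<close> is shortest. If
    \<open>v\<close> has norm 0 the division gives 0, and \<open>p = 0\<close> settles that
    case.\<close>
  define l0 where "l0 = - Re ?i / ?b"
  show ?thesis
  proof (rule exI[of _ l0], rule allI)
    fix l :: real
    define f where "f = (\<lambda>x. u x + of_real l * v x)"
    have fL: "f \<in> L2_funs M" unfolding f_def using L2_lincomb(1)[OF u v, of 1 "of_real l"] by simp
    show "\<exists>p. L2_nsq M (\<lambda>x. v x - p * (u x + of_real l * v x)) \<le>
     (if \<bar>l - l0\<bar> < s / 2 then ?b else ?A / s)"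
    proof (cases "\<bar>l - l0\<bar> < s / 2 \<or> ?b = 0")
      case True
      have "0 \<le> ?A / s" using L2_area_nonneg[OF u v] s by simp
      then show ?thesis using True by (intro exI[of _ 0]) auto
    next
      case False
      then have b: "0 < ?b" and l: "s / 2 \<le> \<bar>l - l0\<bar>" using L2_nsq_nonneg[of M v] by linarith+
      have nf: "L2_nsq M f = L2_nsq M u + l\<^sup>2 * ?b + 2 * l * Re ?i"
        unfolding f_def using L2_lincomb(2)[OF u v, of 1 "of_real l"] by simp
      have A2: "?A\<^sup>2 = L2_nsq M u * ?b - ((Re ?i)\<^sup>2 + (Im ?i)\<^sup>2)"
        using L2_area_sq[OF u v] by (simp add: cmod_power2)
      have bl0: "?b * l0 = - Re ?i" using b by (simp add: l0_def)
      have bf: "?b * L2_nsq M f = (?b * (l - l0))\<^sup>2 + ?A\<^sup>2 + (Im ?i)\<^sup>2"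
        unfolding nf A2 right_diff_distrib bl0 by (simp add: power2_eq_square algebra_simps)
      have nA: "0 \<le> ?A" by (rule L2_area_nonneg[OF u v])
      \<comment> \<open>The inequality of arithmetic and geometric means turns the two squares in
        \<open>bf\<close> into a bound linear in the area. Linearity matters: the quantity
        controlled later is the sum of the areas, not of their squares.\<close>
      have "?b * (s * ?A) \<le> 2 * (?b * \<bar>l - l0\<bar> * ?A)"
        using l b nA mult_right_mono[of s "2 * \<bar>l - l0\<bar>" "?b * ?A"] by (simp add: algebra_simps)
      also have "\<dots> \<le> (?b * \<bar>l - l0\<bar>)\<^sup>2 + ?A\<^sup>2"
        using sum_squares_bound[of "?b * \<bar>l - l0\<bar>" ?A] by (simp add: algebra_simps)
      also have "\<dots> \<le> ?b * L2_nsq M f" unfolding bf by (simp add: power_mult_distrib)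
      finally have sA: "s * ?A \<le> L2_nsq M f" using b by simp
      have fpos: "0 < L2_nsq M f"
      proof -
        have "0 < \<bar>l - l0\<bar>" using l s by linarith
        then have "0 < (?b * (l - l0))\<^sup>2" using b by simp
        then have "0 < ?b * L2_nsq M f" unfolding bf by (smt (verit) zero_le_power2)
        then show ?thesis using b by (simp add: zero_less_mult_iff)
      qed
      define j where "j = L2_inner M v f"
      have j: "j = cnj ?i + of_real (l * ?b)"
      proof -
        have "L2_inner M f v = ?i + of_real l * of_real ?b"
          unfolding f_def using L2_inner_add_left[OF u L2_scale(1)[OF v, of "of_real l"] v]
          by (simp add: L2_inner_scale_left L2_inner_self)
        then show ?thesis unfolding j_def by (subst L2_inner_cnj) simp
      qed
      define p where "p = j / of_real (L2_nsq M f)"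
      \<comment> \<open>The pair \<open>f\<close>, \<open>v\<close> has the same area as
        \<open>u\<close>, \<open>v\<close>, because \<open>f\<close> differs from \<open>u\<close>
        by a multiple of \<open>v\<close>; and \<open>p\<close> is the coefficient of the orthogonal
        projection of \<open>v\<close> to \<open>f\<close>.\<close>
      have det: "?b * L2_nsq M f - (cmod j)\<^sup>2 = ?A\<^sup>2"
        unfolding nf A2 j cmod_power2 by (simp add: power2_eq_square algebra_simps)
      have "L2_nsq M (\<lambda>x. v x - p * f x) = ?b + (cmod p)\<^sup>2 * L2_nsq M f + 2 * Re (cnj (- p) * j)"
        using L2_lincomb(2)[OF v fL, of 1 "- p"] by (simp add: j_def)
      also have "Re (cnj (- p) * j) = - (cmod j)\<^sup>2 / L2_nsq M f"
        unfolding p_def cmod_power2 using fpos by (simp add: power2_eq_square divide_simps)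
      also have "(cmod p)\<^sup>2 * L2_nsq M f = (cmod j)\<^sup>2 / L2_nsq M f"
        unfolding p_def using fpos by (simp add: norm_divide power_divide power2_eq_square)
      also have "?b + (cmod j)\<^sup>2 / L2_nsq M f + 2 * (- (cmod j)\<^sup>2 / L2_nsq M f) = ?A\<^sup>2 / L2_nsq M f"
        unfolding det[symmetric] using fpos by (simp add: field_simps)
      also have "\<dots> \<le> ?A / s"
      proof -
        have "?A\<^sup>2 * s \<le> ?A * L2_nsq M f"
          using mult_left_mono[OF sA nA] by (simp add: power2_eq_square algebra_simps)
        then show ?thesis using fpos s by (simp add: divide_simps)
      qed
      finally show ?thesis using False unfolding f_def by auto
    qed
  qed
qed

section \<open>Roots of unity\<close>

definition root_unity :: "nat \<Rightarrow> nat \<Rightarrow> complex" where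
  "root_unity K w = exp (2 * of_real pi * \<i> * of_nat w / of_nat K)"

lemma norm_root_unity [simp]: "cmod (root_unity K w) = 1"
  by (simp add: root_unity_def norm_exp_eq_Re)

lemma root_unity_nz [simp]: "root_unity K w \<noteq> 0"
  by (simp add: root_unity_def)

lemma root_unity_swap: "root_unity K w ^ t = root_unity K t ^ w"
  by (simp add: root_unity_def exp_of_nat_mult[symmetric] algebra_simps)

lemma root_unity_pow: "0 < K \<Longrightarrow> root_unity K w ^ K = 1"
  unfolding root_unity_swap[of K w K] by (simp add: root_unity_def)

lemma root_unity_0 [simp]: "root_unity K 0 = 1"
  by (simp add: root_unity_def)

lemma root_unity_eq_iff: "0 < K \<Longrightarrow> root_unity K t = root_unity K t' \<longleftrightarrow> t mod K = t' mod K"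
  unfolding root_unity_def using complex_root_unity_eq[of K t t'] by simp

lemma unit_cnj: "cmod z = 1 \<Longrightarrow> z * cnj z = 1"
  by (simp add: complex_norm_square[symmetric])

lemma root_unity_orth:
  assumes K: "0 < K"
  shows "(\<Sum>w<K. root_unity K w ^ t * cnj (root_unity K w ^ t')) = (if t mod K = t' mod K then of_nat K else 0)"
proof -
  let ?r = "root_unity K t * cnj (root_unity K t')"
  have eq: "root_unity K w ^ t * cnj (root_unity K w ^ t') = ?r ^ w" for w
    by (simp add: root_unity_swap[of K w] power_mult_distrib)
  have one: "?r = 1 \<longleftrightarrow> t mod K = t' mod K"
  proof -
    have "?r = 1 \<longleftrightarrow> ?r * root_unity K t' = root_unity K t'" by simp
    also have "\<dots> \<longleftrightarrow> root_unity K t = root_unity K t'"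
      using unit_cnj[of "root_unity K t'"] by (simp add: mult.assoc mult.commute[of "cnj _"])
    finally show ?thesis using root_unity_eq_iff[OF K] by simp
  qed
  have "?r ^ K = 1" using K by (simp add: power_mult_distrib root_unity_pow complex_cnj_power[symmetric] del: complex_cnj_power)
  then show ?thesis unfolding eq using one geometric_sum[of ?r K] by auto
qed

lemma root_unity_sum: "0 < w \<Longrightarrow> w < K \<Longrightarrow> (\<Sum>t<K. root_unity K w ^ t) = 0"
  using root_unity_orth[of K w 0] by (simp add: root_unity_swap[of K w])

lemma root_unity_Parseval:
  assumes K: "0 < K" and S: "finite S" "inj_on (\<lambda>u. u mod K) S"
  shows "(\<Sum>w<K. (cmod (\<Sum>u\<in>S. b u * root_unity K w ^ u))\<^sup>2) = K * (\<Sum>u\<in>S. (cmod (b u))\<^sup>2)"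
proof -
  let ?z = "root_unity K"
  have "complex_of_real (\<Sum>w<K. (cmod (\<Sum>u\<in>S. b u * ?z w ^ u))\<^sup>2) =
      (\<Sum>w<K. \<Sum>u\<in>S. \<Sum>u'\<in>S. b u * cnj (b u') * (?z w ^ u * cnj (?z w ^ u')))"
    unfolding of_real_sum complex_norm_square cnj_sum sum_product
    by (simp add: algebra_simps)
  also have "\<dots> = (\<Sum>u\<in>S. \<Sum>w<K. \<Sum>u'\<in>S. b u * cnj (b u') * (?z w ^ u * cnj (?z w ^ u')))"
    by (rule sum.swap)
  also have "\<dots> = (\<Sum>u\<in>S. \<Sum>u'\<in>S. b u * cnj (b u') * (\<Sum>w<K. ?z w ^ u * cnj (?z w ^ u')))"
    unfolding sum_distrib_left by (rule sum.cong[OF refl], rule sum.swap)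
  also have "\<dots> = (\<Sum>u\<in>S. \<Sum>u'\<in>S. if u' = u then b u * cnj (b u) * of_nat K else 0)"
    unfolding root_unity_orth[OF K] using S(2) by (intro sum.cong refl) (auto simp: inj_on_def)
  also have "\<dots> = (\<Sum>u\<in>S. b u * cnj (b u) * of_nat K)"
    using S(1) by simp
  also have "\<dots> = complex_of_real (K * (\<Sum>u\<in>S. (cmod (b u))\<^sup>2))"
    unfolding complex_norm_square[symmetric] by (simp add: sum_distrib_left mult.commute)
  finally show ?thesis by (simp only: of_real_eq_iff)
qed

section \<open>Cyclic vectors of Koopman operators\<close>

lemma complex_fun_span_0: "(\<lambda>x. 0) \<in> complex_fun_span A"
  unfolding complex_fun_span_def by (rule CollectI, rule exI[of _ "{}"]) auto

lemma complex_fun_span_base: "f \<in> A \<Longrightarrow> (\<lambda>x. a * f x) \<in> complex_fun_span A"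
  unfolding complex_fun_span_def by (rule CollectI, rule exI[of _ "{f}"], rule exI[of _ "\<lambda>_. a"]) auto

lemma complex_fun_span_add:
  assumes "f \<in> complex_fun_span A" "g \<in> complex_fun_span A"
  shows "(\<lambda>x. f x + g x) \<in> complex_fun_span A"
proof -
  obtain F c where F: "finite F" "F \<subseteq> A" "f = (\<lambda>x. \<Sum>h\<in>F. c h * h x)"
    using assms(1) by (auto simp: complex_fun_span_def)
  obtain G d where G: "finite G" "G \<subseteq> A" "g = (\<lambda>x. \<Sum>h\<in>G. d h * h x)"
    using assms(2) by (auto simp: complex_fun_span_def)
  have "f x = (\<Sum>h\<in>F \<union> G. (if h \<in> F then c h else 0) * h x)" for x
    unfolding F(3) using F(1) G(1) by (intro sum.mono_neutral_cong_left) auto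
  moreover have "g x = (\<Sum>h\<in>F \<union> G. (if h \<in> G then d h else 0) * h x)" for x
    unfolding G(3) using F(1) G(1) by (intro sum.mono_neutral_cong_left) auto
  ultimately have "(\<lambda>x. f x + g x) =
      (\<lambda>x. \<Sum>h\<in>F \<union> G. ((if h \<in> F then c h else 0) + (if h \<in> G then d h else 0)) * h x)"
    by (simp add: distrib_right sum.distrib)
  then show ?thesis unfolding complex_fun_span_def using F G
    by (intro CollectI exI[of _ "F \<union> G"] exI[of _ "\<lambda>h. (if h \<in> F then c h else 0) + (if h \<in> G then d h else 0)"]) auto
qed

lemma complex_fun_span_sum:
  assumes "\<And>i. i \<in> I \<Longrightarrow> f i \<in> complex_fun_span A"
  shows "(\<lambda>x. \<Sum>i\<in>I. f i x) \<in> complex_fun_span A"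
  using assms by (induction I rule: infinite_finite_induct) (auto simp: complex_fun_span_0 complex_fun_span_add)

lemma complex_fun_span_scale:
  assumes "f \<in> complex_fun_span A" shows "(\<lambda>x. a * f x) \<in> complex_fun_span A"
proof -
  obtain F c where F: "finite F" "F \<subseteq> A" "f = (\<lambda>x. \<Sum>h\<in>F. c h * h x)"
    using assms(1) by (auto simp: complex_fun_span_def)
  then show ?thesis unfolding complex_fun_span_def
    by (intro CollectI exI[of _ F] exI[of _ "\<lambda>h. a * c h"]) (auto simp: sum_distrib_left mult.assoc)
qed

text \<open>The span is formed from a set of functions, where equal functions with different indices
  coincide. Choosing one index per function allows the same coefficients to be used with another
  family over these indices.\<close>

lemma complex_fun_span_image:
  assumes "f \<in> complex_fun_span (range \<phi>)"
  obtains I c where "finite I" "f = (\<lambda>x. \<Sum>i\<in>I. c i * \<phi> i x)"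
proof -
  obtain F c where F: "finite F" "F \<subseteq> range \<phi>" "f = (\<lambda>x. \<Sum>h\<in>F. c h * h x)"
    using assms by (auto simp: complex_fun_span_def)
  obtain I where I: "finite I" "inj_on \<phi> I" "F = \<phi> ` I"
    using F(1,2) unfolding subset_image_inj by (auto dest: finite_imageD)
  have "f = (\<lambda>x. \<Sum>i\<in>I. c (\<phi> i) * \<phi> i x)"
    unfolding F(3) I(3) sum.reindex[OF I(2)] comp_def ..
  with I(1) show thesis by (rule that[of I "\<lambda>i. c (\<phi> i)"])
qed

locale koopman = prob_space M for M :: "'a measure" +
  fixes T S :: "'a \<Rightarrow> 'a"
  assumes T_meas: "T \<in> measurable M M" and S_meas: "S \<in> measurable M M"
    and T_pres: "distr M M T = M" and S_pres: "distr M M S = M"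
    and ST: "AE x in M. S (T x) = x" and TS: "AE x in M. T (S x) = x"
begin

abbreviation "kp \<equiv> koopman_power T S"

lemma funpow_pres:
  assumes "R \<in> measurable M M" "distr M M R = M"
  shows "(R ^^ n) \<in> measurable M M \<and> distr M M (R ^^ n) = M"
proof (induction n)
  case 0
  show ?case by (simp add: id_def)
next
  case (Suc n)
  then have 1: "(R ^^ n) \<in> measurable M M" and 2: "distr M M (R ^^ n) = M" by auto
  have "distr M M (R \<circ> (R ^^ n)) = distr (distr M M (R ^^ n)) M R"
    using assms(1) 1 by (simp add: distr_distr)
  then show ?case using measurable_comp[OF 1 assms(1)] by (simp only: funpow.simps assms(2) 2)
qed

lemma AE_pres:
  assumes "R \<in> measurable M M" "distr M M R = M" "AE x in M. P x"
  shows "AE x in M. P (R x)"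
proof -
  have "AE x in distr M M R. P x" unfolding assms(2) by (rule assms(3))
  then show ?thesis by (rule AE_distrD[OF assms(1)])
qed

lemma comp_pres:
  assumes R: "R \<in> measurable M M" "distr M M R = M" and f: "f \<in> L2_funs M"
  shows "f \<circ> R \<in> L2_funs M" "L2_nsq M (f \<circ> R) = L2_nsq M f"
    and "g \<in> L2_funs M \<Longrightarrow> L2_inner M (f \<circ> R) (g \<circ> R) = L2_inner M f g"
proof -
  have m: "f \<in> borel_measurable M" using f by (rule L2_meas)
  have "integrable (distr M M R) (\<lambda>x. (cmod (f x))\<^sup>2)" using R f by (simp add: L2_int)
  then have "integrable M (\<lambda>x. (cmod (f (R x)))\<^sup>2)" by (rule integrable_distr[OF R(1)])
  then show "f \<circ> R \<in> L2_funs M"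
    using measurable_comp[OF R(1) m] by (simp add: L2_funs_def)
  have "L2_nsq (distr M M R) f = L2_nsq M (f \<circ> R)"
    unfolding L2_nsq_def comp_def by (rule integral_distr[OF R(1)]) (use m in measurable)
  then show "L2_nsq M (f \<circ> R) = L2_nsq M f" by (simp add: R(2))
  assume g: "g \<in> L2_funs M"
  have "L2_inner (distr M M R) f g = L2_inner M (f \<circ> R) (g \<circ> R)"
    unfolding L2_inner_def comp_def by (rule integral_distr[OF R(1)]) (use m L2_meas[OF g] in measurable)
  then show "L2_inner M (f \<circ> R) (g \<circ> R) = L2_inner M f g" by (simp add: R(2))
qed

lemmas T_pow = funpow_pres[OF T_meas T_pres] and S_pow = funpow_pres[OF S_meas S_pres]

lemma kp_L2:
  assumes "f \<in> L2_funs M" shows "kp k f \<in> L2_funs M" "L2_nsq M (kp k f) = L2_nsq M f"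
  using assms comp_pres(1,2)[OF conjunct1[OF T_pow] conjunct2[OF T_pow]]
    comp_pres(1,2)[OF conjunct1[OF S_pow] conjunct2[OF S_pow]]
  by (auto simp: koopman_power_def)

lemma T_pow_S_pow: "AE x in M. (T ^^ n) ((S ^^ n) x) = x"
proof (induction n)
  case (Suc n)
  have "AE x in M. T (S ((S ^^ n) x)) = (S ^^ n) x"
    using AE_pres[OF conjunct1[OF S_pow] conjunct2[OF S_pow] TS] .
  then show ?case using Suc by eventually_elim (simp add: funpow_swap1)
qed simp

lemma S_pow_T_pow: "AE x in M. (S ^^ n) ((T ^^ n) x) = x"
proof (induction n)
  case (Suc n)
  have "AE x in M. S (T ((T ^^ n) x)) = (T ^^ n) x"
    using AE_pres[OF conjunct1[OF T_pow] conjunct2[OF T_pow] ST] .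
  then show ?case using Suc by eventually_elim (simp add: funpow_swap1)
qed simp

text \<open>Powers of \<open>T\<close> and \<open>S\<close> cancel only almost everywhere, so the
  exponent law holds only up to null sets; the case split mirrors the sign test in
  \<open>koopman_power\<close>.\<close>

lemma kp_diff: "AE x in M. f ((T ^^ t') ((S ^^ t) x)) = kp (int t' - int t) f x"
proof (cases "t \<le> t'")
  case True
  then have eq: "(T ^^ t') = (T ^^ (t' - t)) \<circ> (T ^^ t)" by (simp add: funpow_add[symmetric])
  have n: "nat (int t' - int t) = t' - t" "0 \<le> int t' - int t" using True by auto
  show ?thesis using T_pow_S_pow[of t]
    by eventually_elim (simp add: koopman_power_def n(1) eq True)
next
  case False
  then have eq: "(S ^^ t) = (S ^^ t') \<circ> (S ^^ (t - t'))" by (simp add: funpow_add[symmetric])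
  have n: "nat (- (int t' - int t)) = t - t'" "\<not> 0 \<le> int t' - int t" using False by auto
  have "AE x in M. (T ^^ t') ((S ^^ t') ((S ^^ (t - t')) x)) = (S ^^ (t - t')) x"
    using AE_pres[OF conjunct1[OF S_pow] conjunct2[OF S_pow] T_pow_S_pow] .
  then show ?thesis by eventually_elim (use n in \<open>simp add: koopman_power_def eq False\<close>)
qed

lemma kp_adjoint:
  assumes f: "f \<in> L2_funs M" and g: "g \<in> L2_funs M"
  shows "L2_inner M (f \<circ> (S ^^ t)) g = L2_inner M f (g \<circ> (T ^^ t))"
proof -
  note T' = conjunct1[OF T_pow, of t] conjunct2[OF T_pow, of t]
  note S' = conjunct1[OF S_pow, of t] conjunct2[OF S_pow, of t]
  note fS = comp_pres(1)[OF S' f]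
  have "L2_inner M (f \<circ> (S ^^ t)) g = L2_inner M ((f \<circ> (S ^^ t)) \<circ> (T ^^ t)) (g \<circ> (T ^^ t))"
    by (rule comp_pres(3)[OF T' fS g, symmetric])
  also have "\<dots> = L2_inner M f (g \<circ> (T ^^ t))"
  proof (rule L2_inner_cong_AE)
    show "AE x in M. ((f \<circ> (S ^^ t)) \<circ> (T ^^ t)) x = f x"
      using S_pow_T_pow[of t] by eventually_elim simp
  qed (use comp_pres(1)[OF T' fS] comp_pres(1)[OF T' g] f in \<open>auto dest: L2_meas\<close>)
  finally show ?thesis .
qed

section \<open>Approximation from the cyclic space of a function\<close>

definition near :: "real \<Rightarrow> ('a \<Rightarrow> complex) \<Rightarrow> ('a \<Rightarrow> complex) \<Rightarrow> bool" where
  "near \<epsilon> g f \<longleftrightarrow> (\<exists>p \<in> complex_fun_span (range (\<lambda>k. kp k f)) \<inter> L2_funs M. L2_dist M g p < \<epsilon>)"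

text \<open>An approximating element involves finitely many translates, and Koopman powers are
  isometries, so keeping its coefficients while passing to \<open>f'\<close> moves it by at most a
  constant times the distance from \<open>f\<close> to \<open>f'\<close>. This protects
  approximations already achieved from later changes of the vector.\<close>

lemma near_open:
  assumes near: "near \<epsilon> g f" and f: "f \<in> L2_funs M" and g: "g \<in> L2_funs M"
  shows "\<exists>\<delta>>0. \<forall>f'\<in>L2_funs M. L2_norm M (\<lambda>x. f' x - f x) \<le> \<delta> \<longrightarrow> near \<epsilon> g f'"
proof -
  obtain p where p: "p \<in> complex_fun_span (range (\<lambda>k. kp k f))" "p \<in> L2_funs M" "L2_dist M g p < \<epsilon>"
    using near by (auto simp: near_def)
  obtain I c where I: "finite I" "p = (\<lambda>x. \<Sum>k\<in>I. c k * kp k f x)"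
    using complex_fun_span_image[OF p(1)] by blast
  define C where "C = (\<Sum>k\<in>I. cmod (c k)) + 1"
  have C: "0 < C" by (simp add: C_def sum_nonneg add_nonneg_pos)
  define \<delta> where "\<delta> = (\<epsilon> - L2_dist M g p) / (2 * C)"
  have \<delta>: "0 < \<delta>" using p(3) C by (simp add: \<delta>_def)
  moreover have "near \<epsilon> g f'" if f': "f' \<in> L2_funs M" and d: "L2_norm M (\<lambda>x. f' x - f x) \<le> \<delta>" for f'
  proof -
    define p' where "p' = (\<lambda>x. \<Sum>k\<in>I. c k * kp k f' x)"
    have p'L: "p' \<in> L2_funs M" unfolding p'_def by (intro L2_sum L2_scale(1) kp_L2(1) f')
    have p'S: "p' \<in> complex_fun_span (range (\<lambda>k. kp k f'))" unfolding p'_def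
      by (intro complex_fun_span_sum complex_fun_span_base) auto
    have dk: "L2_norm M (\<lambda>x. c k * kp k (\<lambda>x. f x - f' x) x) \<le> cmod (c k) * \<delta>" for k
    proof -
      have "L2_norm M (\<lambda>x. c k * kp k (\<lambda>x. f x - f' x) x) = cmod (c k) * L2_norm M (\<lambda>x. f x - f' x)"
        by (subst L2_scale(3)) (use kp_L2 f f' in \<open>auto simp: L2_norm_def L2_diff\<close>)
      also have "L2_norm M (\<lambda>x. f x - f' x) = L2_norm M (\<lambda>x. f' x - f x)"
        by (simp add: L2_norm_def L2_nsq_def norm_minus_commute)
      finally show ?thesis using d by (simp add: mult_left_mono)
    qed
    have "(\<lambda>x. p x - p' x) = (\<lambda>x. \<Sum>k\<in>I. c k * kp k (\<lambda>x. f x - f' x) x)"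
      unfolding I(2) p'_def by (auto simp: koopman_power_def sum_subtractf[symmetric] right_diff_distrib intro!: sum.cong)
    then have "L2_norm M (\<lambda>x. p x - p' x) = L2_norm M (\<lambda>x. \<Sum>k\<in>I. c k * kp k (\<lambda>x. f x - f' x) x)"
      by (rule arg_cong)
    also have "\<dots> \<le> (\<Sum>k\<in>I. L2_norm M (\<lambda>x. c k * kp k (\<lambda>x. f x - f' x) x))"
      by (intro L2_norm_sum_le I(1) L2_scale(1) kp_L2(1) L2_diff f f')
    also have "\<dots> \<le> (\<Sum>k\<in>I. cmod (c k) * \<delta>)" by (intro sum_mono dk)
    also have "\<dots> \<le> C * \<delta>" unfolding C_def sum_distrib_right[symmetric] using \<delta> by simp
    also have "\<dots> < \<epsilon> - L2_dist M g p" using p(3) C by (simp add: \<delta>_def)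
    finally have "L2_norm M (\<lambda>x. p x - p' x) < \<epsilon> - L2_dist M g p" .
    moreover have "L2_dist M g p' \<le> L2_dist M g p + L2_norm M (\<lambda>x. p x - p' x)"
      using L2_norm_triangle[OF L2_diff[OF g p(2)] L2_diff[OF p(2) p'L]] by (simp add: L2_dist_norm)
    ultimately show ?thesis unfolding near_def using p'S p'L by (intro bexI[of _ p']) auto
  qed
  ultimately show ?thesis by blast
qed

section \<open>Frequency bands\<close>

definition bandpass :: "nat \<Rightarrow> nat \<Rightarrow> ('a \<Rightarrow> complex) \<Rightarrow> 'a \<Rightarrow> complex" where
  "bandpass K w f = (\<lambda>x. \<Sum>t<K. (root_unity K w ^ t / of_nat K) * (f \<circ> (T ^^ t)) x)"

lemma bandpass_L2: "f \<in> L2_funs M \<Longrightarrow> bandpass K w f \<in> L2_funs M"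
  unfolding bandpass_def
  by (intro L2_sum L2_scale(1) comp_pres(1)[OF conjunct1[OF T_pow] conjunct2[OF T_pow]])

lemma bandpass_lincomb:
  "bandpass K w (\<lambda>x. a * f x + b * g x) = (\<lambda>x. a * bandpass K w f x + b * bandpass K w g x)"
  by (simp add: bandpass_def sum_distrib_left sum.distrib[symmetric] algebra_simps)

lemma bandpass_Parseval:
  assumes K: "0 < K" and f: "f \<in> L2_funs M"
  shows "(\<Sum>w<K. L2_nsq M (bandpass K w f)) = L2_nsq M f"
proof -
  have pt: "(\<Sum>w<K. (cmod (bandpass K w f x))\<^sup>2) = (\<Sum>t<K. (cmod ((f \<circ> (T ^^ t)) x))\<^sup>2 / K)" for x
  proof -
    have "(\<Sum>w<K. (cmod (bandpass K w f x))\<^sup>2) =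
        (\<Sum>w<K. (cmod (\<Sum>t<K. ((f \<circ> (T ^^ t)) x / of_nat K) * root_unity K w ^ t))\<^sup>2)"
      by (simp add: bandpass_def mult.commute)
    also have "\<dots> = K * (\<Sum>t<K. (cmod ((f \<circ> (T ^^ t)) x / of_nat K))\<^sup>2)"
      by (rule root_unity_Parseval[OF K]) (auto simp: inj_on_def)
    finally show ?thesis using K
      by (simp add: sum_distrib_left norm_divide power_divide power2_eq_square[of "real K"])
  qed
  have "(\<Sum>w<K. L2_nsq M (bandpass K w f)) = (\<integral>x. (\<Sum>w<K. (cmod (bandpass K w f x))\<^sup>2) \<partial>M)"
    unfolding L2_nsq_def by (rule Bochner_Integration.integral_sum[symmetric]) (simp add: L2_int bandpass_L2 f)
  also have "\<dots> = (\<Sum>t<K. L2_nsq M (f \<circ> (T ^^ t)) / K)"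
    unfolding pt L2_nsq_def
    by (subst Bochner_Integration.integral_sum)
       (use L2_int[OF comp_pres(1)[OF conjunct1[OF T_pow] conjunct2[OF T_pow] f]] in auto)
  also have "\<dots> = L2_nsq M f"
    using K comp_pres(2)[OF conjunct1[OF T_pow] conjunct2[OF T_pow] f] by simp
  finally show ?thesis .
qed

text \<open>With \<open>A\<^sub>w = bandpass K w\<close>, the map \<open>f \<mapsto> (A\<^sub>w f)\<^sub>w\<close> is an isometry, so its adjoint is a contraction
  and \<open>\<Sum>\<^sub>w A\<^sub>w\<^sup>* A\<^sub>w = 1\<close>. Hence residuals chosen separately on each band can be added up.\<close>

lemma near_residual:
  assumes K: "0 < K" and f: "f \<in> L2_funs M" and g: "g \<in> L2_funs M" and "0 < \<epsilon>"
    and less: "(\<Sum>w<K. L2_nsq M (\<lambda>x. bandpass K w g x - p w * bandpass K w f x)) < \<epsilon>\<^sup>2"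
  shows "near \<epsilon> g f"
proof -
  let ?z = "\<lambda>w. root_unity K w"
  note T' = conjunct1[OF T_pow] conjunct2[OF T_pow] and S' = conjunct1[OF S_pow] conjunct2[OF S_pow]
  define y where "y w = (\<lambda>x. bandpass K w g x - p w * bandpass K w f x)" for w
  have yL: "y w \<in> L2_funs M" for w unfolding y_def
    by (intro L2_diff L2_scale(1) bandpass_L2 f g)
  \<comment> \<open>The adjoints of the band operators, applied to the band residuals and added up.
    The part coming from \<open>g\<close> reproduces \<open>g\<close>, the part coming from
    \<open>f\<close> is the element \<open>P\<close> of the cyclic space.\<close>
  define r where "r = (\<lambda>x. \<Sum>w<K. \<Sum>t<K. cnj (?z w ^ t / of_nat K) * (y w \<circ> (S ^^ t)) x)"
  have rL: "r \<in> L2_funs M" unfolding r_def by (intro L2_sum L2_scale(1) comp_pres(1)[OF S' yL])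
  define P where "P = (\<lambda>x. \<Sum>w<K. \<Sum>t<K. \<Sum>t'<K.
     (cnj (?z w ^ t / of_nat K) * p w * (?z w ^ t' / of_nat K)) * kp (int t' - int t) f x)"
  have PS: "P \<in> complex_fun_span (range (\<lambda>k. kp k f))" unfolding P_def
    by (intro complex_fun_span_sum complex_fun_span_base) auto
  have PL: "P \<in> L2_funs M" unfolding P_def by (intro L2_sum L2_scale(1) kp_L2(1) f)
  have "AE x in M. \<forall>t\<in>{..<K}. \<forall>t'\<in>{..<K}. f ((T ^^ t') ((S ^^ t) x)) = kp (int t' - int t) f x"
    by (intro AE_finite_allI kp_diff) auto
  moreover have "AE x in M. \<forall>t\<in>{..<K}. (T ^^ t) ((S ^^ t) x) = x"
    by (intro AE_finite_allI T_pow_S_pow) auto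
  ultimately have r_eq: "AE x in M. r x = g x - P x"
  proof eventually_elim
    case (elim x)
    have "(\<Sum>w<K. \<Sum>t<K. cnj (?z w ^ t / of_nat K) * (bandpass K w g \<circ> (S ^^ t)) x) =
       (\<Sum>w<K. \<Sum>t<K. \<Sum>t'<K. g ((T ^^ t') ((S ^^ t) x)) / (of_nat K)\<^sup>2 * (?z w ^ t' * cnj (?z w ^ t)))"
      by (simp add: bandpass_def sum_distrib_left power2_eq_square algebra_simps)
    also have "\<dots> = (\<Sum>t<K. \<Sum>w<K. \<Sum>t'<K. g ((T ^^ t') ((S ^^ t) x)) / (of_nat K)\<^sup>2 * (?z w ^ t' * cnj (?z w ^ t)))"
      by (rule sum.swap)
    also have "\<dots> = (\<Sum>t<K. \<Sum>t'<K. g ((T ^^ t') ((S ^^ t) x)) / (of_nat K)\<^sup>2 * (\<Sum>w<K. ?z w ^ t' * cnj (?z w ^ t)))"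
      unfolding sum_distrib_left by (rule sum.cong[OF refl], rule sum.swap)
    also have "\<dots> = (\<Sum>t<K. \<Sum>t'<K. if t' = t then g ((T ^^ t) ((S ^^ t) x)) / of_nat K else 0)"
      unfolding root_unity_orth[OF K] using K by (intro sum.cong refl) (auto simp: power2_eq_square)
    also have "\<dots> = g x" using elim K by simp
    finally have 1: "(\<Sum>w<K. \<Sum>t<K. cnj (?z w ^ t / of_nat K) * (bandpass K w g \<circ> (S ^^ t)) x) = g x" .
    have 2: "(\<Sum>w<K. \<Sum>t<K. cnj (?z w ^ t / of_nat K) * (p w * (bandpass K w f \<circ> (S ^^ t)) x)) = P x"
      unfolding P_def bandpass_def comp_def sum_distrib_left
      by (intro sum.cong refl) (use elim in \<open>simp add: algebra_simps\<close>)
    have "r x = (\<Sum>w<K. \<Sum>t<K. cnj (?z w ^ t / of_nat K) * (bandpass K w g \<circ> (S ^^ t)) x) -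
       (\<Sum>w<K. \<Sum>t<K. cnj (?z w ^ t / of_nat K) * (p w * (bandpass K w f \<circ> (S ^^ t)) x))"
      unfolding r_def y_def by (simp add: sum_subtractf right_diff_distrib)
    then show ?case unfolding 1 2 .
  qed
  have adj: "L2_inner M (\<lambda>x. \<Sum>t<K. cnj (?z w ^ t / of_nat K) * (y w \<circ> (S ^^ t)) x) r =
      L2_inner M (y w) (bandpass K w r)" for w
  proof -
    have "L2_inner M (\<lambda>x. \<Sum>t<K. cnj (?z w ^ t / of_nat K) * (y w \<circ> (S ^^ t)) x) r =
        (\<Sum>t<K. L2_inner M (\<lambda>x. cnj (?z w ^ t / of_nat K) * (y w \<circ> (S ^^ t)) x) r)"
      by (intro L2_inner_sum_left L2_scale(1) comp_pres(1)[OF S' yL] rL)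
    also have "\<dots> = (\<Sum>t<K. cnj (?z w ^ t / of_nat K) * L2_inner M (y w) (r \<circ> (T ^^ t)))"
      by (simp only: L2_inner_scale_left kp_adjoint[OF yL rL])
    also have "\<dots> = (\<Sum>t<K. L2_inner M (y w) (\<lambda>x. (?z w ^ t / of_nat K) * (r \<circ> (T ^^ t)) x))"
      by (simp only: L2_inner_scale_right)
    also have "\<dots> = L2_inner M (y w) (bandpass K w r)"
      unfolding bandpass_def
      by (intro L2_inner_sum_right[symmetric] L2_scale(1) comp_pres(1)[OF T' rL] yL)
    finally show ?thesis .
  qed
  have "complex_of_real (L2_nsq M r) = L2_inner M (\<lambda>x. \<Sum>w<K. \<Sum>t<K. cnj (?z w ^ t / of_nat K) * (y w \<circ> (S ^^ t)) x) r"
    unfolding L2_inner_self[symmetric] by (simp add: r_def)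
  also have "\<dots> = (\<Sum>w<K. L2_inner M (y w) (bandpass K w r))"
    unfolding adj[symmetric]
    by (intro L2_inner_sum_left L2_sum L2_scale(1) comp_pres(1)[OF S' yL] rL)
  finally have "L2_nsq M r = cmod (\<Sum>w<K. L2_inner M (y w) (bandpass K w r))"
    by (metis L2_nsq_nonneg norm_of_real abs_of_nonneg)
  also have "\<dots> \<le> (\<Sum>w<K. L2_norm M (y w) * L2_norm M (bandpass K w r))"
    by (intro sum_norm_le L2_Cauchy_Schwarz yL bandpass_L2 rL)
  \<comment> \<open>By Parseval the second summands give half of \<open>L2_nsq M r\<close>, which is
    absorbed on the left; so \<open>r\<close> is no larger than the band residuals together.\<close>
  also have "\<dots> \<le> (\<Sum>w<K. (L2_nsq M (y w) + L2_nsq M (bandpass K w r)) / 2)"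
  proof (intro sum_mono)
    fix w
    show "L2_norm M (y w) * L2_norm M (bandpass K w r) \<le> (L2_nsq M (y w) + L2_nsq M (bandpass K w r)) / 2"
      using sum_squares_bound[of "L2_norm M (y w)" "L2_norm M (bandpass K w r)"] by (simp add: L2_norm_sq)
  qed
  also have "\<dots> = ((\<Sum>w<K. L2_nsq M (y w)) + L2_nsq M r) / 2"
    unfolding bandpass_Parseval[OF K rL, symmetric] by (simp add: sum.distrib sum_divide_distrib[symmetric])
  finally have "L2_nsq M r < \<epsilon>\<^sup>2" using less by (simp add: y_def)
  moreover have "L2_nsq M (\<lambda>x. g x - P x) = L2_nsq M r"
    by (rule L2_nsq_cong_AE) (use r_eq L2_meas[OF rL] L2_meas[OF L2_diff[OF g PL]] in auto)
  ultimately have "L2_dist M g P < \<epsilon>"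
    using \<open>0 < \<epsilon>\<close> real_sqrt_less_mono[of "L2_nsq M r" "\<epsilon>\<^sup>2"] by (simp add: L2_dist_norm L2_norm_def)
  then show ?thesis unfolding near_def using PS PL by blast
qed

definition band_area :: "nat \<Rightarrow> ('a \<Rightarrow> complex) \<Rightarrow> ('a \<Rightarrow> complex) \<Rightarrow> real" where
  "band_area K e g = (\<Sum>w<K. L2_area M (bandpass K w e) (bandpass K w g))"

text \<open>The exceptional parameter in \<open>L2_residual\<close> varies with the band, so a given
  \<open>l\<close> may be bad for some of them. A grid with spacing \<open>s\<close> meets each
  exceptional interval at most once; on average over \<open>n\<close> grid points the exceptional
  bands contribute at most \<open>L2_nsq M g / n\<close>, and some grid point is as good as the
  average.\<close>

lemma near_perturb:
  assumes e: "e \<in> L2_funs M" and g: "g \<in> L2_funs M"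
    and small: "\<And>\<delta>. 0 < \<delta> \<Longrightarrow> \<exists>K>0. band_area K e g < \<delta>" and "0 < \<eta>" "0 < \<epsilon>"
  shows "\<exists>l::real. \<bar>l\<bar> \<le> \<eta> \<and> near \<epsilon> g (\<lambda>x. e x + of_real l * g x)"
proof -
  \<comment> \<open>So many grid points bring the averaged exceptional part below half of
    \<open>\<epsilon>\<^sup>2\<close>; the choice of \<open>K\<close> does the same for the
    remaining bands.\<close>
  obtain n :: nat where n: "2 * L2_nsq M g / \<epsilon>\<^sup>2 < real n" using reals_Archimedean2 by blast
  have n0: "0 < n"
  proof (rule ccontr)
    assume "\<not> 0 < n"
    moreover have "0 \<le> 2 * L2_nsq M g / \<epsilon>\<^sup>2" by simp
    ultimately show False using n by simp
  qed
  define s where "s = \<eta> / n"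
  have s: "0 < s" using \<open>0 < \<eta>\<close> n0 by (simp add: s_def)
  obtain K where K: "0 < K" "band_area K e g < s * \<epsilon>\<^sup>2 / 2" using small[of "s * \<epsilon>\<^sup>2 / 2"] s \<open>0 < \<epsilon>\<close> by auto
  let ?u = "\<lambda>w. bandpass K w e" and ?v = "\<lambda>w. bandpass K w g"
  have uL: "?u w \<in> L2_funs M" and vL: "?v w \<in> L2_funs M" for w using e g by (auto intro: bandpass_L2)
  have "\<forall>w. \<exists>l0. \<forall>l::real. \<exists>p. L2_nsq M (\<lambda>x. ?v w x - p * (?u w x + of_real l * ?v w x)) \<le>
     (if \<bar>l - l0\<bar> < s / 2 then L2_nsq M (?v w) else L2_area M (?u w) (?v w) / s)"
    using L2_residual[OF uL vL s] by blast
  then obtain l0 where "\<forall>w. \<forall>l::real. \<exists>p. L2_nsq M (\<lambda>x. ?v w x - p * (?u w x + of_real l * ?v w x)) \<le>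
     (if \<bar>l - l0 w\<bar> < s / 2 then L2_nsq M (?v w) else L2_area M (?u w) (?v w) / s)" by metis
  then obtain p where p: "\<And>w (l::real). L2_nsq M (\<lambda>x. ?v w x - p w l * (?u w x + of_real l * ?v w x)) \<le>
     (if \<bar>l - l0 w\<bar> < s / 2 then L2_nsq M (?v w) else L2_area M (?u w) (?v w) / s)" by metis
  define err where "err m = (\<Sum>w<K. L2_nsq M (\<lambda>x. ?v w x - p w (s * real m) * (?u w x + of_real (s * real m) * ?v w x)))" for m :: nat
  have one: "(\<Sum>m\<in>{1..n}. if \<bar>s * real m - c\<bar> < s / 2 then b else a) \<le> b + n * a" if "0 \<le> a" "0 \<le> b" for a b c :: real
  proof -
    let ?X = "{m\<in>{1..n}. \<bar>s * real m - c\<bar> < s / 2}"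
    have "m = m'" if "m \<in> ?X" "m' \<in> ?X" for m m'
    proof (rule ccontr)
      assume "m \<noteq> m'"
      then have "1 \<le> \<bar>real m - real m'\<bar>" by linarith
      then have "s \<le> s * \<bar>real m - real m'\<bar>" using s by simp
      also have "\<dots> = \<bar>s * real m - s * real m'\<bar>" using s by (simp add: right_diff_distrib[symmetric] abs_mult)
      finally have "s \<le> \<bar>s * real m - s * real m'\<bar>" .
      moreover have "\<bar>s * real m - c\<bar> < s / 2" "\<bar>s * real m' - c\<bar> < s / 2" using that by auto
      ultimately show False by linarith
    qed
    then have "\<forall>m\<in>?X. \<forall>m'\<in>?X. m = m'" by blast
    then have "card ?X \<le> 1" unfolding One_nat_def by (subst card_le_Suc0_iff_eq) simp_all
    have "(\<Sum>m\<in>{1..n}. if \<bar>s * real m - c\<bar> < s / 2 then b else a) \<le> (\<Sum>m\<in>{1..n}. (if m \<in> ?X then b else 0) + a)"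
      using that by (intro sum_mono) auto
    also have "\<dots> = card ?X * b + n * a" by (simp add: sum.distrib sum.If_cases Int_def)
    also have "card ?X * b \<le> 1 * b" using \<open>card ?X \<le> 1\<close> that by (intro mult_right_mono) auto
    finally show ?thesis by simp
  qed
  have "(\<Sum>m\<in>{1..n}. err m) \<le> (\<Sum>m\<in>{1..n}. \<Sum>w<K. if \<bar>s * real m - l0 w\<bar> < s / 2 then L2_nsq M (?v w) else L2_area M (?u w) (?v w) / s)"
    unfolding err_def by (intro sum_mono p)
  also have "\<dots> = (\<Sum>w<K. \<Sum>m\<in>{1..n}. if \<bar>s * real m - l0 w\<bar> < s / 2 then L2_nsq M (?v w) else L2_area M (?u w) (?v w) / s)"
    by (rule sum.swap)
  also have "\<dots> \<le> (\<Sum>w<K. L2_nsq M (?v w) + n * (L2_area M (?u w) (?v w) / s))"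
    using s L2_area_nonneg[OF uL vL] by (intro sum_mono one) auto
  also have "\<dots> = L2_nsq M g + n * (band_area K e g / s)"
    unfolding bandpass_Parseval[OF K(1) g, symmetric] band_area_def
    by (simp add: sum.distrib sum_distrib_left sum_divide_distrib)
  also have "\<dots> < n * \<epsilon>\<^sup>2"
  proof -
    have "L2_nsq M g < n * (\<epsilon>\<^sup>2 / 2)" using n \<open>0 < \<epsilon>\<close> by (simp add: divide_simps mult.commute)
    moreover have "n * (band_area K e g / s) < n * (\<epsilon>\<^sup>2 / 2)"
      using K(2) n0 s by (simp add: divide_simps mult.commute)
    moreover have "n * \<epsilon>\<^sup>2 = n * (\<epsilon>\<^sup>2 / 2) + n * (\<epsilon>\<^sup>2 / 2)" by simp
    ultimately show ?thesis by linarith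
  qed
  finally have tot: "(\<Sum>m\<in>{1..n}. err m) < n * \<epsilon>\<^sup>2" .
  have "\<exists>m\<in>{1..n}. err m < \<epsilon>\<^sup>2"
  proof (rule ccontr)
    assume "\<not> ?thesis"
    then have "(\<Sum>m\<in>{1..n}. \<epsilon>\<^sup>2) \<le> (\<Sum>m\<in>{1..n}. err m)"
      by (intro sum_mono) (simp add: not_less)
    then show False using tot by simp
  qed
  then obtain m where m: "m \<in> {1..n}" "err m < \<epsilon>\<^sup>2" by blast
  let ?l = "s * real m"
  have f: "(\<lambda>x. e x + of_real ?l * g x) \<in> L2_funs M" using L2_lincomb(1)[OF e g, of 1 "of_real ?l"] by simp
  have bf: "bandpass K w (\<lambda>x. e x + of_real ?l * g x) = (\<lambda>x. ?u w x + of_real ?l * ?v w x)" for w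
    using bandpass_lincomb[of K w 1 e "of_real ?l" g] by simp
  have "near \<epsilon> g (\<lambda>x. e x + of_real ?l * g x)"
    by (rule near_residual[OF K(1) f g \<open>0 < \<epsilon>\<close>, of "\<lambda>w. p w ?l"]) (use m(2) in \<open>simp only: bf err_def\<close>)
  moreover have "\<bar>?l\<bar> \<le> \<eta>"
  proof -
    have "?l \<le> s * n" using m(1) s by (intro mult_left_mono) auto
    moreover have "0 \<le> ?l" using s by simp
    moreover have "s * n = \<eta>" using n0 by (simp add: s_def)
    ultimately show ?thesis by linarith
  qed
  ultimately show ?thesis by blast
qed

end

section \<open>Construction of a cyclic vector\<close>

context koopman
begin

text \<open>Smallness of band areas is given only on a class \<open>V\<close> that need not contain
  the limit. The sequence therefore stays in \<open>V\<close>, and each step secures one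
  approximation together with a radius within which it survives.\<close>

lemma cyclic_vector_exists:
  fixes g :: "nat \<Rightarrow> 'a \<Rightarrow> complex"
  assumes gL: "\<And>j. g j \<in> L2_funs M" and g1: "\<And>j x. x \<in> space M \<Longrightarrow> cmod (g j x) \<le> 1"
    and V0: "(\<lambda>x. 0) \<in> V" and VL: "V \<subseteq> L2_funs M"
    and Vg: "\<And>e j l. e \<in> V \<Longrightarrow> (\<lambda>x. e x + of_real l * g j x) \<in> V"
    and small: "\<And>e j \<delta>. e \<in> V \<Longrightarrow> 0 < \<delta> \<Longrightarrow> \<exists>K>0. band_area K e (g j) < \<delta>"
  shows "\<exists>e\<in>L2_funs M. \<forall>j. \<forall>\<epsilon>>0. near \<epsilon> (g j) e"
proof -
  \<comment> \<open>Each index \<open>j\<close> is taken up infinitely often, at the steps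
    \<open>prod_encode (j, m)\<close>, with accuracy \<open>1 / Suc n\<close> that tends to 0 along
    them.\<close>
  define \<sigma> where "\<sigma> n = fst (prod_decode n)" for n
  let ?P = "\<lambda>(n::nat) (s::('a \<Rightarrow> complex) \<times> real). fst s \<in> V \<and> 0 < snd s"
  let ?Q = "\<lambda>n (s::('a \<Rightarrow> complex) \<times> real) (s'::('a \<Rightarrow> complex) \<times> real). \<exists>l::real. fst s' = (\<lambda>x. fst s x + of_real l * g (\<sigma> n) x) \<and>
     \<bar>l\<bar> \<le> snd s / 2 \<and> snd s' \<le> snd s / 2 \<and>
     (\<forall>f\<in>L2_funs M. L2_norm M (\<lambda>x. f x - fst s' x) \<le> snd s' \<longrightarrow> near (1 / Suc n) (g (\<sigma> n)) f)"
  have "\<exists>s. \<forall>n. ?P n (s n) \<and> ?Q n (s n) (s (Suc n))"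
  proof (rule dependent_nat_choice[where P = ?P and Q = ?Q])
    show "\<exists>s. ?P 0 s" using V0 by (intro exI[of _ "(\<lambda>x. 0, 1)"]) simp
    fix s n assume s: "?P n s"
    obtain l where l: "\<bar>l\<bar> \<le> snd s / 2" "near (1 / Suc n) (g (\<sigma> n)) (\<lambda>x. fst s x + of_real l * g (\<sigma> n) x)"
      using near_perturb[of "fst s" "g (\<sigma> n)" "snd s / 2" "1 / Suc n"] s VL gL small by auto
    let ?e = "\<lambda>x. fst s x + of_real l * g (\<sigma> n) x"
    have eV: "?e \<in> V" using s Vg by blast
    obtain \<delta> where \<delta>: "0 < \<delta>" "\<And>f. f\<in>L2_funs M \<Longrightarrow> L2_norm M (\<lambda>x. f x - ?e x) \<le> \<delta> \<Longrightarrow> near (1 / Suc n) (g (\<sigma> n)) f"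
      using near_open[OF l(2)] eV VL gL by blast
    show "\<exists>s'. ?P (Suc n) s' \<and> ?Q n s s'"
      using s eV l(1) \<delta> by (intro exI[of _ "(?e, min \<delta> (snd s / 2))"]) auto
  qed
  then obtain s where P: "\<And>n. ?P n (s n)" and Q: "\<And>n. ?Q n (s n) (s (Suc n))" by blast
  define e where "e n = fst (s n)" for n
  define r where "r n = snd (s n)" for n
  have eV: "e n \<in> V" and rpos: "0 < r n" for n using P[of n] by (auto simp: e_def r_def)
  have rdec: "r (Suc n) \<le> r n / 2" for n using Q[of n] by (auto simp: r_def)
  have step: "cmod (e (Suc n) x - e n x) \<le> r n - r (Suc n)" if "x \<in> space M" for n x
  proof -
    obtain l where l: "e (Suc n) = (\<lambda>x. e n x + of_real l * g (\<sigma> n) x)" "\<bar>l\<bar> \<le> r n / 2"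
      using Q[of n] unfolding e_def r_def by blast
    have "cmod (e (Suc n) x - e n x) = \<bar>l\<bar> * cmod (g (\<sigma> n) x)" by (simp add: l(1) norm_mult)
    also have "\<dots> \<le> \<bar>l\<bar> * 1" using g1[OF that] by (intro mult_left_mono) auto
    finally show ?thesis using l(2) rdec[of n] by simp
  qed
  have dist: "cmod (e (n + k) x - e n x) \<le> r n - r (n + k)" if "x \<in> space M" for n k x
  proof (induction k)
    case (Suc k)
    have "cmod (e (n + Suc k) x - e n x) \<le> cmod (e (Suc (n + k)) x - e (n + k) x) + cmod (e (n + k) x - e n x)"
      using norm_triangle_ineq[of "e (Suc (n + k)) x - e (n + k) x" "e (n + k) x - e n x"] by simp
    then show ?case using Suc step[OF that, of "n + k"] by simp
  qed simp
  have r_le: "r n \<le> r 0 * (1/2) ^ n" for n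
  proof (induction n)
    case (Suc n) then show ?case using rdec[of n] by simp
  qed simp
  have r0: "r \<longlonglongrightarrow> 0"
  proof (rule tendsto_sandwich[of "\<lambda>_. 0" r _ "\<lambda>n. r 0 * (1/2) ^ n"])
    show "(\<lambda>n. r 0 * (1/2) ^ n) \<longlonglongrightarrow> 0" by (intro tendsto_mult_right_zero LIMSEQ_power_zero) simp
    show "\<forall>\<^sub>F n in sequentially. 0 \<le> r n" using rpos by (simp add: less_imp_le)
  qed (use r_le in auto)
  have Ce: "Cauchy (\<lambda>n. e n x)" if "x \<in> space M" for x
  proof (rule CauchyI')
    fix \<epsilon> :: real assume "0 < \<epsilon>"
    then obtain N where N: "\<And>n. n \<ge> N \<Longrightarrow> r n < \<epsilon>"
      using order_tendstoD(2)[OF r0] by (auto simp: eventually_sequentially)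
    have "dist (e m x) (e n x) < \<epsilon>" if "m \<ge> N" "n > m" for m n
    proof -
      have "cmod (e n x - e m x) \<le> r m - r n"
        using dist[OF \<open>x \<in> space M\<close>, of m "n - m"] \<open>n > m\<close> by simp
      then have "cmod (e n x - e m x) < \<epsilon>" using N[OF \<open>m \<ge> N\<close>] rpos[of n] by linarith
      then show ?thesis by (simp add: dist_norm norm_minus_commute)
    qed
    then show "\<exists>N. \<forall>m\<ge>N. \<forall>n>m. dist (e m x) (e n x) < \<epsilon>" by blast
  qed
  have lim: "(\<lambda>n. e n x) \<longlonglongrightarrow> lim (\<lambda>n. e n x)" if "x \<in> space M" for x
  proof -
    have "convergent (\<lambda>n. e n x)" by (rule Cauchy_convergent) (rule Ce[OF that])
    then obtain l where l: "(\<lambda>n. e n x) \<longlonglongrightarrow> l" by (auto simp: convergent_def)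
    show ?thesis unfolding limI[OF l] by (rule l)
  qed
  define E where "E x = lim (\<lambda>n. e n x)" for x
  have E_meas: "E \<in> borel_measurable M"
  proof (rule borel_measurable_LIMSEQ_metric[of e])
    show "e i \<in> borel_measurable M" for i using VL eV[of i] by (auto intro: L2_meas)
    show "(\<lambda>i. e i x) \<longlonglongrightarrow> E x" if "x \<in> space M" for x unfolding E_def by (rule lim[OF that])
  qed
  have E_dist: "cmod (E x - e n x) \<le> r n" if x: "x \<in> space M" for x n
  proof (rule LIMSEQ_le_const2)
    show "(\<lambda>m. cmod (e m x - e n x)) \<longlonglongrightarrow> cmod (E x - e n x)"
      unfolding E_def by (intro tendsto_intros lim x)
    show "\<exists>N. \<forall>m\<ge>N. cmod (e m x - e n x) \<le> r n"
      proof (intro exI[of _ n] allI impI)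
      fix m assume "n \<le> m"
      then have "cmod (e m x - e n x) \<le> r n - r m" using dist[OF x, of n "m - n"] by simp
      then show "cmod (e m x - e n x) \<le> r n" using rpos[of m] by linarith
    qed
  qed
  have Ee: "(\<lambda>x. E x - e n x) \<in> L2_funs M" "L2_norm M (\<lambda>x. E x - e n x) \<le> r n" for n
  proof -
    have m: "(\<lambda>x. E x - e n x) \<in> borel_measurable M" using VL eV[of n] by (intro borel_measurable_diff E_meas L2_meas) auto
    show "(\<lambda>x. E x - e n x) \<in> L2_funs M"
      by (rule L2_bounded[OF finite_measure_axioms m, of "r n"]) (rule E_dist)
    have "L2_nsq M (\<lambda>x. E x - e n x) \<le> (r n)\<^sup>2"
      by (rule L2_nsq_bound[OF prob_space_axioms m]) (intro power_mono E_dist, auto)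
    then show "L2_norm M (\<lambda>x. E x - e n x) \<le> r n"
      using rpos[of n] by (simp add: L2_norm_def real_le_lsqrt)
  qed
  have EL: "E \<in> L2_funs M" using L2_add[OF Ee(1)[of 0], of "e 0"] eV VL by auto
  moreover have "near \<epsilon> (g j) E" if "0 < \<epsilon>" for j \<epsilon>
  proof -
    obtain m where m: "1 / real (Suc m) < \<epsilon>" using reals_Archimedean[OF \<open>0 < \<epsilon>\<close>] by (auto simp: inverse_eq_divide)
    define n where "n = prod_encode (j, m)"
    have "m \<le> n" unfolding n_def by (rule le_prod_encode_2)
    then have "1 / real (Suc n) \<le> 1 / real (Suc m)" by (intro divide_left_mono) auto
    moreover have "near (1 / Suc n) (g j) E"
      using Q[of n] Ee(2)[of "Suc n"] EL by (auto simp: \<sigma>_def n_def e_def r_def)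
    moreover have "near b g e" if "near a g e" "a < b" for a b g e
      using that unfolding near_def by (meson less_trans)
    ultimately show ?thesis using m by (meson order_le_less_trans)
  qed
  ultimately show ?thesis by blast
qed

section \<open>From a generator of the sigma-algebra to all square-integrable functions\<close>

lemma near_closed_span: "L2_closed_span M (range (\<lambda>k. kp k e)) = {f \<in> L2_funs M. \<forall>\<epsilon>>0. near \<epsilon> f e}"
  by (simp add: L2_closed_span_def near_def)

lemma near_lincomb:
  assumes f: "f \<in> L2_funs M" "\<And>\<epsilon>. 0 < \<epsilon> \<Longrightarrow> near \<epsilon> f e" and g: "g \<in> L2_funs M" "\<And>\<epsilon>. 0 < \<epsilon> \<Longrightarrow> near \<epsilon> g e"
    and "0 < \<epsilon>"
  shows "near \<epsilon> (\<lambda>x. a * f x + b * g x) e"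
proof -
  define \<delta> where "\<delta> = \<epsilon> / (cmod a + cmod b + 1)"
  have c: "0 < cmod a + cmod b + 1" by (simp add: add_nonneg_pos)
  then have \<delta>: "0 < \<delta>" using \<open>0 < \<epsilon>\<close> by (simp add: \<delta>_def)
  obtain p where p: "p \<in> complex_fun_span (range (\<lambda>k. kp k e))" "p \<in> L2_funs M" "L2_dist M f p < \<delta>"
    using f(2)[OF \<delta>] by (auto simp: near_def)
  obtain p' where p': "p' \<in> complex_fun_span (range (\<lambda>k. kp k e))" "p' \<in> L2_funs M" "L2_dist M g p' < \<delta>"
    using g(2)[OF \<delta>] by (auto simp: near_def)
  let ?p = "\<lambda>x. a * p x + b * p' x"
  have "L2_dist M (\<lambda>x. a * f x + b * g x) ?p =
      L2_norm M (\<lambda>x. a * (f x - p x) + b * (g x - p' x))"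
    by (simp add: L2_dist_norm algebra_simps)
  also have "\<dots> \<le> L2_norm M (\<lambda>x. a * (f x - p x)) + L2_norm M (\<lambda>x. b * (g x - p' x))"
    by (intro L2_norm_triangle L2_scale(1) L2_diff f(1) g(1) p(2) p'(2))
  also have "\<dots> = cmod a * L2_dist M f p + cmod b * L2_dist M g p'"
    using f(1) g(1) p(2) p'(2) by (simp add: L2_scale(3) L2_diff L2_dist_norm)
  also have "\<dots> \<le> cmod a * \<delta> + cmod b * \<delta>" using p(3) p'(3) by (intro add_mono mult_left_mono) auto
  also have "\<dots> < (cmod a + cmod b + 1) * \<delta>" using \<delta> by (simp add: algebra_simps)
  also have "\<dots> = \<epsilon>" using c by (simp add: \<delta>_def)
  finally have "L2_dist M (\<lambda>x. a * f x + b * g x) ?p < \<epsilon>" .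
  moreover have "?p \<in> complex_fun_span (range (\<lambda>k. kp k e))"
    by (intro complex_fun_span_add complex_fun_span_scale p(1) p'(1))
  moreover have "?p \<in> L2_funs M" by (intro L2_lincomb(1) p(2) p'(2))
  ultimately show ?thesis unfolding near_def by blast
qed

lemma near_zero: "0 < \<epsilon> \<Longrightarrow> near \<epsilon> (\<lambda>x. 0) e"
  unfolding near_def by (intro bexI[of _ "\<lambda>x. 0"]) (auto simp: L2_dist_def L2_zero complex_fun_span_0)

lemma near_limit:
  assumes f: "f \<in> L2_funs M" and s: "\<And>i::nat. s i \<in> L2_funs M" "\<And>i \<epsilon>. 0 < \<epsilon> \<Longrightarrow> near \<epsilon> (s i) e"
    and lim: "(\<lambda>i. L2_norm M (\<lambda>x. f x - s i x)) \<longlonglongrightarrow> 0" and "0 < \<epsilon>"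
  shows "near \<epsilon> f e"
proof -
  have "\<forall>\<^sub>F i in sequentially. L2_norm M (\<lambda>x. f x - s i x) < \<epsilon> / 2"
    using order_tendstoD(2)[OF lim, of "\<epsilon> / 2"] \<open>0 < \<epsilon>\<close> by simp
  then obtain i where i: "L2_norm M (\<lambda>x. f x - s i x) < \<epsilon> / 2" by (auto simp: eventually_sequentially)
  obtain p where p: "p \<in> complex_fun_span (range (\<lambda>k. kp k e))" "p \<in> L2_funs M" "L2_dist M (s i) p < \<epsilon> / 2"
    using s(2)[of "\<epsilon> / 2" i] \<open>0 < \<epsilon>\<close> by (auto simp: near_def)
  have "L2_dist M f p \<le> L2_norm M (\<lambda>x. f x - s i x) + L2_dist M (s i) p"
    using L2_norm_triangle[OF L2_diff[OF f s(1)[of i]] L2_diff[OF s(1)[of i] p(2)]] by (simp add: L2_dist_norm)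
  then have "L2_dist M f p < \<epsilon>" using i p(3) by simp
  then show ?thesis unfolding near_def using p by blast
qed

text \<open>The factor 2 is the one supplied by the approximation of measurable functions by simple
  functions; with the triangle inequality it gives the dominating function
  \<open>(3 * cmod (f x))\<^sup>2\<close>.\<close>

lemma L2_dominated:
  assumes f: "f \<in> L2_funs M" and s: "\<And>i::nat. s i \<in> borel_measurable M"
    and lim: "\<And>x. x \<in> space M \<Longrightarrow> (\<lambda>i. s i x) \<longlonglongrightarrow> f x"
    and le: "\<And>i x. x \<in> space M \<Longrightarrow> cmod (s i x) \<le> 2 * cmod (f x)"
  shows "s i \<in> L2_funs M" "(\<lambda>i. L2_norm M (\<lambda>x. f x - s i x)) \<longlonglongrightarrow> 0"
proof -
  have fm: "f \<in> borel_measurable M" using f by (rule L2_meas)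
  have int9: "integrable M (\<lambda>x. (3 * cmod (f x))\<^sup>2)" using L2_int[OF f] by (simp add: power_mult_distrib)
  have "integrable M (\<lambda>x. (cmod (s i x))\<^sup>2)"
  proof (rule Bochner_Integration.integrable_bound[OF int9])
    show "AE x in M. norm ((cmod (s i x))\<^sup>2) \<le> norm ((3 * cmod (f x))\<^sup>2)"
    proof (rule AE_I2)
      fix x assume "x \<in> space M"
      from le[OF this, of i] have "cmod (s i x) \<le> 3 * cmod (f x)" using norm_ge_zero[of "f x"] by linarith
      then show "norm ((cmod (s i x))\<^sup>2) \<le> norm ((3 * cmod (f x))\<^sup>2)"
        unfolding real_norm_def abs_power2 by (intro power_mono) auto
    qed
  qed (use s in measurable)
  then show "s i \<in> L2_funs M" using s by (simp add: L2_funs_def)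
  have "(\<lambda>i. L2_nsq M (\<lambda>x. f x - s i x)) \<longlonglongrightarrow> (\<integral>x. 0 \<partial>M)"
    unfolding L2_nsq_def
  proof (rule integral_dominated_convergence[OF _ _ int9])
    show "AE x in M. (\<lambda>i. (cmod (f x - s i x))\<^sup>2) \<longlonglongrightarrow> 0"
    proof (rule AE_I2)
      fix x assume "x \<in> space M"
      have "(\<lambda>i. (cmod (f x - s i x))\<^sup>2) \<longlonglongrightarrow> (cmod (f x - f x))\<^sup>2"
        by (intro tendsto_intros lim \<open>x \<in> space M\<close>)
      then show "(\<lambda>i. (cmod (f x - s i x))\<^sup>2) \<longlonglongrightarrow> 0" by simp
    qed
    show "AE x in M. norm ((cmod (f x - s i x))\<^sup>2) \<le> (3 * cmod (f x))\<^sup>2" for i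
    proof (rule AE_I2)
      fix x assume "x \<in> space M"
      have "cmod (f x - s i x) \<le> cmod (f x) + cmod (s i x)" by (rule norm_triangle_ineq4)
      then have "cmod (f x - s i x) \<le> 3 * cmod (f x)" using le[OF \<open>x \<in> space M\<close>, of i] by linarith
      then show "norm ((cmod (f x - s i x))\<^sup>2) \<le> (3 * cmod (f x))\<^sup>2"
        unfolding real_norm_def abs_power2 by (intro power_mono) auto
    qed
  qed (use s fm in measurable)
  then show "(\<lambda>i. L2_norm M (\<lambda>x. f x - s i x)) \<longlonglongrightarrow> 0"
    unfolding L2_norm_def using tendsto_real_sqrt[of _ 0] by force
qed

lemma indicator_L2: "A \<in> sets M \<Longrightarrow> (indicator A :: 'a \<Rightarrow> complex) \<in> L2_funs M"
  by (rule L2_bounded[OF finite_measure_axioms, of _ 1]) (auto simp: indicator_def)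

text \<open>The functions approximable from the cyclic space of \<open>e\<close> form a closed
  subspace. The sets with indicator in it are stable under complements and countable disjoint
  unions, so an intersection-stable generator suffices by Dynkin's argument; simple functions and
  limits give the rest.\<close>

lemma cyclic_of_generator:
  assumes G: "Int_stable G" "G \<subseteq> Pow (space M)" "sets M = sigma_sets (space M) G" "space M \<in> G"
    and e: "e \<in> L2_funs M" and near: "\<And>A \<epsilon>. A \<in> G \<Longrightarrow> 0 < \<epsilon> \<Longrightarrow> near \<epsilon> (indicator A) e"
  shows "L2_closed_span M (range (\<lambda>k. kp k e)) = L2_funs M"
proof -
  let ?N = "\<lambda>f. \<forall>\<epsilon>>0. near \<epsilon> f e"
  have GM: "A \<in> sets M" if "A \<in> G" for A using that G(3) by auto
  have N_set: "?N (indicator A)" if "A \<in> sets M" for A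
  proof (rule sigma_sets_induct_disjoint[OF G(1,2) that[unfolded G(3)]], goal_cases)
    case (1 A)
    then show ?case using near by blast
  next
    case 2
    have "indicator {} = (\<lambda>x. 0 :: complex)" by auto
    then show ?case using near_zero by simp
  next
    case (3 A)
    have A: "A \<in> sets M" using 3(1) G(3) by simp
    have "near \<epsilon> (\<lambda>x. 1 * indicator (space M) x + (-1) * indicator A x) e" if "0 < \<epsilon>" for \<epsilon>
      by (rule near_lincomb) (use that indicator_L2 near G(4) 3(2) A in auto)
    moreover have "(\<lambda>x. 1 * indicator (space M) x + (-1) * indicator A x :: complex) = indicator (space M - A)"
      using sets.sets_into_space[OF A] by (auto simp: indicator_def fun_eq_iff)
    ultimately show ?case by simp
  next
    case (4 A)
    have A: "A i \<in> sets M" for i using 4(2) G(3) by auto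
    let ?s = "\<lambda>n x. \<Sum>i<n. indicator (A i) x :: complex"
    let ?U = "\<Union>i. A i"
    have s_eq: "?s n x = indicator (\<Union>i<n. A i) x" for n x
      using 4(1) by (intro indicator_UN_disjoint[symmetric]) (auto simp: disjoint_family_on_def)
    have sN: "?N (?s n)" for n
    proof (induction n)
      case 0
      show ?case using near_zero by simp
    next
      case (Suc n)
      have "near \<epsilon> (\<lambda>x. 1 * ?s n x + 1 * indicator (A n) x) e" if "0 < \<epsilon>" for \<epsilon>
        by (rule near_lincomb) (use that indicator_L2 A Suc 4(3) in \<open>auto intro: L2_sum\<close>)
      then show ?case by simp
    qed
    have U: "(indicator ?U :: 'a \<Rightarrow> complex) \<in> L2_funs M" using A by (intro indicator_L2) auto
    have s1: "?s i \<in> borel_measurable M" for i using A by measurable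
    have s2: "(\<lambda>i. ?s i x) \<longlonglongrightarrow> indicator ?U x" for x
      unfolding s_eq by (rule LIMSEQ_indicator_UN)
    have s3: "cmod (?s i x) \<le> 2 * cmod (indicator ?U x)" for i x
      unfolding s_eq by (auto simp: indicator_def)
    note d = L2_dominated[OF U s1 s2 s3]
    show ?case
      using near_limit[OF U d(1) _ d(2)] sN by blast
  qed
  have N_simple: "?N s" "s \<in> L2_funs M" if s: "simple_function M s" for s
  proof -
    let ?s = "\<lambda>x. \<Sum>y\<in>s ` space M. y * indicator (s -` {y} \<inter> space M) x"
    have fin: "finite (s ` space M)" using s by (rule simple_functionD)
    have sm: "s -` {y} \<inter> space M \<in> sets M" for y using s by (rule simple_functionD)
    have sum: "?N (\<lambda>x. \<Sum>y\<in>I. y * indicator (s -` {y} \<inter> space M) x) \<and>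
        (\<lambda>x. \<Sum>y\<in>I. y * indicator (s -` {y} \<inter> space M) x) \<in> L2_funs M" if "finite I" for I
      using that
    proof (induction I)
      case empty
      show ?case using near_zero by (simp add: L2_zero)
    next
      case (insert y I)
      have "near \<epsilon> (\<lambda>x. y * indicator (s -` {y} \<inter> space M) x + 1 * (\<Sum>y\<in>I. y * indicator (s -` {y} \<inter> space M) x)) e" if "0 < \<epsilon>" for \<epsilon>
        by (rule near_lincomb) (use that indicator_L2[OF sm] N_set[OF sm] insert(3) in blast)+
      moreover have "(\<lambda>x. y * indicator (s -` {y} \<inter> space M) x + 1 * (\<Sum>y\<in>I. y * indicator (s -` {y} \<inter> space M) x)) \<in> L2_funs M"
        by (rule L2_lincomb(1)[OF indicator_L2[OF sm] conjunct2[OF insert(3)]])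
      ultimately show ?case unfolding sum.insert[OF insert(1,2)] mult_1 by blast
    qed
    have eq: "s x = ?s x" if "x \<in> space M" for x
    proof -
      have "?s x = (\<Sum>y\<in>s ` space M. if y = s x then s x else 0)"
        by (intro sum.cong refl) (use that in \<open>auto simp: indicator_def\<close>)
      also have "\<dots> = s x" using that fin by simp
      finally show ?thesis ..
    qed
    have d0: "L2_norm M (\<lambda>x. s x - ?s x) = 0"
    proof -
      have "L2_nsq M (\<lambda>x. s x - ?s x) = (\<integral>x. 0 \<partial>M)"
        unfolding L2_nsq_def
      proof (rule Bochner_Integration.integral_cong[OF refl])
        fix x assume "x \<in> space M"
        show "(cmod (s x - ?s x))\<^sup>2 = 0" unfolding eq[OF \<open>x \<in> space M\<close>, symmetric] by simp
      qed
      then show ?thesis by (simp add: L2_norm_def)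
    qed
    have sms: "s \<in> borel_measurable M" using s by (rule borel_measurable_simple_function)
    obtain B where "\<And>y. y \<in> s ` space M \<Longrightarrow> cmod y \<le> B" using finite_imp_bounded[OF fin] by (auto simp: bounded_iff)
    then show sL: "s \<in> L2_funs M" by (intro L2_bounded[OF finite_measure_axioms sms]) auto
    show "?N s"
    proof (intro allI impI)
      fix \<epsilon> :: real assume "0 < \<epsilon>"
      show "near \<epsilon> s e"
        by (rule near_limit[OF sL, of "\<lambda>_. ?s"]) (use sum[OF fin] d0 \<open>0 < \<epsilon>\<close> in auto)
    qed
  qed
  have "?N f" if f: "f \<in> L2_funs M" for f
  proof -
    from borel_measurable_implies_sequence_metric[OF L2_meas[OF f], of 0] obtain s where
      s: "\<And>i. simple_function M (s i)" "\<And>x. x \<in> space M \<Longrightarrow> (\<lambda>i. s i x) \<longlonglongrightarrow> f x"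
         "\<And>i x. x \<in> space M \<Longrightarrow> cmod (s i x) \<le> 2 * cmod (f x)"
      unfolding dist_norm diff_0_right by blast
    have "(\<lambda>i. L2_norm M (\<lambda>x. f x - s i x)) \<longlonglongrightarrow> 0"
      by (rule L2_dominated[OF f]) (use s in \<open>auto intro: borel_measurable_simple_function\<close>)
    then show ?thesis using near_limit[OF f, of s] N_simple[OF s(1)] by blast
  qed
  then show ?thesis by (auto simp: near_closed_span)
qed

end

section \<open>Random rotations of blocks\<close>

abbreviation unif :: "nat \<Rightarrow> nat measure" where
  "unif n \<equiv> uniform_count_measure {..<n}"

lemma unif_L2 [simp]: "f \<in> L2_funs (unif n)"
proof -
  have "integrable (unif n) g" for g :: "nat \<Rightarrow> real"
    unfolding uniform_count_measure_def by (rule integrable_point_measure_finite) simp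
  then show ?thesis by (simp add: L2_funs_def measurable_def sets_uniform_count_measure space_uniform_count_measure)
qed

lemma unif_nsq: "L2_nsq (unif n) f = (\<Sum>s<n. (cmod (f s))\<^sup>2) / n"
  unfolding L2_nsq_def by (subst integral_uniform_count_measure) (simp_all add: divide_real_def)

lemma unif_inner: "L2_inner (unif n) f g = (\<Sum>s<n. f s * cnj (g s)) / of_nat n"
proof -
  have "L2_inner (unif n) f g = (\<Sum>s<n. f s * cnj (g s)) /\<^sub>R n"
    unfolding L2_inner_def uniform_count_measure_def
    by (subst lebesgue_integral_point_measure_finite) (simp_all add: scaleR_sum_right divide_inverse)
  then show ?thesis by (simp add: scaleR_conv_of_real divide_inverse)
qed

text \<open>A Gram determinant as a sum of squared two-by-two minors. In this form the area can be
  averaged over the rotations minor by minor.\<close>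

lemma Lagrange_identity:
  fixes u v :: "nat \<Rightarrow> complex"
  shows "(\<Sum>s<n. \<Sum>s'<n. (cmod (u s * v s' - v s * u s'))\<^sup>2) =
    2 * ((\<Sum>s<n. (cmod (u s))\<^sup>2) * (\<Sum>s<n. (cmod (v s))\<^sup>2) - (cmod (\<Sum>s<n. u s * cnj (v s)))\<^sup>2)"
proof -
  let ?x = "\<lambda>s. u s * cnj (v s)"
  have pt: "(cmod (u s * v s' - v s * u s'))\<^sup>2 =
      (cmod (u s))\<^sup>2 * (cmod (v s'))\<^sup>2 + (cmod (v s))\<^sup>2 * (cmod (u s'))\<^sup>2 - 2 * Re (?x s * cnj (?x s'))" for s s'
    using cmod_sq_lincomb[of "u s" "v s'" "- v s" "u s'"] by (simp add: algebra_simps)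
  have "(\<Sum>s<n. \<Sum>s'<n. Re (?x s * cnj (?x s'))) = Re ((\<Sum>s<n. ?x s) * cnj (\<Sum>s<n. ?x s))"
    unfolding cnj_sum sum_product by (simp only: Re_sum)
  also have "\<dots> = (cmod (\<Sum>s<n. ?x s))\<^sup>2"
    unfolding complex_norm_square[symmetric] by simp
  finally have e3: "(\<Sum>s<n. \<Sum>s'<n. 2 * Re (?x s * cnj (?x s'))) = 2 * (cmod (\<Sum>s<n. ?x s))\<^sup>2"
    by (simp only: sum_distrib_left[symmetric])
  show ?thesis unfolding pt sum_subtractf sum.distrib e3 sum_product[symmetric] by simp
qed

lemma unif_area_sq:
  assumes "0 < n"
  shows "(L2_area (unif n) u v)\<^sup>2 = (\<Sum>s<n. \<Sum>s'<n. (cmod (u s * v s' - v s * u s'))\<^sup>2) / (2 * (real n)\<^sup>2)"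
  unfolding L2_area_sq[OF unif_L2 unif_L2] unif_nsq unif_inner Lagrange_identity
  using assms by (simp add: norm_divide power_divide power2_eq_square[of "real n"] diff_divide_distrib)

lemma unif_area_reindex:
  assumes "bij_betw \<pi> {..<n} {..<n}"
  shows "L2_area (unif n) (\<lambda>s. u (\<pi> s)) (\<lambda>s. v (\<pi> s)) = L2_area (unif n) u v"
proof -
  have "(\<Sum>s<n. f (\<pi> s)) = (\<Sum>s<n. f s)" for f :: "nat \<Rightarrow> 'b::comm_monoid_add"
    using assms by (rule sum.reindex_bij_betw)
  from this[of "\<lambda>s. (cmod (u s))\<^sup>2"] this[of "\<lambda>s. (cmod (v s))\<^sup>2"] this[of "\<lambda>s. u s * cnj (v s)"]
  show ?thesis unfolding L2_area_def unif_nsq unif_inner by simp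
qed

section \<open>Second moments over independent rotations\<close>

definition rotations :: "nat \<Rightarrow> nat \<Rightarrow> (nat \<Rightarrow> nat) set" where
  "rotations q h = {b. \<forall>y. if y < q then b y < h else b y = 0}"

lemma finite_rotations: "finite (rotations q h)"
proof -
  have "rotations q h \<subseteq> {b. \<forall>y. (y \<in> {..<q} \<longrightarrow> b y \<in> {..<h}) \<and> (y \<notin> {..<q} \<longrightarrow> b y = 0)}"
    by (auto simp: rotations_def split: if_splits)
  moreover have "finite \<dots>" by (rule finite_set_of_finite_funs) auto
  ultimately show ?thesis by (rule finite_subset)
qed

lemma rotations_less: "b \<in> rotations q h \<Longrightarrow> y < q \<Longrightarrow> b y < h"
  by (auto simp: rotations_def split: if_splits)

lemma rotations_upd: "b \<in> rotations q h \<Longrightarrow> y < q \<Longrightarrow> a < h \<Longrightarrow> b(y := a) \<in> rotations q h"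
  by (auto simp: rotations_def)

text \<open>Redrawing one coordinate preserves the uniform distribution: exchanging the fresh value
  with the old one is an involution on pairs. It permits summing over one coordinate while the
  others are held fixed.\<close>

lemma sum_rotations_resample:
  fixes f :: "(nat \<Rightarrow> nat) \<Rightarrow> complex"
  assumes y: "y < q"
  shows "(\<Sum>b\<in>rotations q h. \<Sum>a<h. f (b(y := a))) = of_nat h * (\<Sum>b\<in>rotations q h. f b)"
proof -
  let ?i = "\<lambda>(b, a). (b(y := a), b y)"
  have "(\<Sum>b\<in>rotations q h. \<Sum>a<h. f (b(y := a))) = (\<Sum>(b, a)\<in>rotations q h \<times> {..<h}. f (b(y := a)))"
    by (simp add: sum.cartesian_product)
  also have "\<dots> = (\<Sum>(b, a)\<in>rotations q h \<times> {..<h}. f b)"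
    by (rule sum.reindex_bij_witness[of _ ?i ?i]) (use y in \<open>auto simp: rotations_upd rotations_less\<close>)
  also have "\<dots> = of_nat h * (\<Sum>b\<in>rotations q h. f b)"
    by (simp add: sum.cartesian_product[symmetric] sum_distrib_left)
  finally show ?thesis .
qed

text \<open>The products \<open>\<xi> y y'\<close> are orthogonal for different unordered pairs, since each factor has mean
  zero in every coordinate. No higher moments enter, because \<open>\<xi> y y = 0\<close>.\<close>

lemma rotations_wedge_orth:
  fixes P Q :: "nat \<Rightarrow> complex" and y y' w w' :: nat
  assumes h: "0 < h" and P0: "(\<Sum>a<h. P a) = 0" and Q0: "(\<Sum>a<h. Q a) = 0"
    and lt: "y < q" "y' < q" "w < q" "w' < q"
  defines "\<xi> \<equiv> \<lambda>(b::nat \<Rightarrow> nat) y y'. P (b y) * Q (b y') - Q (b y) * P (b y')"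
  shows "(of_nat h)\<^sup>2 * (\<Sum>b\<in>rotations q h. \<xi> b y y' * cnj (\<xi> b w w')) =
    (if y \<noteq> y' then (if w = y \<and> w' = y' then 1 else if w = y' \<and> w' = y then - 1 else 0) else 0) *
    of_nat (card (rotations q h)) * (\<Sum>a<h. \<Sum>a'<h. (P a * Q a' - Q a * P a') * cnj (P a * Q a' - Q a * P a'))"
proof -
  define D where "D = (\<Sum>a<h. \<Sum>a'<h. (P a * Q a' - Q a * P a') * cnj (P a * Q a' - Q a * P a'))"
  let ?E = "\<lambda>f. \<Sum>b\<in>rotations q h. f b :: complex"
  have anti: "\<xi> b y y' = - \<xi> b y' y" for b y y' by (simp add: \<xi>_def)
  \<comment> \<open>If \<open>y\<close> differs from \<open>y'\<close>, \<open>w\<close> and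
    \<open>w'\<close>, the coordinate \<open>b y\<close> enters linearly through
    \<open>P (b y)\<close> and \<open>Q (b y)\<close>, both of mean zero.\<close>
  have kill: "?E (\<lambda>b. \<xi> b y y' * cnj (\<xi> b w w')) = 0" if "y \<noteq> y'" "y \<noteq> w" "y \<noteq> w'" "y < q" for y y' w w'
  proof -
    have "(\<Sum>a<h. \<xi> (b(y := a)) y y' * cnj (\<xi> (b(y := a)) w w')) = 0" for b
    proof -
      have "(\<Sum>a<h. \<xi> (b(y := a)) y y' * cnj (\<xi> (b(y := a)) w w')) =
          ((\<Sum>a<h. P a) * Q (b y') - (\<Sum>a<h. Q a) * P (b y')) * cnj (\<xi> b w w')"
        unfolding sum_distrib_right sum_subtractf[symmetric] \<xi>_def using that by (intro sum.cong refl) auto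
      then show ?thesis by (simp add: P0 Q0)
    qed
    then have "of_nat h * ?E (\<lambda>b. \<xi> b y y' * cnj (\<xi> b w w')) = 0"
      unfolding sum_rotations_resample[OF \<open>y < q\<close>, where f = "\<lambda>b. \<xi> b y y' * cnj (\<xi> b w w')", symmetric] by simp
    then show ?thesis using h by simp
  qed
  have same: "(of_nat h)\<^sup>2 * ?E (\<lambda>b. \<xi> b y y' * cnj (\<xi> b y y')) = of_nat (card (rotations q h)) * D"
    if ne: "y \<noteq> y'" "y < q" "y' < q" for y y'
  proof -
    have "(of_nat h)\<^sup>2 * ?E (\<lambda>b. \<xi> b y y' * cnj (\<xi> b y y')) =
        of_nat h * ?E (\<lambda>b. \<Sum>a<h. \<xi> (b(y := a)) y y' * cnj (\<xi> (b(y := a)) y y'))"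
      unfolding sum_rotations_resample[OF \<open>y < q\<close>, where f = "\<lambda>b. \<xi> b y y' * cnj (\<xi> b y y')"] by (simp add: power2_eq_square)
    also have "\<dots> = ?E (\<lambda>b. \<Sum>a'<h. \<Sum>a<h. \<xi> (b(y' := a', y := a)) y y' * cnj (\<xi> (b(y' := a', y := a)) y y'))"
      using sum_rotations_resample[OF \<open>y' < q\<close>, where f = "\<lambda>b. \<Sum>a<h. \<xi> (b(y := a)) y y' * cnj (\<xi> (b(y := a)) y y')"] by (rule sym)
    also have "\<dots> = ?E (\<lambda>b. D)"
    proof (rule sum.cong[OF refl])
      fix b :: "nat \<Rightarrow> nat"
      have \<xi>: "\<xi> (b(y' := a', y := a)) y y' = P a * Q a' - Q a * P a'" for a a'
        using ne by (simp add: \<xi>_def)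
      have "(\<Sum>a'<h. \<Sum>a<h. \<xi> (b(y' := a', y := a)) y y' * cnj (\<xi> (b(y' := a', y := a)) y y')) =
          (\<Sum>a'<h. \<Sum>a<h. (P a * Q a' - Q a * P a') * cnj (P a * Q a' - Q a * P a'))"
        unfolding \<xi> ..
      also have "\<dots> = D" unfolding D_def by (rule sum.swap)
      finally show "(\<Sum>a'<h. \<Sum>a<h. \<xi> (b(y' := a', y := a)) y y' * cnj (\<xi> (b(y' := a', y := a)) y y')) = D" .
    qed
    finally show ?thesis by (simp only: sum_constant)
  qed
  have "(of_nat h)\<^sup>2 * ?E (\<lambda>b. \<xi> b y y' * cnj (\<xi> b w w')) =
    (if y \<noteq> y' then (if w = y \<and> w' = y' then 1 else if w = y' \<and> w' = y then - 1 else 0) else 0) *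
    of_nat (card (rotations q h)) * D"
  proof (cases "y = y' \<or> w = w'")
    case True
    have z: "\<xi> b y y = 0" for b y by (simp add: \<xi>_def mult.commute)
    show ?thesis using True by (elim disjE) (simp_all add: z)
  next
    case False
    \<comment> \<open>Unless the two unordered pairs agree, one of \<open>y\<close>,
      \<open>y'\<close> lies outside \<open>{w, w'}\<close> and can be averaged away.\<close>
    consider "w = y" "w' = y'" | "w = y'" "w' = y" | "y \<noteq> w" "y \<noteq> w'" | "y' \<noteq> w" "y' \<noteq> w'"
      using False by auto
    then show ?thesis
    proof cases
      case 1
      then show ?thesis using same[of y y'] False lt by simp
    next
      case 2
      have "?E (\<lambda>b. \<xi> b y y' * cnj (\<xi> b w w')) = - ?E (\<lambda>b. \<xi> b y y' * cnj (\<xi> b y y'))"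
        unfolding 2 anti[of _ y' y] by (simp add: sum_negf)
      then show ?thesis using same[of y y'] False lt 2 by simp
    next
      case 3
      then show ?thesis using kill[of y y' w w'] False lt by auto
    next
      case 4
      have "?E (\<lambda>b. \<xi> b y y' * cnj (\<xi> b w w')) = - ?E (\<lambda>b. \<xi> b y' y * cnj (\<xi> b w w'))"
        unfolding anti[of _ y y'] by (simp add: sum_negf)
      then show ?thesis using kill[of y' y w w'] False lt 4 by auto
    qed
  qed
  then show ?thesis unfolding D_def .
qed

lemma double_sum_norm_square:
  fixes F :: "'a \<Rightarrow> 'b \<Rightarrow> complex"
  shows "(\<Sum>y\<in>A. \<Sum>y'\<in>B. F y y') * cnj (\<Sum>y\<in>A. \<Sum>y'\<in>B. F y y') =
    (\<Sum>y\<in>A. \<Sum>y'\<in>B. \<Sum>w\<in>A. \<Sum>w'\<in>B. F y y' * cnj (F w w'))"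
  unfolding cnj_sum sum_product by (rule sum.cong[OF refl], rule sum.swap)

text \<open>By orthogonality an ordered pair of blocks is correlated only with itself and, with
  opposite sign, with its reversal. The coefficients then combine to the Gram determinant of
  \<open>k\<close> and \<open>k'\<close>, so the arrangement of the blocks enters the second moment
  through this determinant alone.\<close>

lemma rotations_wedge_moment:
  fixes P Q k k' :: "nat \<Rightarrow> complex" and q h :: nat
  assumes h: "0 < h" and P0: "(\<Sum>a<h. P a) = 0" and Q0: "(\<Sum>a<h. Q a) = 0"
  defines "Y \<equiv> \<lambda>(k::nat \<Rightarrow> complex) R (b::nat \<Rightarrow> nat). \<Sum>y<q. k y * (R (b y) :: complex)"
  shows "(real h)\<^sup>2 * (\<Sum>b\<in>rotations q h. (cmod (Y k P b * Y k' Q b - Y k Q b * Y k' P b))\<^sup>2) =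
    card (rotations q h) * (\<Sum>a<h. \<Sum>a'<h. (cmod (P a * Q a' - Q a * P a'))\<^sup>2) *
    ((\<Sum>y<q. (cmod (k y))\<^sup>2) * (\<Sum>y<q. (cmod (k' y))\<^sup>2) - (cmod (\<Sum>y<q. k y * cnj (k' y)))\<^sup>2)"
proof -
  define \<xi> where "\<xi> = (\<lambda>(b::nat \<Rightarrow> nat) y y'. P (b y) * Q (b y') - Q (b y) * P (b y'))"
  let ?N = "of_nat (card (rotations q h)) :: complex"
  let ?D = "\<Sum>a<h. \<Sum>a'<h. (P a * Q a' - Q a * P a') * cnj (P a * Q a' - Q a * P a')"
  have X: "Y k P b * Y k' Q b - Y k Q b * Y k' P b = (\<Sum>y<q. \<Sum>y'<q. (k y * k' y') * \<xi> b y y')" for b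
    unfolding Y_def sum_product sum_subtractf[symmetric] \<xi>_def by (simp add: algebra_simps)
  let ?c = "\<lambda>y y' w w'. (k y * k' y') * cnj (k w * k' w')"
  let ?d = "\<lambda>y y' w w'. if y \<noteq> y' then (if w = y \<and> w' = y' then 1 else if w = y' \<and> w' = y then - 1 else 0) else 0 :: complex"
  have orth: "(of_nat h)\<^sup>2 * (\<Sum>b\<in>rotations q h. \<xi> b y y' * cnj (\<xi> b w w')) = ?d y y' w w' * ?N * ?D"
    if "y < q" "y' < q" "w < q" "w' < q" for y y' w w'
    unfolding \<xi>_def by (rule rotations_wedge_orth[OF h P0 Q0 that])
  have "(of_nat h)\<^sup>2 * (\<Sum>b\<in>rotations q h. complex_of_real ((cmod (Y k P b * Y k' Q b - Y k Q b * Y k' P b))\<^sup>2)) =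
      (of_nat h)\<^sup>2 * (\<Sum>b\<in>rotations q h. \<Sum>y<q. \<Sum>y'<q. \<Sum>w<q. \<Sum>w'<q. ?c y y' w w' * (\<xi> b y y' * cnj (\<xi> b w w')))"
  proof (intro arg_cong2[where f = "(*)"] sum.cong refl)
    fix b
    show "complex_of_real ((cmod (Y k P b * Y k' Q b - Y k Q b * Y k' P b))\<^sup>2) =
        (\<Sum>y<q. \<Sum>y'<q. \<Sum>w<q. \<Sum>w'<q. ?c y y' w w' * (\<xi> b y y' * cnj (\<xi> b w w')))"
      unfolding X complex_norm_square
      by (simp only: double_sum_norm_square complex_cnj_mult mult_ac)
  qed
  also have "\<dots> = (\<Sum>y<q. \<Sum>y'<q. \<Sum>w<q. \<Sum>w'<q. ?c y y' w w' * ((of_nat h)\<^sup>2 * (\<Sum>b\<in>rotations q h. \<xi> b y y' * cnj (\<xi> b w w'))))"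
    unfolding sum_distrib_left sum.swap[of _ "rotations q h" "{..<q}"]
    by (intro sum.cong refl) (simp only: mult_ac)
  also have "\<dots> = (\<Sum>y<q. \<Sum>y'<q. \<Sum>w<q. \<Sum>w'<q. ?c y y' w w' * (?d y y' w w' * ?N * ?D))"
    by (intro sum.cong refl) (simp only: orth lessThan_iff)
  also have "\<dots> = (\<Sum>y<q. \<Sum>y'<q. \<Sum>w<q. \<Sum>w'<q. ?c y y' w w' * ?d y y' w w') * (?N * ?D)"
    by (simp add: sum_distrib_right mult.assoc)
  also have "(\<Sum>y<q. \<Sum>y'<q. \<Sum>w<q. \<Sum>w'<q. ?c y y' w w' * ?d y y' w w') =
      (\<Sum>y<q. \<Sum>y'<q. ?c y y' y y' - ?c y y' y' y)"
  proof (intro sum.cong refl)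
    fix y y' assume y: "y \<in> {..<q}" "y' \<in> {..<q}"
    show "(\<Sum>w<q. \<Sum>w'<q. ?c y y' w w' * ?d y y' w w') = ?c y y' y y' - ?c y y' y' y"
    proof (cases "y = y'")
      case False
      have "(\<Sum>w<q. \<Sum>w'<q. ?c y y' w w' * ?d y y' w w') =
        (\<Sum>w<q. \<Sum>w'<q. (if w' = y' then (if w = y then ?c y y' y y' else 0) else 0) -
          (if w' = y then (if w = y' then ?c y y' y' y else 0) else 0))"
        using False by (intro sum.cong refl) auto
      also have "\<dots> = ?c y y' y y' - ?c y y' y' y"
        using y by (simp add: sum_subtractf)
      finally show ?thesis .
    qed simp
  qed
  also have "(\<Sum>y<q. \<Sum>y'<q. ?c y y' y y' - ?c y y' y' y) =
      complex_of_real ((\<Sum>y<q. (cmod (k y))\<^sup>2) * (\<Sum>y<q. (cmod (k' y))\<^sup>2) - (cmod (\<Sum>y<q. k y * cnj (k' y)))\<^sup>2)"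
  proof -
    have "complex_of_real ((\<Sum>y<q. (cmod (k y))\<^sup>2) * (\<Sum>y<q. (cmod (k' y))\<^sup>2) - (cmod (\<Sum>y<q. k y * cnj (k' y)))\<^sup>2) =
       (\<Sum>y<q. k y * cnj (k y)) * (\<Sum>y<q. k' y * cnj (k' y)) - (\<Sum>y<q. k y * cnj (k' y)) * (\<Sum>y<q. cnj (k y) * k' y)"
      by (simp only: of_real_diff of_real_mult of_real_sum complex_norm_square cnj_sum complex_cnj_mult complex_cnj_cnj)
    also have "\<dots> = (\<Sum>y<q. \<Sum>y'<q. ?c y y' y y' - ?c y y' y' y)"
      unfolding sum_product sum_subtractf[symmetric] by (simp add: algebra_simps)
    finally show ?thesis ..
  qed
  also have "?N * ?D = complex_of_real (card (rotations q h) * (\<Sum>a<h. \<Sum>a'<h. (cmod (P a * Q a' - Q a * P a'))\<^sup>2))"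
    by (simp only: of_real_sum of_real_mult of_real_of_nat_eq complex_norm_square)
  finally have "complex_of_real ((real h)\<^sup>2 * (\<Sum>b\<in>rotations q h. (cmod (Y k P b * Y k' Q b - Y k Q b * Y k' P b))\<^sup>2)) =
    complex_of_real (((\<Sum>y<q. (cmod (k y))\<^sup>2) * (\<Sum>y<q. (cmod (k' y))\<^sup>2) - (cmod (\<Sum>y<q. k y * cnj (k' y)))\<^sup>2) *
      (card (rotations q h) * (\<Sum>a<h. \<Sum>a'<h. (cmod (P a * Q a' - Q a * P a'))\<^sup>2)))"
    by (simp only: of_real_mult of_real_power of_real_sum of_real_of_nat_eq)
  then show ?thesis by (simp only: of_real_eq_iff mult_ac)
qed

section \<open>Words, windows and blocks\<close>

definition window :: "nat \<Rightarrow> (nat \<Rightarrow> complex) \<Rightarrow> nat \<Rightarrow> complex \<Rightarrow> nat \<Rightarrow> complex" where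
  "window h G n z s = (\<Sum>t<n. G ((s + t) mod h) * z ^ t)"

text \<open>The window length \<open>n\<close> is independent of the number \<open>K\<close> of
  frequencies, so that words of several levels can be compared over the same frequencies. The
  normalization is the one for which Parseval bounds the value for complete words by 1.\<close>

definition mean_area :: "nat \<Rightarrow> nat \<Rightarrow> nat \<Rightarrow> (nat \<Rightarrow> complex) \<Rightarrow> (nat \<Rightarrow> complex) \<Rightarrow> real" where
  "mean_area K h n G1 G2 =
     (\<Sum>w<K. L2_area (unif h) (window h G1 n (root_unity K w)) (window h G2 n (root_unity K w))) / (real K * real n)"

text \<open>With \<open>h\<close> the height of a level this is composition of \<open>G\<close> with
  the projection \<open>iceberg_proj\<close> to that level, written so that the rotations
  \<open>b\<close> of this level alone can vary.\<close>

definition lift_word :: "nat \<Rightarrow> (nat \<Rightarrow> nat) \<Rightarrow> (nat \<Rightarrow> complex) \<Rightarrow> nat \<Rightarrow> complex" where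
  "lift_word h b G u = G (nat ((int (u mod h) - int (b (u div h))) mod int h))"

text \<open>The sum starts at \<open>j = 1\<close> because a window that begins inside block
  \<open>s\<close> covers this block only partly; the remainder belongs to \<open>edge_sum\<close>.
  A block rotated by \<open>b y\<close> is the word read cyclically from
  \<open>h - b y\<close>.\<close>

definition block_sum :: "nat \<Rightarrow> nat \<Rightarrow> nat \<Rightarrow> (nat \<Rightarrow> nat) \<Rightarrow> (nat \<Rightarrow> complex) \<Rightarrow> complex \<Rightarrow> nat \<Rightarrow> complex" where
  "block_sum L q h b G z s = (\<Sum>j\<in>{1..<L}. z ^ (j * h) * window h G h z (h - b ((s + j) mod q)))"

lemma lift_word_block:
  assumes "t < h" "b y < h"
  shows "lift_word h b G (y * h + t) = G ((h - b y + t) mod h)"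
proof -
  have d: "(y * h + t) div h = y" "(y * h + t) mod h = t" using assms(1) by auto
  have "int ((h - b y + t) mod h) = (int h - int (b y) + int t) mod int h"
    using assms(2) by (simp add: of_nat_mod of_nat_diff algebra_simps)
  also have "\<dots> = (int t - int (b y)) mod int h"
    using mod_add_self1[of "int h" "int t - int (b y)"] by (simp add: algebra_simps)
  finally have "nat ((int t - int (b y)) mod int h) = (h - b y + t) mod h" by (metis nat_int)
  then show ?thesis by (simp only: lift_word_def d)
qed

lemma block_mod:
  fixes y q t h :: nat
  assumes "t < h" shows "(y * h + t) mod (q * h) = (y mod q) * h + t"
  using mod_mult2_eq[of "y * h + t" h q] assms by (simp add: mult.commute)

lemma sum_blocks:
  fixes f :: "nat \<Rightarrow> complex"
  assumes "1 \<le> L" shows "(\<Sum>u\<in>{h..<L * h}. f u) = (\<Sum>j\<in>{1..<L}. \<Sum>t<h. f (j * h + t))"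
  using assms
proof (induction L rule: dec_induct)
  case base
  then show ?case by simp
next
  case (step L)
  have hL: "h \<le> L * h" using step.hyps mult_le_mono1[of 1 L h] by simp
  have "{h..<Suc L * h} = {h..<L * h} \<union> {L * h..<L * h + h}"
    by (subst ivl_disj_un_two(3)[OF hL]) (simp_all add: add.commute)
  then have "(\<Sum>u\<in>{h..<Suc L * h}. f u) = (\<Sum>u\<in>{h..<L * h}. f u) + (\<Sum>u\<in>{L * h..<L * h + h}. f u)"
    by (simp only:) (rule sum.union_disjoint, auto)
  also have "(\<Sum>u\<in>{L * h..<L * h + h}. f u) = (\<Sum>t<h. f (L * h + t))"
    by (rule sum.reindex_bij_witness[of _ "\<lambda>t. L * h + t" "\<lambda>u. u - L * h"]) auto
  finally show ?case using step by simp
qed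

lemma block_sum_word:
  assumes b: "\<And>y. y < q \<Longrightarrow> b y < h" and q: "0 < q" and L: "1 \<le> L"
  shows "block_sum L q h b G z s = (\<Sum>u\<in>{h..<L * h}. lift_word h b G ((s * h + u) mod (q * h)) * z ^ u)"
proof -
  have "lift_word h b G ((s * h + (j * h + t)) mod (q * h)) = G ((h - b ((s + j) mod q) + t) mod h)"
    if "t < h" for j t
  proof -
    have e: "s * h + (j * h + t) = (s + j) * h + t" by (simp add: algebra_simps)
    show ?thesis unfolding e block_mod[OF that] using q by (intro lift_word_block that b) simp
  qed
  then show ?thesis unfolding sum_blocks[OF L] block_sum_def window_def sum_distrib_left
    by (intro sum.cong refl) (simp add: power_add mult_ac)
qed

definition edge_sum :: "nat \<Rightarrow> nat \<Rightarrow> nat \<Rightarrow> (nat \<Rightarrow> nat) \<Rightarrow> (nat \<Rightarrow> complex) \<Rightarrow> complex \<Rightarrow> nat \<Rightarrow> nat \<Rightarrow> complex" where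
  "edge_sum L q h b G z s t =
     (\<Sum>u\<in>{t..<h} \<union> {L * h..<L * h + t}. lift_word h b G ((s * h + u) mod (q * h)) * z ^ u)"

text \<open>The factor \<open>z ^ t\<close> moves the origin of the exponents to the beginning of
  block \<open>s\<close>, which makes the contribution of the complete blocks independent of
  \<open>t\<close>. The two incomplete pieces have \<open>h\<close> letters together.\<close>

lemma window_split:
  assumes b: "\<And>y. y < q \<Longrightarrow> b y < h" and q: "0 < q" and L: "1 \<le> L" and t: "t < h"
  shows "z ^ t * window (q * h) (lift_word h b G) (L * h) z (s * h + t) =
    block_sum L q h b G z s + edge_sum L q h b G z s t"
proof -
  let ?f = "\<lambda>u. lift_word h b G ((s * h + u) mod (q * h)) * z ^ u"
  have hL: "h \<le> L * h" using mult_le_mono1[OF L, of h] by simp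
  have "z ^ t * window (q * h) (lift_word h b G) (L * h) z (s * h + t) = (\<Sum>v<L * h. ?f (t + v))"
    unfolding window_def sum_distrib_left by (intro sum.cong refl) (simp add: power_add add.assoc mult_ac)
  also have "\<dots> = (\<Sum>u\<in>{t..<L * h + t}. ?f u)"
    by (rule sum.reindex_bij_witness[of _ "\<lambda>u. u - t" "\<lambda>v. t + v"]) auto
  also have "{t..<L * h + t} = {h..<L * h} \<union> ({t..<h} \<union> {L * h..<L * h + t})"
    using t hL unfolding set_eq_iff Un_iff atLeastLessThan_iff by linarith
  also have "(\<Sum>u\<in>\<dots>. ?f u) = (\<Sum>u\<in>{h..<L * h}. ?f u) + (\<Sum>u\<in>{t..<h} \<union> {L * h..<L * h + t}. ?f u)"
  proof (rule sum.union_disjoint)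
    show "{h..<L * h} \<inter> ({t..<h} \<union> {L * h..<L * h + t}) = {}"
      unfolding set_eq_iff Int_iff Un_iff atLeastLessThan_iff empty_iff using hL by (intro allI iffI; elim conjE disjE FalseE; linarith)
  qed auto
  also have "(\<Sum>u\<in>{h..<L * h}. ?f u) = block_sum L q h b G z s"
    by (rule block_sum_word[OF _ q L, symmetric]) (rule b)
  finally show ?thesis unfolding edge_sum_def .
qed

lemma inj_on_mod_window: "inj_on (\<lambda>u. u mod K) {a..<a + K}" for a K :: nat
proof (rule inj_onI)
  have *: "u = u'" if "u \<le> u'" "u' < u + K" "u mod K = u' mod K" for u u' :: nat
  proof -
    have "K dvd u' - u" using that by (metis mod_eq_dvd_iff_nat)
    moreover have "u' - u < K" using that by simp
    ultimately have "u' - u = 0" by (meson dvd_imp_le linorder_not_less not_gr_zero)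
    then show ?thesis using that by simp
  qed
  fix u u' assume "u \<in> {a..<a + K}" "u' \<in> {a..<a + K}" "u mod K = u' mod K"
  then show "u = u'" using *[of u u'] *[of u' u] by (cases "u \<le> u'") auto
qed

lemma root_unity_Parseval_le:
  fixes F :: "nat \<Rightarrow> complex"
  assumes K: "0 < K" and S: "S \<subseteq> {a..<a + K}" and F: "\<And>u. cmod (F u) \<le> 1"
  shows "(\<Sum>w<K. (cmod (\<Sum>u\<in>S. F u * root_unity K w ^ u))\<^sup>2) \<le> real K * real (card S)"
proof -
  have fin: "finite S" using S finite_subset by blast
  have "(\<Sum>w<K. (cmod (\<Sum>u\<in>S. F u * root_unity K w ^ u))\<^sup>2) = K * (\<Sum>u\<in>S. (cmod (F u))\<^sup>2)"
    by (rule root_unity_Parseval[OF K fin inj_on_subset[OF inj_on_mod_window S]])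
  also have "(\<Sum>u\<in>S. (cmod (F u))\<^sup>2) \<le> (\<Sum>u\<in>S. 1)"
    by (intro sum_mono) (simp add: F power_le_one)
  finally show ?thesis by (simp add: mult_left_mono)
qed

lemma sum_L2_norm_prod_le:
  assumes "(\<Sum>w<K. L2_nsq M (u w)) \<le> A" "(\<Sum>w<K. L2_nsq M (v w)) \<le> B"
  shows "(\<Sum>w<K. L2_norm M (u w) * L2_norm M (v w)) \<le> sqrt (A * B)"
proof (rule real_le_rsqrt)
  have "(\<Sum>w<K. L2_norm M (u w) * L2_norm M (v w))\<^sup>2 \<le>
      (\<Sum>w<K. (L2_norm M (u w))\<^sup>2) * (\<Sum>w<K. (L2_norm M (v w))\<^sup>2)"
    by (rule Cauchy_Schwarz_ineq_sum)
  also have "\<dots> \<le> A * B" unfolding L2_norm_sq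
    by (intro mult_mono assms sum_nonneg L2_nsq_nonneg order_trans[OF sum_nonneg assms(1)])
  finally show "(\<Sum>w<K. L2_norm M (u w) * L2_norm M (v w))\<^sup>2 \<le> A * B" .
qed

lemma sum_unif_nsq_le:
  assumes "\<And>s. s < n \<Longrightarrow> (\<Sum>w<K. (cmod (u w s))\<^sup>2) \<le> B" and "0 < n"
  shows "(\<Sum>w<K. L2_nsq (unif n) (u w)) \<le> B"
proof -
  have "(\<Sum>w<K. L2_nsq (unif n) (u w)) = (\<Sum>s<n. \<Sum>w<K. (cmod (u w s))\<^sup>2) / n"
    unfolding unif_nsq sum_divide_distrib[symmetric] by (subst sum.swap) (rule refl)
  also have "\<dots> \<le> (\<Sum>s<n. B) / n"
    by (intro divide_right_mono sum_mono assms(1)) auto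
  finally show ?thesis using \<open>0 < n\<close> by simp
qed

lemma unif_div_mod:
  fixes f :: "nat \<Rightarrow> 'b::comm_monoid_add"
  assumes "0 < h"
  shows "(\<Sum>s<q * h. f s) = (\<Sum>y<q. \<Sum>t<h. f (y * h + t))"
  using sum.nat_group[of f h q] sum.atLeastLessThan_shift_0[of f "_ * h" "_ * h + h"]
  by (simp add: atLeast0LessThan comp_def)

text \<open>The phase varies inside a block, but it is unimodular and common to both vectors, so it
  cancels in the norms and in the inner product; what remains is constant on blocks.\<close>

lemma unif_area_blocks:
  assumes h: "0 < h" and q: "0 < q" and z: "cmod z = 1"
  shows "L2_area (unif (q * h)) (\<lambda>s. cnj (z ^ (s mod h)) * u (s div h)) (\<lambda>s. cnj (z ^ (s mod h)) * v (s div h)) =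
    L2_area (unif q) u v"
proof -
  have zt: "cmod (z ^ t) = 1" for t using z by (simp add: norm_power)
  have n: "L2_nsq (unif (q * h)) (\<lambda>s. cnj (z ^ (s mod h)) * u (s div h)) = L2_nsq (unif q) u" for u
  proof -
    have "(\<Sum>s<q * h. (cmod (cnj (z ^ (s mod h)) * u (s div h)))\<^sup>2) = (\<Sum>y<q. \<Sum>t<h. (cmod (u y))\<^sup>2)"
      unfolding unif_div_mod[OF h] by (intro sum.cong refl) (simp add: norm_mult zt del: complex_cnj_power)
    then show ?thesis unfolding unif_nsq using h q by (simp add: sum_distrib_left[symmetric])
  qed
  have "L2_inner (unif (q * h)) (\<lambda>s. cnj (z ^ (s mod h)) * u (s div h)) (\<lambda>s. cnj (z ^ (s mod h)) * v (s div h)) =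
      L2_inner (unif q) u v"
  proof -
    have "(\<Sum>s<q * h. (cnj (z ^ (s mod h)) * u (s div h)) * cnj (cnj (z ^ (s mod h)) * v (s div h))) =
        (\<Sum>y<q. \<Sum>t<h. u y * cnj (v y))"
      unfolding unif_div_mod[OF h]
    proof (intro sum.cong refl)
      fix y t assume "t \<in> {..<h}"
      then have d: "(y * h + t) div h = y" "(y * h + t) mod h = t" by auto
      have "(cnj (z ^ t) * u y) * cnj (cnj (z ^ t) * v y) = (z ^ t * cnj (z ^ t)) * (u y * cnj (v y))"
        by (simp only: complex_cnj_mult complex_cnj_cnj mult_ac)
      then show "(cnj (z ^ ((y * h + t) mod h)) * u ((y * h + t) div h)) * cnj (cnj (z ^ ((y * h + t) mod h)) * v ((y * h + t) div h)) =
          u y * cnj (v y)" unfolding d unit_cnj[OF zt] by simp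
    qed
    then show ?thesis unfolding unif_inner using h q by (simp add: sum_distrib_left[symmetric])
  qed
  then show ?thesis unfolding L2_area_def n by simp
qed

text \<open>Dropping the two incomplete blocks of a window of \<open>L\<close> blocks costs \<open>2 / \<surd>L\<close>, by Parseval.\<close>

lemma mean_area_blocks:
  assumes b: "\<And>y. y < q \<Longrightarrow> b y < h" and q: "0 < q" and h: "0 < h" and L: "1 \<le> L" and K: "L * h \<le> K"
    and G1: "\<And>u. cmod (G1 u) \<le> 1" and G2: "\<And>u. cmod (G2 u) \<le> 1"
  shows "mean_area K (q * h) (L * h) (lift_word h b G1) (lift_word h b G2) \<le>
    (\<Sum>w<K. L2_area (unif q) (block_sum L q h b G1 (root_unity K w)) (block_sum L q h b G2 (root_unity K w))) / (real K * real (L * h)) + 2 / sqrt L"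
proof -
  let ?z = "root_unity K" and ?M = "unif (q * h)"
  have K0: "0 < K" using K h L by (metis gr0I less_le_trans mult_is_0 not_one_le_zero not_less_zero le_zero_eq)
  have qh: "0 < q * h" using q h by simp
  define U where "U G w = window (q * h) (lift_word h b G) (L * h) (?z w)" for G w
  define Y where "Y G w s = cnj (?z w ^ (s mod h)) * block_sum L q h b G (?z w) (s div h)" for G w s
  have UY: "U G w s - Y G w s = cnj (?z w ^ (s mod h)) * edge_sum L q h b G (?z w) (s div h) (s mod h)" for G w s
  proof -
    let ?t = "s mod h"
    have s: "s = s div h * h + ?t" by simp
    have "cnj (?z w ^ ?t) * (?z w ^ ?t * U G w s) =
        cnj (?z w ^ ?t) * (block_sum L q h b G (?z w) (s div h) + edge_sum L q h b G (?z w) (s div h) ?t)"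
      unfolding U_def using window_split[OF b q L mod_less_divisor[OF h, of s], where z = "?z w" and G = G and s = "s div h"] by simp
    moreover have "cnj (?z w ^ ?t) * (?z w ^ ?t * U G w s) = U G w s"
      using unit_cnj[of "?z w ^ ?t"] by (simp add: norm_power mult_ac)
    ultimately have "U G w s = cnj (?z w ^ ?t) * block_sum L q h b G (?z w) (s div h) +
        cnj (?z w ^ ?t) * edge_sum L q h b G (?z w) (s div h) ?t"
      by (simp only: distrib_left)
    then show ?thesis unfolding Y_def by (simp only: add_diff_cancel_left')
  qed
  have cm: "cmod (cnj (?z w ^ t) * x) = cmod x" for w t x by (simp add: norm_mult norm_power)
  have lw: "cmod (lift_word h b G u) \<le> 1" if "\<And>u. cmod (G u) \<le> 1" for G u using that by (simp add: lift_word_def)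
  have E_le: "(\<Sum>w<K. L2_nsq ?M (\<lambda>s. U G w s - Y G w s)) \<le> real K * real h" if G: "\<And>u. cmod (G u) \<le> 1" for G
  proof (rule sum_unif_nsq_le[OF _ qh])
    fix s
    let ?t = "s mod h"
    have t: "?t < h" using h by simp
    have hL: "h \<le> L * h" using mult_le_mono1[OF L, of h] by simp
    have "(\<Sum>w<K. (cmod (U G w s - Y G w s))\<^sup>2) = (\<Sum>w<K. (cmod (edge_sum L q h b G (?z w) (s div h) ?t))\<^sup>2)"
      unfolding UY cm ..
    also have "\<dots> \<le> real K * real (card ({?t..<h} \<union> {L * h..<L * h + ?t}))"
      unfolding edge_sum_def
    proof (intro root_unity_Parseval_le[of _ _ ?t] K0 lw G)
      show "{?t..<h} \<union> {L * h..<L * h + ?t} \<subseteq> {?t..<?t + K}"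
        using t hL K unfolding subset_iff Un_iff atLeastLessThan_iff by linarith
    qed
    also have "card ({?t..<h} \<union> {L * h..<L * h + ?t}) = h"
    proof (subst card_Un_disjoint)
      show "{?t..<h} \<inter> {L * h..<L * h + ?t} = {}"
        unfolding set_eq_iff Int_iff atLeastLessThan_iff empty_iff
        using hL by (intro allI iffI; elim conjE FalseE; linarith)
    qed (use t in auto)
    finally show "(\<Sum>w<K. (cmod (U G w s - Y G w s))\<^sup>2) \<le> real K * real h" .
  qed
  have U_le: "(\<Sum>w<K. L2_nsq ?M (U G w)) \<le> real K * real (L * h)" if G: "\<And>u. cmod (G u) \<le> 1" for G
  proof (rule sum_unif_nsq_le[OF _ qh])
    fix s
    have "(\<Sum>w<K. (cmod (U G w s))\<^sup>2) \<le> real K * real (card {..<L * h})"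
      unfolding U_def window_def using K by (intro root_unity_Parseval_le[of _ _ 0] K0 lw G) auto
    then show "(\<Sum>w<K. (cmod (U G w s))\<^sup>2) \<le> real K * real (L * h)" by simp
  qed
  have Y_le: "(\<Sum>w<K. L2_nsq ?M (Y G w)) \<le> real K * real (L * h)" if G: "\<And>u. cmod (G u) \<le> 1" for G
  proof (rule sum_unif_nsq_le[OF _ qh])
    fix s
    have bw: "block_sum L q h b G (?z w) (s div h) =
        (\<Sum>u\<in>{h..<L * h}. lift_word h b G ((s div h * h + u) mod (q * h)) * ?z w ^ u)" for w
      by (rule block_sum_word[OF _ q L]) (rule b)
    have "(\<Sum>w<K. (cmod (Y G w s))\<^sup>2) \<le> real K * real (card {h..<L * h})"
      unfolding Y_def cm bw using K
      by (intro root_unity_Parseval_le[of _ _ 0] K0 lw G) auto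
    also have "\<dots> \<le> real K * real (L * h)"
      by (intro mult_left_mono) (simp_all only: card_atLeastLessThan of_nat_le_iff diff_le_self of_nat_0_le_iff)
    finally show "(\<Sum>w<K. (cmod (Y G w s))\<^sup>2) \<le> real K * real (L * h)" .
  qed
  \<comment> \<open>In each of the two error terms an edge of energy \<open>K * h\<close> meets a
    window of energy \<open>K * (L * h)\<close>. The root of the product, divided by
    \<open>K * (L * h)\<close>, is \<open>1 / sqrt L\<close>.\<close>
  have "(\<Sum>w<K. L2_area ?M (U G1 w) (U G2 w)) \<le>
      (\<Sum>w<K. L2_area ?M (Y G1 w) (Y G2 w) + L2_norm ?M (\<lambda>s. U G1 w s - Y G1 w s) * L2_norm ?M (U G2 w) +
        L2_norm ?M (Y G1 w) * L2_norm ?M (\<lambda>s. U G2 w s - Y G2 w s))"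
    by (intro sum_mono L2_area_perturb unif_L2)
  also have "\<dots> \<le> (\<Sum>w<K. L2_area ?M (Y G1 w) (Y G2 w)) + sqrt ((real K * real h) * (real K * real (L * h))) +
      sqrt ((real K * real (L * h)) * (real K * real h))"
    unfolding sum.distrib using G1 G2
    by (intro add_mono order_refl sum_L2_norm_prod_le E_le U_le Y_le)
  also have "\<dots> = (\<Sum>w<K. L2_area ?M (Y G1 w) (Y G2 w)) + 2 * (real K * real h * sqrt L)"
  proof -
    have eq: "(real K * real h) * (real K * real (L * h)) = (real K * real h)\<^sup>2 * real L"
      by (simp add: power2_eq_square mult_ac)
    have "sqrt ((real K * real h) * (real K * real (L * h))) = real K * real h * sqrt L"
      unfolding eq real_sqrt_mult by simp
    then show ?thesis by (simp only: mult.commute[of "real K * real (L * h)"])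
  qed
  also have "(\<Sum>w<K. L2_area ?M (Y G1 w) (Y G2 w)) =
      (\<Sum>w<K. L2_area (unif q) (block_sum L q h b G1 (?z w)) (block_sum L q h b G2 (?z w)))"
    unfolding Y_def by (intro sum.cong refl unif_area_blocks h q norm_root_unity)
  finally have main: "(\<Sum>w<K. L2_area ?M (U G1 w) (U G2 w)) \<le>
      (\<Sum>w<K. L2_area (unif q) (block_sum L q h b G1 (?z w)) (block_sum L q h b G2 (?z w))) + 2 * (real K * real h * sqrt L)" .
  have "2 * (real K * real h * sqrt L) / (real K * real (L * h)) = 2 / sqrt L"
    using K0 h L by (simp add: field_simps real_sqrt_mult[symmetric])
  then show ?thesis using divide_right_mono[OF main, of "real K * real (L * h)"]
    unfolding mean_area_def U_def by (simp add: add_divide_distrib)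
qed

section \<open>Block coefficients and the constant 2/3\<close>

definition block_coeff :: "nat \<Rightarrow> nat \<Rightarrow> nat \<Rightarrow> complex \<Rightarrow> nat \<Rightarrow> nat \<Rightarrow> complex" where
  "block_coeff L q h z s y = (if 1 \<le> (y + q - s) mod q \<and> (y + q - s) mod q < L then z ^ (((y + q - s) mod q) * h) else 0)"

text \<open>\<open>(y + q - s) mod q\<close> is the position of block \<open>y\<close> in a window
  that starts at block \<open>s\<close> on a cycle of \<open>q\<close> blocks. The lemma passes from
  blocks to positions.\<close>

lemma sum_rotate:
  fixes F :: "nat \<Rightarrow> nat \<Rightarrow> 'b::comm_monoid_add"
  assumes s: "s < q"
  shows "(\<Sum>y<q. F ((y + q - s) mod q) y) = (\<Sum>e<q. F e ((s + e) mod q))"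
proof -
  have 1: "(s + (y + q - s) mod q) mod q = y" if "y < q" for y
    using that s by (cases "s \<le> y") (auto simp: mod_if)
  have 2: "((s + e) mod q + q - s) mod q = e" if "e < q" for e
    using that s by (cases "s + e < q") (auto simp: mod_if)
  show ?thesis
    by (rule sum.reindex_bij_witness[of _ "\<lambda>e. (s + e) mod q" "\<lambda>y. (y + q - s) mod q"])
       (use s 1 2 in auto)
qed

lemma block_sum_coeff:
  assumes s: "s < q" and L: "L \<le> q"
  shows "block_sum L q h b G z s = (\<Sum>y<q. block_coeff L q h z s y * window h G h z (h - b y))"
proof -
  have "(\<Sum>y<q. block_coeff L q h z s y * window h G h z (h - b y)) =
      (\<Sum>e<q. (if 1 \<le> e \<and> e < L then z ^ (e * h) else 0) * window h G h z (h - b ((s + e) mod q)))"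
    unfolding block_coeff_def by (rule sum_rotate[OF s])
  also have "\<dots> = block_sum L q h b G z s"
    unfolding block_sum_def using L by (intro sum.mono_neutral_cong_right) auto
  finally show ?thesis ..
qed

lemma block_coeff_nsq:
  assumes s: "s < q" and L: "1 \<le> L" "L \<le> q" and z: "cmod z = 1"
  shows "(\<Sum>y<q. (cmod (block_coeff L q h z s y))\<^sup>2) = real L - 1"
proof -
  have "(\<Sum>y<q. (cmod (block_coeff L q h z s y))\<^sup>2) =
      (\<Sum>e<q. (cmod (if 1 \<le> e \<and> e < L then z ^ (e * h) else 0))\<^sup>2)"
    unfolding block_coeff_def by (rule sum_rotate[OF s])
  also have "\<dots> = (\<Sum>e\<in>{1..<L}. 1)"
    using L z by (intro sum.mono_neutral_cong_right) (auto simp: norm_power)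
  finally show ?thesis using L by (simp add: of_nat_diff)
qed

text \<open>Two complete windows at cyclic distance \<open>d\<close> share two runs of blocks, of
  lengths close to \<open>d\<close> and \<open>q - d\<close>, each with a constant phase. Whatever
  the phases, the triangle inequality leaves the difference of the lengths, so the bound holds
  uniformly in \<open>z\<close>.\<close>

lemma block_coeff_inner:
  assumes s: "s < q" "s' < q" and z: "cmod z = 1"
  shows "\<bar>real q - 2 * real ((s' + q - s) mod q)\<bar> - (if s = s' then 1 else 0) \<le>
    cmod (\<Sum>y<q. block_coeff q q h z s y * cnj (block_coeff q q h z s' y))"
proof -
  define d where "d = (s' + q - s) mod q"
  have dq: "d < q" using s by (simp add: d_def)
  have d0: "d = 0 \<longleftrightarrow> s = s'"
    unfolding d_def using s by (cases "s \<le> s'") (auto simp: mod_if)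
  let ?f = "\<lambda>e. if 1 \<le> e \<and> e < q then z ^ (e * h) else 0"
  have e': "((s + e) mod q + q - s') mod q = (e + q - d) mod q" if "e < q" for e
    unfolding d_def using that s
    by (cases "s \<le> s'"; cases "s + e < q") (auto simp: mod_if)
  have "(\<Sum>y<q. block_coeff q q h z s y * cnj (block_coeff q q h z s' y)) =
      (\<Sum>e<q. ?f e * cnj (?f (((s + e) mod q + q - s') mod q)))"
    unfolding block_coeff_def by (rule sum_rotate[OF s(1)])
  also have "\<dots> = (\<Sum>e<q. ?f e * cnj (?f ((e + q - d) mod q)))"
    by (intro sum.cong refl) (simp only: e' lessThan_iff)
  also have "\<dots> = (\<Sum>e<q. (if 1 \<le> e \<and> e < d then cnj (z ^ ((q - d) * h)) else 0) +
      (if d < e then z ^ (d * h) else 0))"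
  proof (intro sum.cong refl)
    fix e assume "e \<in> {..<q}"
    then have e: "e < q" by simp
    have zc: "z ^ n * cnj (z ^ n) = 1" for n using z by (intro unit_cnj) (simp add: norm_power)
    \<comment> \<open>Position 0 has coefficient 0 in the first window, and \<open>e = d\<close> is
      position 0 of the second one. The other positions split at \<open>d\<close>: below it the
      second window has wrapped around.\<close>
    consider "e = 0" | "1 \<le> e" "e < d" | "e = d" "1 \<le> e" | "1 \<le> e" "d < e" by linarith
    then show "?f e * cnj (?f ((e + q - d) mod q)) =
      (if 1 \<le> e \<and> e < d then cnj (z ^ ((q - d) * h)) else 0) + (if d < e then z ^ (d * h) else 0)"
    proof cases
      case 2
      have lt: "e + (q - d) < q" using 2 dq by linarith
      have "e + q - d = e + (q - d)" using dq by linarith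
      then have m: "(e + q - d) mod q = e + (q - d)" using mod_less[OF lt] by simp
      have "z ^ (e * h) * cnj (z ^ ((e + (q - d)) * h)) = (z ^ (e * h) * cnj (z ^ (e * h))) * cnj (z ^ ((q - d) * h))"
        by (simp only: distrib_right power_add complex_cnj_mult mult.assoc)
      then have "z ^ (e * h) * cnj (z ^ ((e + (q - d)) * h)) = cnj (z ^ ((q - d) * h))"
        by (simp only: zc mult_1)
      moreover have "?f e = z ^ (e * h)" "?f (e + (q - d)) = z ^ ((e + (q - d)) * h)" using 2 e lt by auto
      ultimately show ?thesis unfolding m using 2 by simp
    next
      case 4
      have eq: "e + q - d = (e - d) + q" using 4 by linarith
      have m: "(e + q - d) mod q = e - d"
        unfolding eq mod_add_self2 using e by (intro mod_less) linarith
      have "e = (e - d) + d" using 4 by simp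
      then have "z ^ (e * h) = z ^ ((e - d) * h) * z ^ (d * h)"
        by (metis distrib_right power_add)
      then have "z ^ (e * h) * cnj (z ^ ((e - d) * h)) = (z ^ ((e - d) * h) * cnj (z ^ ((e - d) * h))) * z ^ (d * h)"
        by (simp only: mult_ac)
      then have "z ^ (e * h) * cnj (z ^ ((e - d) * h)) = z ^ (d * h)" by (simp only: zc mult_1)
      moreover have "?f e = z ^ (e * h)" "?f (e - d) = z ^ ((e - d) * h)" using 4 e by auto
      ultimately show ?thesis unfolding m using 4 by simp
    next
      case 1
      then show ?thesis by simp
    next
      case 3
      have "e + q - d = q" using 3 by simp
      then have m: "(e + q - d) mod q = 0" by simp
      show ?thesis unfolding m using 3 by simp
    qed
  qed
  also have "\<dots> = of_nat (d - 1) * cnj (z ^ ((q - d) * h)) + of_nat (q - 1 - d) * z ^ (d * h)"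
  proof -
    have "{..<q} \<inter> {e. 1 \<le> e \<and> e < d} = {1..<d}" "{..<q} \<inter> {e. d < e} = {d<..<q}" using dq by auto
    then show ?thesis by (simp add: sum.distrib sum.If_cases)
  qed
  finally have eq: "(\<Sum>y<q. block_coeff q q h z s y * cnj (block_coeff q q h z s' y)) =
      of_nat (d - 1) * cnj (z ^ ((q - d) * h)) + of_nat (q - 1 - d) * z ^ (d * h)" .
  have n1: "cmod (of_nat (d - 1) * cnj (z ^ ((q - d) * h))) = real (d - 1)"
    and n2: "cmod (of_nat (q - 1 - d) * z ^ (d * h)) = real (q - 1 - d)"
    using z by (simp_all add: norm_mult norm_power)
  have "\<bar>real (d - 1) - real (q - 1 - d)\<bar> \<le> cmod (\<Sum>y<q. block_coeff q q h z s y * cnj (block_coeff q q h z s' y))"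
    unfolding eq n1[symmetric] n2[symmetric]
    using norm_triangle_ineq3[of "of_nat (d - 1) * cnj (z ^ ((q - d) * h))" "- (of_nat (q - 1 - d) * z ^ (d * h))"]
    by (simp only: norm_minus_cancel diff_minus_eq_add)
  \<comment> \<open>For \<open>d > 0\<close> each run lacks one block and the differences agree. For
    \<open>d = 0\<close> the truncated \<open>d - 1\<close> is 0, only the other run lacks a block,
    and the correction 1 is needed.\<close>
  moreover have "\<bar>real q - 2 * real d\<bar> - (if s = s' then 1 else 0) \<le> \<bar>real (d - 1) - real (q - 1 - d)\<bar>"
    using dq d0 by (cases "d = 0") (auto simp: of_nat_diff)
  ultimately show ?thesis by (simp add: d_def)
qed


definition coeff_det :: "nat \<Rightarrow> nat \<Rightarrow> nat \<Rightarrow> complex \<Rightarrow> nat \<Rightarrow> nat \<Rightarrow> real" where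
  "coeff_det L q h z s s' =
     (\<Sum>y<q. (cmod (block_coeff L q h z s y))\<^sup>2) * (\<Sum>y<q. (cmod (block_coeff L q h z s' y))\<^sup>2) -
     (cmod (\<Sum>y<q. block_coeff L q h z s y * cnj (block_coeff L q h z s' y)))\<^sup>2"

lemma coeff_det_le:
  assumes s: "s < q" "s' < q" and L: "1 \<le> L" "L \<le> q" and z: "cmod z = 1"
  shows "coeff_det L q h z s s' \<le> (real L)\<^sup>2"
proof -
  have "coeff_det L q h z s s' \<le> (real L - 1) * (real L - 1)"
    unfolding coeff_det_def block_coeff_nsq[OF s(1) L z] block_coeff_nsq[OF s(2) L z] by simp
  also have "\<dots> \<le> real L * real L" using L by (intro mult_mono) auto
  finally show ?thesis by (simp add: power2_eq_square)
qed

lemma sum_sq_arith: "(\<Sum>e<n. (c - 2 * real e)\<^sup>2) = n * c\<^sup>2 - 2 * c * n * (real n - 1) + 2 * n * (real n - 1) * (2 * real n - 1) / 3"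
  by (induction n) (simp_all add: power2_eq_square field_simps)

text \<open>At offset \<open>d\<close> the determinant is at most
  \<open>q\<^sup>2 - (q - 2 * d)\<^sup>2\<close>, at every frequency. The second square has average
  \<open>(q\<^sup>2 + 2) / 3\<close> over \<open>d\<close>, which leaves at most two thirds of
  \<open>q\<^sup>2\<close>.\<close>

lemma sum_coeff_det_full:
  assumes q: "1 \<le> q" and z: "cmod z = 1"
  shows "(\<Sum>s<q. \<Sum>s'<q. coeff_det q q h z s s') \<le> 2 / 3 * (real q)\<^sup>2 * (real q)\<^sup>2"
proof -
  have F: "coeff_det q q h z s s' \<le> (real q)\<^sup>2 - (real q - 2 * real ((s' + q - s) mod q))\<^sup>2"
    if s: "s < q" "s' < q" for s s'
  proof -
    let ?d = "(s' + q - s) mod q" and ?i = "\<Sum>y<q. block_coeff q q h z s y * cnj (block_coeff q q h z s' y)"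
    have c: "coeff_det q q h z s s' = (real q - 1)\<^sup>2 - (cmod ?i)\<^sup>2"
      unfolding coeff_det_def block_coeff_nsq[OF s(1) q order_refl z] block_coeff_nsq[OF s(2) q order_refl z]
      by (simp add: power2_eq_square)
    show ?thesis
    proof (cases "s = s'")
      case True
      then have "real q - 1 \<le> cmod ?i" using block_coeff_inner[OF s z, of h] by simp
      then have "(real q - 1)\<^sup>2 \<le> (cmod ?i)\<^sup>2" using q by (intro power_mono) auto
      then show ?thesis unfolding c using True by simp
    next
      case False
      then have "\<bar>real q - 2 * real ?d\<bar> \<le> cmod ?i" using block_coeff_inner[OF s z, of h] by simp
      then have "\<bar>real q - 2 * real ?d\<bar>\<^sup>2 \<le> (cmod ?i)\<^sup>2" by (intro power_mono) auto
      moreover have "(real q - 1)\<^sup>2 \<le> (real q)\<^sup>2" using q by (intro power_mono) auto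
      ultimately show ?thesis unfolding c by simp
    qed
  qed
  have "(\<Sum>s<q. \<Sum>s'<q. coeff_det q q h z s s') \<le>
      (\<Sum>s<q. \<Sum>s'<q. (real q)\<^sup>2 - (real q - 2 * real ((s' + q - s) mod q))\<^sup>2)"
    by (intro sum_mono F) auto
  also have "\<dots> = (\<Sum>s<q. \<Sum>e<q. (real q)\<^sup>2 - (real q - 2 * real e)\<^sup>2)"
    by (rule sum.cong[OF refl], rule sum_rotate[where F = "\<lambda>e y. (real q)\<^sup>2 - (real q - 2 * real e)\<^sup>2"]) simp
  also have "\<dots> = real q * (real q ^ 3 - real q * ((real q)\<^sup>2 + 2) / 3)"
    unfolding sum_subtractf sum_sq_arith by (simp add: power2_eq_square power3_eq_cube field_simps)
  also have "\<dots> \<le> 2 / 3 * (real q)\<^sup>2 * (real q)\<^sup>2"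
    by (simp add: power2_eq_square power3_eq_cube field_simps)
  finally show ?thesis .
qed

section \<open>The expected area after one random lift\<close>

lemma window_mod: "window h G n z (s mod h) = window h G n z s"
  unfolding window_def by (simp add: mod_add_left_eq)

lemma bij_betw_reflect: "bij_betw (\<lambda>a. (h - a + t) mod h) {..<h} {..<h}" if "t < h" for h t :: nat
proof (rule bij_betw_byWitness[where f' = "\<lambda>u. (t + h - u) mod h"])
  show "\<forall>a\<in>{..<h}. (t + h - (h - a + t) mod h) mod h = a"
  proof
    fix a assume "a \<in> {..<h}"
    then show "(t + h - (h - a + t) mod h) mod h = a"
      using that by (cases "a \<le> t") (auto simp: mod_if)
  qed
  show "\<forall>u\<in>{..<h}. (h - (t + h - u) mod h + t) mod h = u"
  proof
    fix u assume "u \<in> {..<h}"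
    then show "(h - (t + h - u) mod h + t) mod h = u"
      using that by (cases "u \<le> t") (auto simp: mod_if)
  qed
qed (use that in auto)

text \<open>Under a uniform rotation every letter of a block is uniform, so a word with sum 0 has
  windows of mean 0 at every frequency. This is the reason for working with centered words.\<close>

lemma sum_window_zero:
  assumes "(\<Sum>u<h. G u) = 0" shows "(\<Sum>a<h. window h G h z (h - a)) = 0"
proof -
  have "(\<Sum>a<h. window h G h z (h - a)) = (\<Sum>t<h. (\<Sum>a<h. G ((h - a + t) mod h)) * z ^ t)"
    unfolding window_def by (subst sum.swap) (simp only: sum_distrib_right)
  also have "\<dots> = (\<Sum>t<h. (\<Sum>u<h. G u) * z ^ t)"
    by (intro sum.cong refl arg_cong2[where f = "(*)"] sum.reindex_bij_betw bij_betw_reflect) auto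
  finally show ?thesis by (simp add: assms)
qed

text \<open>By Lagrange's identity both areas are sums of squared minors, and
  \<open>rotations_wedge_moment\<close> computes the mean of each minor of the longer word. The
  second moment thus factors exactly into an arithmetic part and the area one level below.\<close>

lemma block_area_sq:
  assumes h: "0 < h" and L: "1 \<le> L" "L \<le> q" and G1: "(\<Sum>u<h. G1 u) = 0" and G2: "(\<Sum>u<h. G2 u) = 0"
  shows "(\<Sum>b\<in>rotations q h. (L2_area (unif q) (block_sum L q h b G1 z) (block_sum L q h b G2 z))\<^sup>2) =
    card (rotations q h) * ((\<Sum>s<q. \<Sum>s'<q. coeff_det L q h z s s') / (real q)\<^sup>2) *
    (L2_area (unif h) (window h G1 h z) (window h G2 h z))\<^sup>2"
proof -
  let ?P = "\<lambda>a. window h G1 h z (h - a)" and ?Q = "\<lambda>a. window h G2 h z (h - a)"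
  let ?A = "L2_area (unif h) (window h G1 h z) (window h G2 h z)" and ?N = "real (card (rotations q h))"
  have q: "0 < q" using L by simp
  have "L2_area (unif h) ?P ?Q = ?A"
    using unif_area_reindex[OF bij_betw_reflect[OF h], of "window h G1 h z" "window h G2 h z"] by (simp add: window_mod)
  then have D: "(\<Sum>a<h. \<Sum>a'<h. (cmod (?P a * ?Q a' - ?Q a * ?P a'))\<^sup>2) = 2 * (real h)\<^sup>2 * ?A\<^sup>2"
    using unif_area_sq[OF h, of ?P ?Q] h by (simp add: field_simps)
  have mom: "(\<Sum>b\<in>rotations q h. (cmod (block_sum L q h b G1 z s * block_sum L q h b G2 z s' -
      block_sum L q h b G2 z s * block_sum L q h b G1 z s'))\<^sup>2) = ?N * (2 * ?A\<^sup>2) * coeff_det L q h z s s'"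
    if s: "s < q" "s' < q" for s s'
  proof -
    have "(real h)\<^sup>2 * (\<Sum>b\<in>rotations q h. (cmod (block_sum L q h b G1 z s * block_sum L q h b G2 z s' -
      block_sum L q h b G2 z s * block_sum L q h b G1 z s'))\<^sup>2) = ?N * (2 * (real h)\<^sup>2 * ?A\<^sup>2) * coeff_det L q h z s s'"
      unfolding block_sum_coeff[OF s(1) L(2)] block_sum_coeff[OF s(2) L(2)] D[symmetric] coeff_det_def
      by (rule rotations_wedge_moment[OF h sum_window_zero[OF G1] sum_window_zero[OF G2]])
    then show ?thesis using h by (simp add: mult_ac)
  qed
  have "(\<Sum>b\<in>rotations q h. (L2_area (unif q) (block_sum L q h b G1 z) (block_sum L q h b G2 z))\<^sup>2) =
     (\<Sum>s<q. \<Sum>s'<q. \<Sum>b\<in>rotations q h. (cmod (block_sum L q h b G1 z s * block_sum L q h b G2 z s' -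
      block_sum L q h b G2 z s * block_sum L q h b G1 z s'))\<^sup>2) / (2 * (real q)\<^sup>2)"
    unfolding unif_area_sq[OF q] sum_divide_distrib[symmetric] sum.swap[of _ "rotations q h" "{..<q}"] ..
  also have "\<dots> = (\<Sum>s<q. \<Sum>s'<q. ?N * (2 * ?A\<^sup>2) * coeff_det L q h z s s') / (2 * (real q)\<^sup>2)"
    by (intro arg_cong2[where f = "(/)"] sum.cong refl mom) auto
  also have "\<dots> = (?N * (2 * ?A\<^sup>2) * (\<Sum>s<q. \<Sum>s'<q. coeff_det L q h z s s')) / (2 * (real q)\<^sup>2)"
    by (simp only: sum_distrib_left)
  finally show ?thesis by simp
qed

lemma block_area_mean:
  assumes h: "0 < h" and L: "1 \<le> L" "L \<le> q" and G1: "(\<Sum>u<h. G1 u) = 0" and G2: "(\<Sum>u<h. G2 u) = 0"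
    and c: "0 \<le> c" "(\<Sum>s<q. \<Sum>s'<q. coeff_det L q h z s s') \<le> c\<^sup>2 * (real q)\<^sup>2"
  shows "(\<Sum>b\<in>rotations q h. L2_area (unif q) (block_sum L q h b G1 z) (block_sum L q h b G2 z)) \<le>
    card (rotations q h) * (c * L2_area (unif h) (window h G1 h z) (window h G2 h z))"
proof (rule power2_le_imp_le)
  let ?A = "L2_area (unif h) (window h G1 h z) (window h G2 h z)" and ?N = "real (card (rotations q h))"
  let ?a = "\<lambda>b. L2_area (unif q) (block_sum L q h b G1 z) (block_sum L q h b G2 z)"
  have q: "0 < q" using L by simp
  have "(\<Sum>b\<in>rotations q h. 1 * ?a b)\<^sup>2 \<le> (\<Sum>b\<in>rotations q h. 1\<^sup>2) * (\<Sum>b\<in>rotations q h. (?a b)\<^sup>2)"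
    by (rule Cauchy_Schwarz_ineq_sum)
  also have "\<dots> = ?N * (?N * ((\<Sum>s<q. \<Sum>s'<q. coeff_det L q h z s s') / (real q)\<^sup>2) * ?A\<^sup>2)"
    unfolding block_area_sq[OF h L G1 G2] by simp
  also have "\<dots> \<le> ?N * (?N * c\<^sup>2 * ?A\<^sup>2)"
  proof (intro mult_left_mono mult_right_mono)
    show "(\<Sum>s<q. \<Sum>s'<q. coeff_det L q h z s s') / (real q)\<^sup>2 \<le> c\<^sup>2"
      using c(2) q by (simp add: divide_simps)
  qed auto
  also have "\<dots> = (?N * (c * ?A))\<^sup>2" by (simp add: power2_eq_square mult_ac)
  finally show "(\<Sum>b\<in>rotations q h. ?a b)\<^sup>2 \<le> (?N * (c * ?A))\<^sup>2" by simp
  show "0 \<le> ?N * (c * ?A)" using c(1) L2_area_nonneg[OF unif_L2 unif_L2] by simp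
qed

text \<open>\<open>c\<close> compares first moments of block sums with single blocks at each
  frequency, and the normalization of \<open>mean_area\<close> changes by \<open>L\<close>, whence
  \<open>c / L\<close>. Short windows use \<open>c = L\<close>, complete ones
  \<open>c = sqrt (2 / 3) * q\<close>.\<close>

lemma mean_area_average:
  assumes h: "0 < h" and L: "1 \<le> L" "L \<le> q" and K: "L * h \<le> K"
    and G1: "(\<Sum>u<h. G1 u) = 0" "\<And>u. cmod (G1 u) \<le> 1" and G2: "(\<Sum>u<h. G2 u) = 0" "\<And>u. cmod (G2 u) \<le> 1"
    and c: "0 \<le> c" "\<And>z. cmod z = 1 \<Longrightarrow> (\<Sum>s<q. \<Sum>s'<q. coeff_det L q h z s s') \<le> c\<^sup>2 * (real q)\<^sup>2"
  shows "(\<Sum>b\<in>rotations q h. mean_area K (q * h) (L * h) (lift_word h b G1) (lift_word h b G2)) \<le>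
    card (rotations q h) * (c / L * mean_area K h h G1 G2 + 2 / sqrt L)"
proof -
  let ?z = "root_unity K" and ?N = "real (card (rotations q h))" and ?R = "rotations q h"
  let ?B = "\<lambda>b w. L2_area (unif q) (block_sum L q h b G1 (?z w)) (block_sum L q h b G2 (?z w))"
  have q: "0 < q" using L by simp
  have "(\<Sum>b\<in>?R. mean_area K (q * h) (L * h) (lift_word h b G1) (lift_word h b G2)) \<le>
      (\<Sum>b\<in>?R. (\<Sum>w<K. ?B b w) / (real K * real (L * h)) + 2 / sqrt L)"
    by (rule sum_mono, rule mean_area_blocks[OF _ q h L(1) K G1(2) G2(2)]) (rule rotations_less)
  also have "\<dots> = (\<Sum>b\<in>?R. \<Sum>w<K. ?B b w) / (real K * real (L * h)) + ?N * (2 / sqrt L)"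
    unfolding sum.distrib sum_divide_distrib[symmetric] sum_constant by simp
  also have "(\<Sum>b\<in>?R. \<Sum>w<K. ?B b w) = (\<Sum>w<K. \<Sum>b\<in>?R. ?B b w)"
    by (rule sum.swap)
  also have "(\<Sum>w<K. \<Sum>b\<in>?R. ?B b w) / (real K * real (L * h)) + ?N * (2 / sqrt L) \<le> (\<Sum>w<K. ?N * (c * L2_area (unif h) (window h G1 h (?z w)) (window h G2 h (?z w)))) /
      (real K * real (L * h)) + ?N * (2 / sqrt L)"
    by (intro add_right_mono divide_right_mono sum_mono block_area_mean[OF h L G1(1) G2(1) c] norm_root_unity) simp
  also have "\<dots> = ?N * (c / L * mean_area K h h G1 G2) + ?N * (2 / sqrt L)"
    unfolding mean_area_def sum_distrib_left[symmetric] by simp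
  finally show ?thesis by (simp only: distrib_left)
qed

lemma mean_area_average_window:
  assumes h: "0 < h" and L: "1 \<le> L" "L \<le> q" and K: "L * h \<le> K"
    and G1: "(\<Sum>u<h. G1 u) = 0" "\<And>u. cmod (G1 u) \<le> 1" and G2: "(\<Sum>u<h. G2 u) = 0" "\<And>u. cmod (G2 u) \<le> 1"
  shows "(\<Sum>b\<in>rotations q h. mean_area K (q * h) (L * h) (lift_word h b G1) (lift_word h b G2)) \<le>
    card (rotations q h) * (mean_area K h h G1 G2 + 2 / sqrt L)"
proof -
  have "(\<Sum>s<q. \<Sum>s'<q. coeff_det L q h z s s') \<le> (real L)\<^sup>2 * (real q)\<^sup>2" if "cmod z = 1" for z
  proof -
    have "(\<Sum>s<q. \<Sum>s'<q. coeff_det L q h z s s') \<le> (\<Sum>s<q. \<Sum>s'<q. (real L)\<^sup>2)"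
      by (intro sum_mono coeff_det_le L that) auto
    then show ?thesis by (simp add: power2_eq_square mult_ac)
  qed
  from mean_area_average[OF h L K G1 G2 _ this] show ?thesis using L by simp
qed

lemma mean_area_average_full:
  assumes h: "0 < h" and q: "1 \<le> q" and K: "q * h \<le> K"
    and G1: "(\<Sum>u<h. G1 u) = 0" "\<And>u. cmod (G1 u) \<le> 1" and G2: "(\<Sum>u<h. G2 u) = 0" "\<And>u. cmod (G2 u) \<le> 1"
  shows "(\<Sum>b\<in>rotations q h. mean_area K (q * h) (q * h) (lift_word h b G1) (lift_word h b G2)) \<le>
    card (rotations q h) * (sqrt (2 / 3) * mean_area K h h G1 G2 + 2 / sqrt q)"
proof -
  have "(\<Sum>s<q. \<Sum>s'<q. coeff_det q q h z s s') \<le> (sqrt (2 / 3) * real q)\<^sup>2 * (real q)\<^sup>2" if "cmod z = 1" for z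
    using sum_coeff_det_full[OF q that, of h] by (simp add: power_mult_distrib)
  from mean_area_average[OF h q order_refl K G1 G2 _ this] show ?thesis using q by simp
qed

section \<open>The iceberg transformation\<close>

context iceberg
begin

section \<open>Coordinates, measurability and invariance\<close>

lemma prob_\<mu>: "prob_space \<mu>"
  using is_iceberg_measure by (simp add: is_iceberg_measure_def)

lemma sets_\<mu>: "sets \<mu> = sets (restrict_space borel X)"
  using is_iceberg_measure by (simp add: is_iceberg_measure_def)

lemma space_\<mu>: "space \<mu> = X"
  using sets_eq_imp_space_eq[OF sets_\<mu>] by (simp add: space_restrict_space)

lemma X_less: "x \<in> X \<Longrightarrow> x n < h n"
  by (auto simp: iceberg_space_def)

lemma X_proj: "x \<in> X \<Longrightarrow> \<phi> n (x (Suc n)) = x n"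
  by (auto simp: iceberg_space_def)

lemma coord_meas: "(\<lambda>x. x n) \<in> measurable \<mu> (count_space UNIV)"
proof (rule measurableI)
  fix A :: "nat set"
  have "(\<lambda>x. x n) -` A \<inter> space \<mu> = (\<Union>t\<in>A. {x\<in>X. x n = t})" by (auto simp: space_\<mu>)
  also have "\<dots> \<in> sets \<mu>" unfolding sets_\<mu>
    by (rule sets.countable_UN') (simp_all add: cylinder_sets image_subset_iff)
  finally show "(\<lambda>x. x n) -` A \<inter> space \<mu> \<in> sets \<mu>" .
qed simp

lemma coord_set: "{x\<in>X. P (x n)} \<in> sets \<mu>"
  using measurable_sets[OF coord_meas, of "{t. P t}" n] by (simp add: space_\<mu> vimage_def Int_def conj_commute)

lemma eventually_coord_set:
  fixes k :: "nat \<Rightarrow> nat"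
  shows "{x\<in>X. \<exists>N. \<forall>d\<ge>N. P d (x (k d))} \<in> sets \<mu>"
proof -
  have c: "{x\<in>X. N \<le> d \<longrightarrow> P d (x (k d))} \<in> sets \<mu>" for N d
    by (rule coord_set)
  have "{x\<in>X. \<exists>N. \<forall>d\<ge>N. P d (x (k d))} = (\<Union>N. \<Inter>d. {x\<in>X. N \<le> d \<longrightarrow> P d (x (k d))})" by auto
  also have "\<dots> \<in> sets \<mu>"
    by (rule sets.countable_UN, rule image_subsetI, rule sets.countable_INT) (simp_all add: c image_subset_iff)
  finally show ?thesis .
qed

lemma coord_fun_meas: "(\<lambda>x. f (x n)) \<in> measurable \<mu> N" if "\<And>t. f t \<in> space N"
  by (rule measurable_compose[OF coord_meas]) (simp add: that)

lemma coord_meas_unif: "(\<lambda>x. x n) \<in> measurable \<mu> (unif (h n))"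
proof (rule measurableI)
  show "(\<lambda>x. x n) -` A \<inter> space \<mu> \<in> sets \<mu>" for A
    using measurable_sets[OF coord_meas, of A n] by simp
qed (simp add: space_\<mu> X_less space_uniform_count_measure)

lemma coord_distr: "distr \<mu> (unif (h n)) (\<lambda>x. x n) = unif (h n)"
proof (rule measure_eqI_finite[of _ "{..<h n}"])
  interpret prob_space \<mu> by (rule prob_\<mu>)
  fix t assume t: "t \<in> {..<h n}"
  have "emeasure (distr \<mu> (unif (h n)) (\<lambda>x. x n)) {t} = emeasure \<mu> {x\<in>X. x n = t}"
    using t by (subst emeasure_distr[OF coord_meas_unif])
      (auto simp: sets_uniform_count_measure space_\<mu> intro!: arg_cong[where f = "emeasure \<mu>"])
  also have "\<dots> = ennreal (1 / real (h n))"
    using is_iceberg_measure t by (simp add: is_iceberg_measure_def emeasure_eq_measure)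
  also have "\<dots> = emeasure (unif (h n)) {t}"
    using t by (subst emeasure_uniform_count_measure) auto
  finally show "emeasure (distr \<mu> (unif (h n)) (\<lambda>x. x n)) {t} = emeasure (unif (h n)) {t}" .
qed (simp_all add: sets_uniform_count_measure)

lemma measure_coord: "measure \<mu> {x\<in>X. P (x n)} = card {u\<in>{..<h n}. P u} / h n"
proof -
  have "measure \<mu> {x\<in>X. P (x n)} = measure (distr \<mu> (unif (h n)) (\<lambda>x. x n)) {u\<in>{..<h n}. P u}"
    by (subst measure_distr[OF coord_meas_unif])
      (auto simp: sets_uniform_count_measure space_\<mu> X_less intro!: arg_cong[where f = "measure \<mu>"])
  then show ?thesis unfolding coord_distr by (subst (asm) measure_uniform_count_measure) auto
qed

lemma coord_nsq: "L2_nsq \<mu> (\<lambda>x. f (x n)) = L2_nsq (unif (h n)) f"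
proof -
  have "L2_nsq (distr \<mu> (unif (h n)) (\<lambda>x. x n)) f = L2_nsq \<mu> (\<lambda>x. f (x n))"
    unfolding L2_nsq_def by (rule integral_distr[OF coord_meas_unif])
      (simp add: measurable_def sets_uniform_count_measure space_uniform_count_measure)
  then show ?thesis by (simp only: coord_distr)
qed

lemma coord_inner: "L2_inner \<mu> (\<lambda>x. f (x n)) (\<lambda>x. g (x n)) = L2_inner (unif (h n)) f g"
proof -
  have "L2_inner (distr \<mu> (unif (h n)) (\<lambda>x. x n)) f g = L2_inner \<mu> (\<lambda>x. f (x n)) (\<lambda>x. g (x n))"
    unfolding L2_inner_def by (rule integral_distr[OF coord_meas_unif])
      (simp add: measurable_def sets_uniform_count_measure space_uniform_count_measure)
  then show ?thesis by (simp only: coord_distr)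
qed

lemma coord_area: "L2_area \<mu> (\<lambda>x. f (x n)) (\<lambda>x. g (x n)) = L2_area (unif (h n)) f g"
  by (simp only: L2_area_def coord_nsq coord_inner)

lemma coord_L2: "(\<lambda>x. f (x n)) \<in> L2_funs \<mu>"
proof -
  interpret prob_space \<mu> by (rule prob_\<mu>)
  show ?thesis
  proof (rule L2_bounded[OF finite_measure_axioms])
    show "(\<lambda>x. f (x n)) \<in> borel_measurable \<mu>" by (rule coord_fun_meas) simp
    show "cmod (f (x n)) \<le> (\<Sum>t<h n. cmod (f t))" if "x \<in> space \<mu>" for x
      using that X_less[of x n] by (intro member_le_sum) (auto simp: space_\<mu>)
  qed
qed

primrec descend :: "nat \<Rightarrow> nat \<Rightarrow> nat \<Rightarrow> nat" where
  "descend n 0 u = u"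
| "descend n (Suc d) u = descend n d (\<phi> (n + d) u)"

lemma descend_X: "x \<in> X \<Longrightarrow> descend n d (x (n + d)) = x n"
proof (induction d)
  case (Suc d)
  then show ?case using X_proj[of x "n + d"] by simp
qed simp

text \<open>Both coordinates are uniform under \<open>\<mu>\<close>, so fibres of the composed
  projections are counted by comparing the measures of one event.\<close>

lemma card_descend:
  assumes "t < h n"
  shows "card {u\<in>{..<h (n + d)}. descend n d u = t} / h (n + d) = 1 / h n"
proof -
  have "{x\<in>X. descend n d (x (n + d)) = t} = {x\<in>X. x n = t}" using descend_X by auto
  then show ?thesis using measure_coord[of "\<lambda>u. descend n d u = t" "n + d"] is_iceberg_measure assms
    by (simp add: is_iceberg_measure_def)
qed

text \<open>Both \<open>T\<close> and its inverse act on all sufficiently high coordinates by a permutation.\<close>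

lemma eventual_shift:
  assumes A: "A \<in> sets \<mu>" "AE x in \<mu>. x \<in> A"
    and f: "\<And>x. x \<in> A \<Longrightarrow> f x \<in> X" "\<And>x. x \<in> A \<Longrightarrow> \<forall>\<^sub>F m in sequentially. f x m = g m (x m)"
      "\<And>x. x \<notin> A \<Longrightarrow> f x = x"
    and g: "\<And>m. bij_betw (g m) {..<h m} {..<h m}"
  shows "f \<in> measurable \<mu> \<mu>" "distr \<mu> \<mu> f = \<mu>"
proof -
  interpret prob_space \<mu> by (rule prob_\<mu>)
  let ?P = "\<lambda>n t d x. descend n d (g (n + d) (x (n + d))) = t"
  have AX: "A \<subseteq> X" using sets.sets_into_space[OF A(1)] by (simp add: space_\<mu>)
  \<comment> \<open>High coordinates of \<open>f x\<close> are explicit and determine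
    \<open>f x n\<close> by descent. Preimages of cylinders thereby become countable combinations of
    coordinate sets.\<close>
  have ev: "\<forall>\<^sub>F d in sequentially. ?P n t d x \<longleftrightarrow> f x n = t" if x: "x \<in> A" for x n t
  proof -
    have "\<forall>\<^sub>F d in sequentially. f x (d + n) = g (d + n) (x (d + n))"
      using f(2)[OF x] eventually_sequentially_seg[of "\<lambda>m. f x m = g m (x m)" n] by blast
    then show ?thesis
    proof eventually_elim
      case (elim d)
      have "f x n = descend n d (f x (n + d))" by (rule descend_X[symmetric]) (rule f(1)[OF x])
      then show ?case using elim by (simp add: add.commute)
    qed
  qed
  have fX: "f x \<in> X" if "x \<in> X" for x using that f(1,3) by (cases "x \<in> A") auto
  have pre: "f -` {x\<in>X. x n = t} \<inter> space \<mu> \<in> sets \<mu>" for n t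
  proof -
    have "f -` {x\<in>X. x n = t} \<inter> space \<mu> =
        (A \<inter> {x\<in>X. \<exists>N. \<forall>d\<ge>N. ?P n t d x}) \<union> ({x\<in>X. x n = t} - A)" (is "?L = ?R")
    proof (intro set_eqI)
      fix x
      show "x \<in> ?L \<longleftrightarrow> x \<in> ?R"
      proof (cases "x \<in> A")
        case True
        then have X: "x \<in> X" using AX by auto
        have "f x n = t \<longleftrightarrow> (\<forall>\<^sub>F d in sequentially. ?P n t d x)"
        proof
          assume "f x n = t"
          then show "\<forall>\<^sub>F d in sequentially. ?P n t d x" using ev[OF True, of n t] by simp
        next
          assume "\<forall>\<^sub>F d in sequentially. ?P n t d x"
          then have "\<forall>\<^sub>F d in sequentially. f x n = t" using ev[OF True, of n t] by eventually_elim simp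
          then show "f x n = t" by simp
        qed
        then show ?thesis using True X f(1)[OF True] by (auto simp: space_\<mu> eventually_sequentially)
      next
        case False
        then show ?thesis using f(3)[OF False] by (auto simp: space_\<mu>)
      qed
    qed
    also have "\<dots> \<in> sets \<mu>"
      by (intro sets.Un sets.Int A(1) sets.Diff coord_set[of "\<lambda>u. u = t"]
          eventually_coord_set[of "\<lambda>d u. descend n d (g (n + d) u) = t"])
    finally show ?thesis .
  qed
  show fm: "f \<in> measurable \<mu> \<mu>"
  proof (rule measurable_sigma_sets[of \<mu> X "insert {} {{x\<in>X. x n = t} |n t. t < h n}"])
    show "sets \<mu> = sigma_sets X (insert {} {{x\<in>X. x n = t} |n t. t < h n})"
      by (simp only: sets_\<mu> sets_restrict_eq)
    show "f \<in> space \<mu> \<rightarrow> X" using fX by (auto simp: space_\<mu>)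
    show "f -` y \<inter> space \<mu> \<in> sets \<mu>" if "y \<in> insert {} {{x\<in>X. x n = t} |n t. t < h n}" for y
      using that pre by auto
  qed auto
  \<comment> \<open>Invariance follows from uniqueness of the measure once the image measure has the
    right mass on cylinders. These masses are limits of the masses of \<open>?E d\<close>, which
    equal \<open>1 / h n\<close> because \<open>g\<close> permutes a finite set.\<close>
  have "is_iceberg_measure q \<alpha> (distr \<mu> \<mu> f)"
    unfolding is_iceberg_measure_def
  proof (intro conjI allI impI)
    show "prob_space (distr \<mu> \<mu> f)" by (rule prob_space_distr[OF fm])
    show "sets (distr \<mu> \<mu> f) = sets (restrict_space borel X)" by (simp add: sets_\<mu>)
    fix n t assume t: "t < h n"
    let ?E = "\<lambda>d. {x\<in>X. ?P n t d x}"
    have mE: "measure \<mu> (?E d) = 1 / h n" for d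
    proof -
      let ?g = "g (n + d)" and ?m = "n + d"
      have "bij_betw ?g {u\<in>{..<h ?m}. descend n d (?g u) = t} {u\<in>{..<h ?m}. descend n d u = t}"
        using g[of ?m] unfolding bij_betw_def by (auto simp: inj_on_def image_iff)
      then have "card {u\<in>{..<h ?m}. descend n d (?g u) = t} = card {u\<in>{..<h ?m}. descend n d u = t}"
        by (rule bij_betw_same_card)
      then show ?thesis using measure_coord[of "\<lambda>u. descend n d (?g u) = t" ?m] card_descend[OF t, of d] by simp
    qed
    let ?F = "f -` {x\<in>X. x n = t} \<inter> space \<mu>"
    have "(\<lambda>d. \<integral>x. indicator (?E d) x \<partial>\<mu>) \<longlonglongrightarrow> (\<integral>x. indicator ?F x \<partial>\<mu> :: real)"
    proof (rule integral_dominated_convergence[where w = "\<lambda>_. 1"])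
      show "AE x in \<mu>. (\<lambda>d. indicator (?E d) x) \<longlonglongrightarrow> (indicator ?F x :: real)"
        using A(2)
      proof eventually_elim
        case (elim x)
        then have "x \<in> X" using AX by auto
        have "\<forall>\<^sub>F d in sequentially. indicator (?E d) x = (indicator ?F x :: real)"
          using ev[OF elim, of n t]
          by eventually_elim (use \<open>x \<in> X\<close> fX in \<open>auto simp: indicator_def space_\<mu>\<close>)
        then show ?case by (rule tendsto_eventually)
      qed
      show "indicator ?F \<in> borel_measurable \<mu>" using pre by simp
      show "indicator (?E d) \<in> borel_measurable \<mu>" for d
        using coord_set[of "\<lambda>u. descend n d (g (n + d) u) = t" "n + d"] by simp
    qed (auto simp: indicator_def)
    then have "(\<lambda>d. measure \<mu> (?E d)) \<longlonglongrightarrow> measure \<mu> ?F"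
      using pre coord_set[of "\<lambda>u. descend n _ (g (n + _) u) = t" "n + _"] by simp
    then have "measure \<mu> ?F = 1 / h n" unfolding mE by (simp add: LIMSEQ_const_iff)
    then show "measure (distr \<mu> \<mu> f) {x\<in>X. x n = t} = 1 / real (h n)"
      using coord_set[of "\<lambda>u. u = t" n] by (simp add: measure_distr[OF fm])
  qed
  then show "distr \<mu> \<mu> f = \<mu>" by (rule iceberg_measure_unique[OF _ is_iceberg_measure])
qed

definition step_ok :: "nat \<Rightarrow> nat \<Rightarrow> bool" where
  "step_ok n u \<longleftrightarrow> \<phi> n ((u + 1) mod h (Suc n)) = (\<phi> n u + 1) mod h n"

definition back_ok :: "nat \<Rightarrow> nat \<Rightarrow> bool" where
  "back_ok n u \<longleftrightarrow> \<phi> n ((u + (h (Suc n) - 1)) mod h (Suc n)) = (\<phi> n u + (h n - 1)) mod h n"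

lemma regular_from_iff:
  "x \<in> X \<Longrightarrow> iceberg_regular_from q \<alpha> n0 x \<longleftrightarrow> (\<forall>n\<ge>n0. step_ok n (x (Suc n)))"
  by (simp add: iceberg_regular_from_def step_ok_def X_proj)

lemma R_sets: "R \<in> sets \<mu>"
proof -
  have "R = {x\<in>X. \<exists>n0. \<forall>n\<ge>n0. step_ok n (x (Suc n))}"
    unfolding iceberg_regular_def using regular_from_iff by auto
  then show ?thesis by (simp only: eventually_coord_set[of step_ok Suc])
qed

lemma shift_back: "u < h n \<Longrightarrow> ((u + 1) mod h n + (h n - 1)) mod h n = u"
  "u < h n \<Longrightarrow> ((u + (h n - 1)) mod h n + 1) mod h n = u"
proof -
  assume u: "u < h n"
  have e: "u + 1 + (h n - 1) = u + h n" "u + (h n - 1) + 1 = u + h n" using h_pos[of n] by linarith+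
  show "((u + 1) mod h n + (h n - 1)) mod h n = u" "((u + (h n - 1)) mod h n + 1) mod h n = u"
    unfolding mod_add_left_eq e mod_add_self2 using u by (simp_all only: mod_less)
qed

text \<open>A description of the image by coordinates, needed for its measurability:
  \<open>back_ok\<close> says that subtraction of 1, written as addition of \<open>h n - 1\<close>,
  commutes with the projection.\<close>

lemma TR_iff: "z \<in> T ` R \<longleftrightarrow> z \<in> X \<and> (\<exists>n0. \<forall>n\<ge>n0. back_ok n (z (Suc n)))"
proof
  assume "z \<in> T ` R"
  then obtain x where x: "x \<in> R" "z = T x" by blast
  then have X: "x \<in> X" by (simp add: iceberg_regular_def)
  obtain N where N: "\<And>n. n \<ge> N \<Longrightarrow> z n = (x n + 1) mod h n"
    using T_char(2)[OF x(1)] x(2) by (auto simp: eventually_sequentially)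
  have b: "(z n + (h n - 1)) mod h n = x n" if "n \<ge> N" for n
    using N[OF that] shift_back(1)[OF X_less[OF X]] by simp
  have zX: "z \<in> X" using T_char(1)[OF x(1)] x(2) by simp
  have "back_ok n (z (Suc n))" if "n \<ge> N" for n
    unfolding back_ok_def X_proj[OF zX] using b[of n] b[of "Suc n"] that X_proj[OF X]
    by (simp del: iceberg_height.simps)
  then show "z \<in> X \<and> (\<exists>n0. \<forall>n\<ge>n0. back_ok n (z (Suc n)))" using zX by blast
next
  assume "z \<in> X \<and> (\<exists>n0. \<forall>n\<ge>n0. back_ok n (z (Suc n)))"
  then obtain N where zX: "z \<in> X" and N: "\<And>n. n \<ge> N \<Longrightarrow> back_ok n (z (Suc n))" by blast
  define w where "w n = (z n + (h n - 1)) mod h n" for n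
  have "\<phi> n (w (Suc n)) = w n" if "n \<ge> N" for n
    using N[OF that] unfolding back_ok_def w_def X_proj[OF zX] .
  then obtain x where x: "x \<in> X" "\<And>n. n \<ge> N \<Longrightarrow> x n = w n"
    using X_extend[of N w] h_pos by (auto simp: w_def)
  have s: "(x n + 1) mod h n = z n" if "n \<ge> N" for n
    unfolding x(2)[OF that] w_def by (rule shift_back(2)[OF X_less[OF zX]])
  have "iceberg_regular_from q \<alpha> N x"
    unfolding iceberg_regular_from_def using s X_proj[OF zX] by (simp del: iceberg_height.simps)
  then have xR: "x \<in> R" and "\<And>n. n \<ge> N \<Longrightarrow> T x n = z n"
    using x T_char(3)[of x N] s by (auto simp: iceberg_regular_def)
  then have "T x = z" using X_eqI[of "T x" z N] T_char(1)[OF xR] zX by blast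
  then show "z \<in> T ` R" using xR by blast
qed

lemma TR_sets: "T ` R \<in> sets \<mu>"
proof -
  have "T ` R = {x\<in>X. \<exists>n0. \<forall>n\<ge>n0. back_ok n (x (Suc n))}" using TR_iff by auto
  then show ?thesis by (simp only: eventually_coord_set[of back_ok Suc])
qed

lemma shift_bij: "bij_betw (\<lambda>u. (u + 1) mod h m) {..<h m} {..<h m}"
  "bij_betw (\<lambda>u. (u + (h m - 1)) mod h m) {..<h m} {..<h m}"
proof -
  have 1: "\<forall>u\<in>{..<h m}. ((u + 1) mod h m + (h m - 1)) mod h m = u"
    "\<forall>u\<in>{..<h m}. ((u + (h m - 1)) mod h m + 1) mod h m = u"
    by (intro ballI, simp only: lessThan_iff shift_back)+
  have 2: "(\<lambda>u. (u + 1) mod h m) ` {..<h m} \<subseteq> {..<h m}" "(\<lambda>u. (u + (h m - 1)) mod h m) ` {..<h m} \<subseteq> {..<h m}"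
    by (intro image_subsetI, simp only: lessThan_iff mod_less_divisor[OF h_pos])+
  show "bij_betw (\<lambda>u. (u + 1) mod h m) {..<h m} {..<h m}"
    by (rule bij_betw_byWitness[OF 1 2])
  show "bij_betw (\<lambda>u. (u + (h m - 1)) mod h m) {..<h m} {..<h m}"
    by (rule bij_betw_byWitness[OF 1(2,1) 2(2,1)])
qed

lemma koopman_iceberg: "koopman \<mu> T (iceberg_inv q \<alpha>)"
proof -
  let ?S = "iceberg_inv q \<alpha>"
  have TS: "T (?S z) = z" "?S z \<in> R" if "z \<in> T ` R" for z
    using that by (simp_all add: iceberg_inv_def f_inv_into_f inv_into_into)
  have "\<forall>\<^sub>F m in sequentially. ?S z m = (z m + (h m - 1)) mod h m" if z: "z \<in> T ` R" for z
    using T_char(2)[OF TS(2)[OF z]]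
  proof eventually_elim
    case (elim m)
    have "?S z \<in> X" using TS(2)[OF z] by (simp add: iceberg_regular_def)
    then show ?case using elim shift_back(1)[OF X_less] unfolding TS(1)[OF z] by metis
  qed
  note Sev = this
  have SX: "?S z \<in> X" if "z \<in> T ` R" for z using TS(2)[OF that] by (simp add: iceberg_regular_def)
  have Sid: "?S z = z" if "z \<notin> T ` R" for z using that by (simp add: iceberg_inv_def)
  have S: "?S \<in> measurable \<mu> \<mu>" by (rule eventual_shift(1)[OF TR_sets AE_image_regular SX Sev Sid shift_bij(2)])
  have S': "distr \<mu> \<mu> ?S = \<mu>" by (rule eventual_shift(2)[OF TR_sets AE_image_regular SX Sev Sid shift_bij(2)])
  have Tid: "T x = x" if "x \<notin> R" for x using that by (simp add: iceberg_map_def)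
  have T: "T \<in> measurable \<mu> \<mu>" by (rule eventual_shift(1)[OF R_sets AE_regular T_char(1,2) Tid shift_bij(1)])
  have T': "distr \<mu> \<mu> T = \<mu>" by (rule eventual_shift(2)[OF R_sets AE_regular T_char(1,2) Tid shift_bij(1)])
  interpret prob_space \<mu> by (rule prob_\<mu>)
  show ?thesis
  proof
    show "AE x in \<mu>. ?S (T x) = x" using AE_regular by eventually_elim (rule inv_T)
    show "AE x in \<mu>. T (?S x) = x" using AE_image_regular by eventually_elim (rule TS(1))
  qed (fact S S' T T')+
qed

end

section \<open>Removal of the mean\<close>

lemma unif_norm_le:
  assumes "0 < n" "\<And>s. cmod (f s) \<le> B" shows "L2_norm (unif n) f \<le> B"
proof -
  have B: "0 \<le> B" using assms(2)[of 0] norm_ge_zero order_trans by blast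
  have "L2_nsq (unif n) f \<le> (\<Sum>s<n. B\<^sup>2) / n"
    unfolding unif_nsq by (intro divide_right_mono sum_mono power_mono assms(2)) auto
  then have "L2_nsq (unif n) f \<le> B\<^sup>2" using assms(1) by simp
  then show ?thesis unfolding L2_norm_def by (rule real_le_lsqrt[OF B])
qed

lemma bij_betw_rotate:
  assumes h: "0 < h" shows "bij_betw (\<lambda>t. (t + a) mod h) {..<h} {..<h::nat}"
proof -
  let ?r = "h - a mod h"
  have e: "a + ?r = (a div h + 1) * h"
    using div_mult_mod_eq[of a h] mod_less_divisor[OF h, of a] unfolding distrib_right by linarith
  then have e': "?r + a = (a div h + 1) * h" by (simp only: add.commute)
  have 1: "\<forall>t\<in>{..<h}. ((t + a) mod h + ?r) mod h = t" "\<forall>t\<in>{..<h}. ((t + ?r) mod h + a) mod h = t"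
    unfolding mod_add_left_eq add.assoc e e' by (auto simp only: mod_mult_self1 mod_less lessThan_iff)
  have 2: "(\<lambda>t. (t + b) mod h) ` {..<h} \<subseteq> {..<h}" for b using h by auto
  show ?thesis by (rule bij_betw_byWitness[OF 1 2 2])
qed

lemma lift_word_bound: "(\<And>u. cmod (G u) \<le> B) \<Longrightarrow> cmod (lift_word h b G u) \<le> B"
  by (simp add: lift_word_def)

lemma lift_word_diff: "lift_word h b (\<lambda>u. G u - c) = (\<lambda>u. lift_word h b G u - c)"
  by (simp add: lift_word_def fun_eq_iff)

lemma sum_lift_word:
  assumes h: "0 < h" and b: "\<And>y. y < q \<Longrightarrow> b y < h" and G: "(\<Sum>u<h. G u) = 0"
  shows "(\<Sum>u<q * h. lift_word h b G u) = 0"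
proof -
  have "(\<Sum>u<q * h. lift_word h b G u) = (\<Sum>y<q. \<Sum>t<h. G ((t + (h - b y)) mod h))"
    unfolding unif_div_mod[OF h]
    by (intro sum.cong refl, subst lift_word_block) (use b in \<open>auto simp: add.commute\<close>)
  also have "\<dots> = (\<Sum>y<q. \<Sum>u<h. G u)"
  proof (rule sum.cong[OF refl])
    fix y
    show "(\<Sum>t<h. G ((t + (h - b y)) mod h)) = (\<Sum>u<h. G u)"
      by (rule sum.reindex_bij_betw[OF bij_betw_rotate[OF h]])
  qed
  finally show ?thesis by (simp add: G)
qed

lemma window_const_diff:
  "window h (\<lambda>u. G u - c) n z s = window h G n z s - c * (\<Sum>t<n. z ^ t)"
  by (simp add: window_def left_diff_distrib sum_subtractf sum_distrib_left)

text \<open>Subtracting the mean only affects the frequency \<open>z = 1\<close>, where complete blocks contribute constants.\<close>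

lemma mean_area_center:
  fixes K L h q :: nat
  assumes b: "\<And>y. y < q \<Longrightarrow> b y < h" and q: "0 < q" and h: "0 < h" and L: "1 \<le> L"
    and G1: "\<And>u. cmod (G1 u) \<le> 1" "\<And>u. cmod (G1 u - c1) \<le> 1" "cmod c1 \<le> 1" "(\<Sum>u<h. G1 u - c1) = 0"
    and G2: "\<And>u. cmod (G2 u) \<le> 1" "\<And>u. cmod (G2 u - c2) \<le> 1" "cmod c2 \<le> 1" "(\<Sum>u<h. G2 u - c2) = 0"
  defines "K \<equiv> L * h"
  shows "mean_area K (q * h) K (lift_word h b G1) (lift_word h b G2) \<le>
    mean_area K (q * h) K (lift_word h b (\<lambda>u. G1 u - c1)) (lift_word h b (\<lambda>u. G2 u - c2)) + 2 / L"
proof -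
  let ?M = "unif (q * h)" and ?z = "root_unity K"
  have K0: "0 < K" using h L by (simp add: K_def)
  have qh: "0 < q * h" using q h by simp
  define V where "V G w = window (q * h) (lift_word h b G) K (?z w)" for G w
  have V_center: "V (\<lambda>u. G u - c) w = V G w" if "0 < w" "w < K" for G c w
    unfolding V_def lift_word_diff using root_unity_sum[OF that]
    by (intro ext) (simp add: window_const_diff)
  have V_le: "cmod (V G w s) \<le> real K" if G: "\<And>u. cmod (G u) \<le> 1" for G w s
  proof -
    have "cmod (V G w s) \<le> (\<Sum>t<K. 1)"
      unfolding V_def window_def
      by (intro sum_norm_le) (simp add: norm_mult norm_power lift_word_bound[of G 1] G)
    then show ?thesis by simp
  qed
  have V0: "cmod (V G 0 s - of_nat K * c) \<le> real h"
    if G: "\<And>u. cmod (G u - c) \<le> 1" "(\<Sum>u<h. G u - c) = 0" for G c s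
  proof -
    let ?g = "\<lambda>u. G u - c"
    have blk: "window h ?g h 1 s = 0" for s
    proof -
      have "(\<Sum>t<h. ?g ((s + t) mod h)) = (\<Sum>u<h. ?g u)"
        using sum.reindex_bij_betw[OF bij_betw_rotate[OF h, of s], of ?g] by (simp add: add.commute)
      then show ?thesis by (simp add: window_def G(2))
    qed
    have "V G 0 s - of_nat K * c = window (q * h) (lift_word h b ?g) (L * h) 1 s"
      unfolding V_def lift_word_diff by (simp add: window_const_diff K_def mult.commute)
    also have "\<dots> = block_sum L q h b ?g 1 (s div h) + edge_sum L q h b ?g 1 (s div h) (s mod h)"
      using window_split[OF _ q L mod_less_divisor[OF h, of s], of b 1 ?g "s div h"] b by simp
    also have "block_sum L q h b ?g 1 (s div h) = 0" by (simp add: block_sum_def blk)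
    finally have "cmod (V G 0 s - of_nat K * c) = cmod (edge_sum L q h b ?g 1 (s div h) (s mod h))" by simp
    also have "\<dots> \<le> (\<Sum>u\<in>{s mod h..<h} \<union> {L * h..<L * h + s mod h}. 1)"
      unfolding edge_sum_def by (intro sum_norm_le) (simp add: lift_word_bound[of ?g 1] G(1))
    also have "\<dots> = real (card ({s mod h..<h} \<union> {L * h..<L * h + s mod h}))" by simp
    also have "card ({s mod h..<h} \<union> {L * h..<L * h + s mod h}) \<le> (h - s mod h) + s mod h"
      by (rule order_trans[OF card_Un_le]) simp
    also have "(h - s mod h) + s mod h = h" using mod_less_divisor[OF h, of s] by simp
    finally show ?thesis by simp
  qed
  \<comment> \<open>At frequency 0 the windows are within \<open>h\<close> of the constants
    \<open>K * c1\<close> and \<open>K * c2\<close>; constants are parallel, so they span no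
    area.\<close>
  have zero: "L2_area ?M (V G1 0) (V G2 0) \<le> 2 * (real h * real K)"
  proof -
    let ?k1 = "\<lambda>s::nat. of_nat K * c1" and ?k2 = "\<lambda>s::nat. of_nat K * c2"
    have "L2_area ?M ?k1 ?k2 = 0"
      using qh by (simp add: L2_area_def unif_nsq unif_inner norm_mult power_mult_distrib)
    moreover have "L2_norm ?M (\<lambda>s. V G1 0 s - ?k1 s) \<le> real h" "L2_norm ?M (\<lambda>s. V G2 0 s - ?k2 s) \<le> real h"
      using G1 G2 by (intro unif_norm_le[OF qh] V0, auto)+
    moreover have "L2_norm ?M (V G2 0) \<le> real K" using G2 by (intro unif_norm_le[OF qh] V_le)
    moreover have "L2_norm ?M ?k1 \<le> real K"
      using G1(3) by (intro unif_norm_le[OF qh]) (simp add: norm_mult mult_left_le)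
    moreover have "L2_area ?M (V G1 0) (V G2 0) \<le> L2_area ?M ?k1 ?k2 +
        L2_norm ?M (\<lambda>s. V G1 0 s - ?k1 s) * L2_norm ?M (V G2 0) + L2_norm ?M ?k1 * L2_norm ?M (\<lambda>s. V G2 0 s - ?k2 s)"
      by (intro L2_area_perturb unif_L2)
    moreover have "L2_norm ?M (\<lambda>s. V G1 0 s - ?k1 s) * L2_norm ?M (V G2 0) \<le> real h * real K"
      using calculation by (intro mult_mono) auto
    moreover have "L2_norm ?M ?k1 * L2_norm ?M (\<lambda>s. V G2 0 s - ?k2 s) \<le> real h * real K"
      unfolding mult.commute[of "real h"] using calculation by (intro mult_mono) auto
    ultimately show ?thesis by linarith
  qed
  let ?c1 = "\<lambda>u. G1 u - c1" and ?c2 = "\<lambda>u. G2 u - c2"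
  have "(\<Sum>w<K. L2_area ?M (V G1 w) (V G2 w)) \<le>
      (\<Sum>w<K. L2_area ?M (V ?c1 w) (V ?c2 w) + (if w = 0 then 2 * (real h * real K) else 0))"
  proof (rule sum_mono)
    fix w assume "w \<in> {..<K}"
    show "L2_area ?M (V G1 w) (V G2 w) \<le> L2_area ?M (V ?c1 w) (V ?c2 w) + (if w = 0 then 2 * (real h * real K) else 0)"
    proof (cases "w = 0")
      case True
      then show ?thesis using zero L2_area_nonneg[OF unif_L2 unif_L2, of "q * h" "V ?c1 0" "V ?c2 0"] by simp
    next
      case False
      then show ?thesis using V_center[of w] \<open>w \<in> {..<K}\<close> by simp
    qed
  qed
  also have "\<dots> = (\<Sum>w<K. L2_area ?M (V ?c1 w) (V ?c2 w)) + 2 * (real h * real K)"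
    using K0 by (simp add: sum.distrib)
  finally have main: "(\<Sum>w<K. L2_area ?M (V G1 w) (V G2 w)) \<le> (\<Sum>w<K. L2_area ?M (V ?c1 w) (V ?c2 w)) + 2 * (real h * real K)" .
  have "2 * (real h * real K) / (real K * real K) = 2 / L" using K0 h by (simp add: K_def)
  then show ?thesis using divide_right_mono[OF main, of "real K * real K"]
    unfolding mean_area_def V_def by (simp add: add_divide_distrib)
qed

text \<open>A function \<open>c\<close> of coordinate \<open>n\<close>, expressed through coordinate
  \<open>n + d\<close>; see \<open>word_descend\<close>. It is defined for arbitrary arrays of
  rotations, so that averages over finite families of them make sense.\<close>

primrec word :: "(nat \<Rightarrow> nat) \<Rightarrow> (nat \<Rightarrow> nat \<Rightarrow> nat) \<Rightarrow> nat \<Rightarrow> (nat \<Rightarrow> complex) \<Rightarrow> nat \<Rightarrow> nat \<Rightarrow> complex" where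
  "word q \<alpha> n c 0 = c"
| "word q \<alpha> n c (Suc d) = lift_word (iceberg_height q (n + d)) (\<alpha> (n + d)) (word q \<alpha> n c d)"

lemma word_bound: "(\<And>u. cmod (c u) \<le> B) \<Longrightarrow> cmod (word q \<alpha> n c d u) \<le> B"
  by (induction d arbitrary: u) (auto simp: lift_word_bound)

lemma word_diff: "word q \<alpha> n (\<lambda>u. c u - k) d = (\<lambda>u. word q \<alpha> n c d u - k)"
  by (induction d) (auto simp: lift_word_diff)

context iceberg
begin

sublocale K: koopman "iceberg_measure q \<alpha>" "iceberg_map q \<alpha>" "iceberg_inv q \<alpha>"
  by (rule koopman_iceberg)

lemma word_descend: "word q \<alpha> n c d u = c (descend n d u)"
proof (induction d arbitrary: u)
  case (Suc d)
  then show ?case by (simp add: lift_word_def iceberg_proj_def Let_def)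
qed simp

lemma sum_word: "(\<Sum>u<h n. c u) = 0 \<Longrightarrow> (\<Sum>u<h (n + d). word q \<alpha> n c d u) = 0"
proof (induction d)
  case (Suc d)
  then show ?case
    using sum_lift_word[OF h_pos[of "n + d"], of "q (n + d)" "\<alpha> (n + d)" "word q \<alpha> n c d"] \<alpha>_less by simp
qed simp

section \<open>Orbits that follow the cyclic shift\<close>

lemma step_ok_if:
  assumes "u < h (Suc n)" "u mod h n \<noteq> h n - 1"
  shows "step_ok n u"
proof -
  have s: "Suc (u mod h n) < h n" using assms(2) mod_less_divisor[OF h_pos, of u n] by linarith
  have "Suc u \<noteq> h (Suc n)"
  proof
    assume "Suc u = h (Suc n)"
    then have "Suc u mod h n = 0" by simp
    then show False using s by (simp add: mod_Suc)
  qed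
  then have "(u + 1) mod h (Suc n) = Suc u" using assms(1) by simp
  then show ?thesis unfolding step_ok_def using \<phi>_step[OF s] by (simp del: iceberg_height.simps)
qed

lemma measure_block_end: "measure \<mu> {x\<in>X. x (Suc n) mod h n = h n - 1} = 1 / h n"
proof -
  have "{u\<in>{..<h (Suc n)}. u mod h n = h n - 1} = (\<lambda>y. y * h n + (h n - 1)) ` {..<q n}"
  proof (intro set_eqI iffI)
    fix u assume u: "u \<in> {u\<in>{..<h (Suc n)}. u mod h n = h n - 1}"
    then have "u = u div h n * h n + (h n - 1)" using div_mult_mod_eq[of u "h n"] by simp
    moreover have "u div h n < q n" using u by (simp add: less_mult_imp_div_less)
    ultimately show "u \<in> (\<lambda>y. y * h n + (h n - 1)) ` {..<q n}" by blast
  next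
    fix u assume "u \<in> (\<lambda>y. y * h n + (h n - 1)) ` {..<q n}"
    then obtain y where y: "y < q n" "u = y * h n + (h n - 1)" by auto
    have "u < (y + 1) * h n" using y(2) h_pos[of n] by simp
    also have "\<dots> \<le> q n * h n" using y(1) by (intro mult_right_mono) auto
    finally have "u < h (Suc n)" by simp
    moreover have "u mod h n = h n - 1"
      unfolding y(2) mod_mult_self3 using h_pos[of n] by (intro mod_less) linarith
    ultimately show "u \<in> {u\<in>{..<h (Suc n)}. u mod h n = h n - 1}" by simp
  qed
  moreover have "inj_on (\<lambda>y. y * h n + (h n - 1)) {..<q n}"
  proof (rule inj_onI)
    fix y y' assume "y * h n + (h n - 1) = y' * h n + (h n - 1)"
    then have "y * h n = y' * h n" by (simp only: add_right_cancel)
    then show "y = y'" using h_pos[of n] by simp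
  qed
  ultimately have "card {u\<in>{..<h (Suc n)}. u mod h n = h n - 1} = q n" by (simp add: card_image)
  then show ?thesis using measure_coord[of "\<lambda>u. u mod h n = h n - 1" "Suc n"] q_ge_2[of n] by simp
qed

definition Reg :: "nat \<Rightarrow> (nat \<Rightarrow> nat) set" where
  "Reg m = {x\<in>X. \<forall>n\<ge>m. step_ok n (x (Suc n))}"

lemma Reg_sets: "Reg m \<in> sets \<mu>"
proof -
  have c: "{x\<in>X. m \<le> d \<longrightarrow> step_ok d (x (Suc d))} \<in> sets \<mu>" for d
    by (rule coord_set)
  have "Reg m = (\<Inter>d. {x\<in>X. m \<le> d \<longrightarrow> step_ok d (x (Suc d))})" by (auto simp: Reg_def)
  also have "\<dots> \<in> sets \<mu>" by (rule sets.countable_INT) (simp_all add: c image_subset_iff)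
  finally show ?thesis .
qed

lemma h_growth: "2 ^ k * h m \<le> h (m + k)"
proof (induction k)
  case (Suc k)
  have "2 ^ Suc k * h m = 2 * (2 ^ k * h m)" by simp
  also have "\<dots> \<le> q (m + k) * h (m + k)" using Suc q_ge_2 by (intro mult_mono) auto
  finally show ?case by simp
qed simp

text \<open>A step fails at level \<open>n\<close> only when the coordinate sits at the end of a
  block, which has probability \<open>1 / h n\<close>. Heights at least double, so the geometric
  series from level \<open>m\<close> on has sum at most \<open>2 / h m\<close>.\<close>

lemma measure_not_Reg: "measure \<mu> (X - Reg m) \<le> 2 / h m"
proof -
  let ?B = "\<lambda>k. {x\<in>X. x (Suc (m + k)) mod h (m + k) = h (m + k) - 1}"
  have B: "?B k \<in> sets \<mu>" for k
    using coord_set[of "\<lambda>u. u mod h (m + k) = h (m + k) - 1" "Suc (m + k)"] .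
  have geo: "summable (\<lambda>k. (1/2) ^ k * (1 / real (h m)))" by (intro summable_mult2 summable_geometric) simp
  have le: "measure \<mu> (?B k) \<le> (1/2) ^ k * (1 / real (h m))" for k
  proof -
    have "real (2 ^ k * h m) \<le> real (h (m + k))" using h_growth of_nat_le_iff by blast
    then show ?thesis unfolding measure_block_end
      using h_pos[of m] by (simp add: power_one_over divide_simps mult.commute)
  qed
  have summable: "summable (\<lambda>k. measure \<mu> (?B k))"
    by (rule summable_comparison_test'[OF geo, of 0]) (use le in simp)
  have "measure \<mu> (X - Reg m) \<le> measure \<mu> (\<Union>k. ?B k)"
  proof (rule K.finite_measure_mono)
    show "X - Reg m \<subseteq> (\<Union>k. ?B k)"
    proof
      fix x assume "x \<in> X - Reg m"
      then obtain n where n: "x \<in> X" "n \<ge> m" "\<not> step_ok n (x (Suc n))" by (auto simp: Reg_def)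
      then have "x (Suc n) mod h n = h n - 1" using step_ok_if X_less by blast
      then have "x \<in> ?B (n - m)" using n by simp
      then show "x \<in> (\<Union>k. ?B k)" by blast
    qed
    show "(\<Union>k. ?B k) \<in> sets \<mu>" using B by auto
  qed
  also have "\<dots> \<le> (\<Sum>k. measure \<mu> (?B k))"
    by (rule K.finite_measure_subadditive_countably) (use B summable in auto)
  also have "\<dots> \<le> (\<Sum>k. (1/2) ^ k * (1 / real (h m)))"
    by (rule suminf_le[OF le summable geo])
  also have "\<dots> = 2 / h m"
    by (subst suminf_mult2[symmetric]) (simp_all add: suminf_geometric)
  finally show ?thesis .
qed

lemma T_X: "x \<in> X \<Longrightarrow> (T ^^ j) x \<in> X"
proof (induction j)
  case (Suc j)
  have "T y \<in> X" if "y \<in> X" for y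
    using that T_char(1)[of y] by (cases "y \<in> R") (simp_all add: iceberg_map_def[of q \<alpha> y])
  then show ?case using Suc by simp
qed simp

lemma T_pow_coord:
  assumes "x \<in> X" "\<And>i. i < j \<Longrightarrow> (T ^^ i) x \<in> Reg m" "m \<le> n"
  shows "(T ^^ j) x n = (x n + j) mod h n"
  using assms(2)
proof (induction j)
  case 0
  then show ?case using X_less[OF assms(1)] by simp
next
  case (Suc j)
  let ?y = "(T ^^ j) x"
  have y: "?y \<in> Reg m" using Suc.prems by simp
  then have reg: "iceberg_regular_from q \<alpha> m ?y" "?y \<in> X" using regular_from_iff by (auto simp: Reg_def)
  then have "?y \<in> R" by (auto simp: iceberg_regular_def)
  then have "T ?y n = (?y n + 1) mod h n" using T_char(3) reg assms(3) by blast
  also have "?y n = (x n + j) mod h n" using Suc by simp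
  finally show ?case by (simp add: mod_Suc_eq)
qed

definition Good :: "nat \<Rightarrow> nat \<Rightarrow> (nat \<Rightarrow> nat) set" where
  "Good K m = {x\<in>X. \<forall>j<K. (T ^^ j) x \<in> Reg m}"

lemma bad_cover: "X - Good K m = (\<Union>j<K. (T ^^ j) -` (X - Reg m) \<inter> space \<mu>)"
  using T_X by (auto simp: Good_def space_\<mu>)

lemma bad_sets: "X - Good K m \<in> sets \<mu>"
  unfolding bad_cover using Reg_sets K.T_pow space_\<mu>
  by (intro sets.finite_UN measurable_sets[OF conjunct1[OF K.T_pow]]) (auto simp: space_\<mu>[symmetric])

lemma measure_bad: "measure \<mu> (X - Good K m) \<le> 2 * K / h m"
proof -
  have XR: "X - Reg m \<in> sets \<mu>" using Reg_sets by (auto simp: space_\<mu>[symmetric])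
  have "measure \<mu> (X - Good K m) \<le> (\<Sum>j<K. measure \<mu> ((T ^^ j) -` (X - Reg m) \<inter> space \<mu>))"
    unfolding bad_cover
    by (rule K.finite_measure_subadditive_finite) (auto intro!: measurable_sets[OF conjunct1[OF K.T_pow] XR])
  also have "\<dots> = (\<Sum>j<K. measure \<mu> (X - Reg m))"
  proof (intro sum.cong refl)
    fix j
    have "measure (distr \<mu> \<mu> (T ^^ j)) (X - Reg m) = measure \<mu> ((T ^^ j) -` (X - Reg m) \<inter> space \<mu>)"
      by (rule measure_distr[OF conjunct1[OF K.T_pow] XR])
    then show "measure \<mu> ((T ^^ j) -` (X - Reg m) \<inter> space \<mu>) = measure \<mu> (X - Reg m)"
      by (simp only: conjunct2[OF K.T_pow])
  qed
  also have "\<dots> \<le> (\<Sum>j<K. 2 / h m)" by (intro sum_mono measure_not_Reg)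
  finally show ?thesis by (simp add: mult.commute)
qed

text \<open>Off the bad set \<open>T ^^ t\<close> acts on coordinate \<open>n + d\<close> as the
  shift by \<open>t\<close> for all \<open>t < K\<close>, so bandpass functions are windows divided
  by \<open>K\<close>. Parseval at each point bounds the squared discrepancy over all frequencies at
  once, with no loss in their number.\<close>

lemma band_area_le:
  assumes K: "0 < K" and c1: "\<And>u. cmod (c1 u) \<le> 1" and c2: "\<And>u. cmod (c2 u) \<le> 1"
  shows "K.band_area K (\<lambda>x. c1 (x n)) (\<lambda>x. c2 (x n)) \<le>
    mean_area K (h (n + d)) K (word q \<alpha> n c1 d) (word q \<alpha> n c2 d) + 2 * sqrt (8 * K / h (n + d))"
proof -
  let ?z = "root_unity K" and ?m = "n + d"
  define G where "G c = word q \<alpha> n c d" for c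
  define u where "u c w = K.bandpass K w (\<lambda>x. c (x n))" for c :: "nat \<Rightarrow> complex" and w
  define v where "v c w = (\<lambda>x. (1 / of_nat K) * window (h ?m) (G c) K (?z w) (x ?m))" for c and w
  let ?bad = "X - Good K ?m"
  have uL: "u c w \<in> L2_funs \<mu>" for c w unfolding u_def by (intro K.bandpass_L2 coord_L2)
  have wL: "(\<lambda>x. window (h ?m) (G c) K (?z w) (x ?m)) \<in> L2_funs \<mu>" for c w
    by (rule coord_L2)
  have vL: "v c w \<in> L2_funs \<mu>" for c w unfolding v_def by (intro L2_scale(1) wL)
  have GX: "G c (x ?m) = c (x n)" if "x \<in> X" for x c
    unfolding G_def word_descend descend_X[OF that] ..
  have diff: "u c w x - v c w x = (\<Sum>t<K. ((c ((T ^^ t) x n) - G c ((x ?m + t) mod h ?m)) / of_nat K) * ?z w ^ t)" for c w x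
    unfolding u_def v_def K.bandpass_def window_def
    by (simp add: sum_distrib_left sum_subtractf[symmetric] left_diff_distrib right_diff_distrib diff_divide_distrib mult.commute)
  have pt: "(\<Sum>w<K. (cmod (u c w x - v c w x))\<^sup>2) \<le> 4 * indicator ?bad x"
    if x: "x \<in> X" and c: "\<And>u. cmod (c u) \<le> 1" for x c
  proof -
    let ?D = "\<lambda>t. c ((T ^^ t) x n) - G c ((x ?m + t) mod h ?m)"
    have "(\<Sum>w<K. (cmod (u c w x - v c w x))\<^sup>2) = K * (\<Sum>t<K. (cmod (?D t / of_nat K))\<^sup>2)"
      unfolding diff by (rule root_unity_Parseval[OF K]) (auto simp: inj_on_def)
    also have "\<dots> = (\<Sum>t<K. (cmod (?D t))\<^sup>2) / K"
      using K by (simp add: norm_divide power_divide sum_divide_distrib[symmetric] power2_eq_square[of "real K"])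
    also have "\<dots> \<le> (\<Sum>t<K. 4 * indicator ?bad x) / K"
    proof (intro divide_right_mono sum_mono)
      fix t assume t: "t \<in> {..<K}"
      show "(cmod (?D t))\<^sup>2 \<le> 4 * indicator ?bad x"
      proof (cases "x \<in> Good K ?m")
        case True
        then have "(T ^^ t) x ?m = (x ?m + t) mod h ?m"
          using t by (intro T_pow_coord[OF x, of t ?m]) (auto simp: Good_def)
        then have "?D t = 0" using GX[OF T_X[OF x], of c t] by simp
        then show ?thesis by simp
      next
        case False
        have "cmod (?D t) \<le> cmod (c ((T ^^ t) x n)) + cmod (G c ((x ?m + t) mod h ?m))"
          by (rule norm_triangle_ineq4)
        also have "\<dots> \<le> 1 + 1" unfolding G_def by (intro add_mono c word_bound)
        finally have "(cmod (?D t))\<^sup>2 \<le> 2\<^sup>2" by (intro power_mono) auto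
        then show ?thesis using False x by simp
      qed
    qed simp
    also have "\<dots> = 4 * indicator ?bad x" using K by simp
    finally show ?thesis .
  qed
  \<comment> \<open>Values bounded by 1 differ by at most 2, hence the 4 in \<open>pt\<close>; the
    bad set has measure at most \<open>2 * K / h (n + d)\<close>, hence the 8.\<close>
  have E_le: "(\<Sum>w<K. L2_nsq \<mu> (\<lambda>x. u c w x - v c w x)) \<le> 8 * K / h ?m" if c: "\<And>u. cmod (c u) \<le> 1" for c
  proof -
    have int: "integrable \<mu> (\<lambda>x. (cmod (u c w x - v c w x))\<^sup>2)" for w
      by (intro L2_int L2_diff uL vL)
    have "(\<Sum>w<K. L2_nsq \<mu> (\<lambda>x. u c w x - v c w x)) = (\<integral>x. (\<Sum>w<K. (cmod (u c w x - v c w x))\<^sup>2) \<partial>\<mu>)"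
      unfolding L2_nsq_def by (rule Bochner_Integration.integral_sum[symmetric]) (rule int)
    also have "\<dots> \<le> (\<integral>x. 4 * indicator ?bad x \<partial>\<mu>)"
    proof (rule integral_mono)
      show "integrable \<mu> (\<lambda>x. \<Sum>w<K. (cmod (u c w x - v c w x))\<^sup>2)"
        by (intro Bochner_Integration.integrable_sum int)
      show "integrable \<mu> (\<lambda>x. 4 * indicator ?bad x :: real)"
        using bad_sets by (intro integrable_mult_right integrable_real_indicator) (auto simp: K.emeasure_eq_measure)
    qed (simp add: pt c space_\<mu>)
    also have "\<dots> = 4 * measure \<mu> ?bad" using bad_sets by simp
    also have "\<dots> \<le> 4 * (2 * K / h ?m)" using measure_bad[of K ?m] by simp
    finally show ?thesis by simp
  qed
  have u_le: "(\<Sum>w<K. L2_nsq \<mu> (u c w)) \<le> 1" if c: "\<And>u. cmod (c u) \<le> 1" for c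
    unfolding u_def K.bandpass_Parseval[OF K coord_L2]
  proof (rule L2_nsq_bound[OF K.prob_space_axioms])
    show "(\<lambda>x. c (x n)) \<in> borel_measurable \<mu>" by (rule L2_meas[OF coord_L2])
    show "(cmod (c (x n)))\<^sup>2 \<le> 1" for x by (intro power_le_one c) simp
  qed
  have v_le: "(\<Sum>w<K. L2_nsq \<mu> (v c w)) \<le> 1" if c: "\<And>u. cmod (c u) \<le> 1" for c
  proof -
    have "(\<Sum>w<K. (cmod (window (h ?m) (G c) K (?z w) s))\<^sup>2) \<le> real K * real (card {..<K})" for s
      unfolding window_def G_def by (rule root_unity_Parseval_le[OF K, of _ 0]) (auto intro: word_bound c)
    then have w: "(\<Sum>w<K. L2_nsq (unif (h ?m)) (window (h ?m) (G c) K (?z w))) \<le> real K * real K"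
      by (intro sum_unif_nsq_le h_pos) simp
    have "(\<Sum>w<K. L2_nsq \<mu> (v c w)) = (\<Sum>w<K. L2_nsq (unif (h ?m)) (window (h ?m) (G c) K (?z w))) / (real K * real K)"
      unfolding v_def L2_scale(2)[OF wL] coord_nsq sum_divide_distrib
      by (simp add: norm_divide power_divide power2_eq_square)
    then show ?thesis using w K by simp
  qed
  have va: "L2_area \<mu> (v c1 w) (v c2 w) =
      L2_area (unif (h ?m)) (window (h ?m) (G c1) K (?z w)) (window (h ?m) (G c2) K (?z w)) / (real K * real K)" for w
  proof -
    have "L2_area \<mu> (v c1 w) (v c2 w) = cmod (1 / of_nat K) * L2_area \<mu> (\<lambda>x. window (h ?m) (G c1) K (?z w) (x ?m)) (v c2 w)"
      unfolding v_def[of c1] by (rule L2_area_scale[OF wL])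
    also have "L2_area \<mu> (\<lambda>x. window (h ?m) (G c1) K (?z w) (x ?m)) (v c2 w) =
        cmod (1 / of_nat K) * L2_area \<mu> (\<lambda>x. window (h ?m) (G c2) K (?z w) (x ?m)) (\<lambda>x. window (h ?m) (G c1) K (?z w) (x ?m))"
      unfolding v_def[of c2] by (subst L2_area_commute) (rule L2_area_scale[OF wL])
    also have "L2_area \<mu> (\<lambda>x. window (h ?m) (G c2) K (?z w) (x ?m)) (\<lambda>x. window (h ?m) (G c1) K (?z w) (x ?m)) =
        L2_area (unif (h ?m)) (window (h ?m) (G c1) K (?z w)) (window (h ?m) (G c2) K (?z w))"
      unfolding coord_area by (rule L2_area_commute)
    finally show ?thesis by (simp add: norm_divide)
  qed
  have "K.band_area K (\<lambda>x. c1 (x n)) (\<lambda>x. c2 (x n)) = (\<Sum>w<K. L2_area \<mu> (u c1 w) (u c2 w))"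
    by (simp add: K.band_area_def u_def)
  also have "\<dots> \<le> (\<Sum>w<K. L2_area \<mu> (v c1 w) (v c2 w) + L2_norm \<mu> (\<lambda>x. u c1 w x - v c1 w x) * L2_norm \<mu> (u c2 w) +
      L2_norm \<mu> (v c1 w) * L2_norm \<mu> (\<lambda>x. u c2 w x - v c2 w x))"
    by (intro sum_mono L2_area_perturb uL vL)
  also have "\<dots> \<le> (\<Sum>w<K. L2_area \<mu> (v c1 w) (v c2 w)) + sqrt ((8 * K / h ?m) * 1) + sqrt (1 * (8 * K / h ?m))"
    unfolding sum.distrib by (intro add_mono order_refl sum_L2_norm_prod_le E_le u_le v_le c1 c2)
  also have "(\<Sum>w<K. L2_area \<mu> (v c1 w) (v c2 w)) = mean_area K (h ?m) K (G c1) (G c2)"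
    unfolding va mean_area_def sum_divide_distrib ..
  finally show ?thesis unfolding G_def by simp
qed

end

section \<open>Reduction to indicators of cylinders\<close>

lemma L2_area_sum_left:
  assumes "finite I" "\<And>i. i \<in> I \<Longrightarrow> u i \<in> L2_funs M" "v \<in> L2_funs M"
  shows "L2_area M (\<lambda>x. \<Sum>i\<in>I. a i * u i x) v \<le> (\<Sum>i\<in>I. cmod (a i) * L2_area M (u i) v)"
  using assms
proof (induction I)
  case empty
  then show ?case by (simp add: L2_area_def L2_nsq_def L2_inner_def)
next
  case (insert i I)
  have "L2_area M (\<lambda>x. a i * u i x + (\<Sum>i\<in>I. a i * u i x)) v \<le>
      L2_area M (\<lambda>x. a i * u i x) v + L2_area M (\<lambda>x. \<Sum>i\<in>I. a i * u i x) v"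
    using insert by (intro L2_area_triangle L2_scale(1) L2_sum) auto
  then show ?case using insert by (simp add: L2_area_scale)
qed

lemma (in koopman) band_area_sum_left:
  assumes "finite I" "\<And>i. i \<in> I \<Longrightarrow> e i \<in> L2_funs M" "g \<in> L2_funs M"
  shows "band_area K (\<lambda>x. \<Sum>i\<in>I. a i * e i x) g \<le> (\<Sum>i\<in>I. cmod (a i) * band_area K (e i) g)"
proof -
  have b: "bandpass K w (\<lambda>x. \<Sum>i\<in>I. a i * e i x) = (\<lambda>x. \<Sum>i\<in>I. a i * bandpass K w (e i) x)" for w
  proof
    fix x
    have "bandpass K w (\<lambda>x. \<Sum>i\<in>I. a i * e i x) x = (\<Sum>t<K. \<Sum>i\<in>I. a i * (root_unity K w ^ t / of_nat K * (e i \<circ> (T ^^ t)) x))"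
      unfolding bandpass_def comp_def sum_distrib_left by (intro sum.cong refl) (simp add: mult_ac)
    also have "\<dots> = (\<Sum>i\<in>I. \<Sum>t<K. a i * (root_unity K w ^ t / of_nat K * (e i \<circ> (T ^^ t)) x))"
      by (rule sum.swap)
    finally show "bandpass K w (\<lambda>x. \<Sum>i\<in>I. a i * e i x) x = (\<Sum>i\<in>I. a i * bandpass K w (e i) x)"
      by (simp only: bandpass_def sum_distrib_left)
  qed
  have "band_area K (\<lambda>x. \<Sum>i\<in>I. a i * e i x) g \<le>
      (\<Sum>w<K. \<Sum>i\<in>I. cmod (a i) * L2_area M (bandpass K w (e i)) (bandpass K w g))"
    unfolding band_area_def b using assms by (intro sum_mono L2_area_sum_left bandpass_L2)
  also have "\<dots> = (\<Sum>i\<in>I. \<Sum>w<K. cmod (a i) * L2_area M (bandpass K w (e i)) (bandpass K w g))"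
    by (rule sum.swap)
  finally show ?thesis by (simp only: band_area_def sum_distrib_left)
qed

lemma (in koopman) band_area_commute: "band_area K e g = band_area K g e"
  unfolding band_area_def by (simp only: L2_area_commute)

lemma L2_area_cong:
  assumes "\<And>x. x \<in> space M \<Longrightarrow> f x = f' x" "\<And>x. x \<in> space M \<Longrightarrow> g x = g' x"
  shows "L2_area M f g = L2_area M f' g'"
proof -
  have "L2_nsq M f = L2_nsq M f'" "L2_nsq M g = L2_nsq M g'" "L2_inner M f g = L2_inner M f' g'"
    unfolding L2_nsq_def L2_inner_def using assms by (auto intro!: Bochner_Integration.integral_cong)
  then show ?thesis by (simp only: L2_area_def)
qed

lemma (in koopman) band_area_cong:
  assumes "\<And>x. x \<in> space M \<Longrightarrow> e x = e' x" "\<And>x. x \<in> space M \<Longrightarrow> g x = g' x"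
  shows "band_area K e g = band_area K e' g'"
proof -
  have T: "(T ^^ t) x \<in> space M" if "x \<in> space M" for t x
    using measurable_space[OF conjunct1[OF T_pow] that] .
  have b: "bandpass K w f x = bandpass K w f' x"
    if f: "\<And>x. x \<in> space M \<Longrightarrow> f x = f' x" and x: "x \<in> space M" for w x and f f' :: "'a \<Rightarrow> complex"
    unfolding bandpass_def comp_def by (rule sum.cong[OF refl]) (simp only: f[OF T[OF x]])
  show ?thesis unfolding band_area_def
  proof (rule sum.cong[OF refl], rule L2_area_cong)
    fix w x assume x: "x \<in> space M"
    show "bandpass K w e x = bandpass K w e' x" by (rule b[OF assms(1) x])
    show "bandpass K w g x = bandpass K w g' x" by (rule b[OF assms(2) x])
  qed
qed

context iceberg
begin

definition cyl :: "nat \<Rightarrow> nat \<Rightarrow> (nat \<Rightarrow> nat) \<Rightarrow> complex" where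
  "cyl n i = (\<lambda>x. if x n = i then 1 else 0)"

lemma cyl_L2: "cyl n i \<in> L2_funs \<mu>"
  unfolding cyl_def by (rule coord_L2[where f = "\<lambda>u. if u = i then 1 else 0"])

lemma level_expand:
  assumes "x \<in> X" shows "(a :: nat \<Rightarrow> complex) (x n) = (\<Sum>i<h n. a i * cyl n i x)"
proof -
  have "(\<Sum>i<h n. a i * cyl n i x) = (\<Sum>i<h n. if i = x n then a (x n) else 0)"
    by (intro sum.cong refl) (auto simp: cyl_def)
  also have "\<dots> = a (x n)" using X_less[OF assms] by simp
  finally show ?thesis ..
qed

text \<open>Areas are subadditive in each argument, so functions of one coordinate are controlled by
  finitely many pairs of indicators. A single \<open>K\<close> that is good for all pairs of a level
  then serves all functions of that level.\<close>

lemma band_area_level: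
  fixes a b :: "nat \<Rightarrow> complex"
  assumes e: "\<And>x. x \<in> X \<Longrightarrow> e x = a (x n)" and g: "\<And>x. x \<in> X \<Longrightarrow> g x = b (x n)"
  shows "K.band_area K e g \<le> (\<Sum>i<h n. \<Sum>j<h n. cmod (a i) * (cmod (b j) * K.band_area K (cyl n i) (cyl n j)))"
proof -
  let ?e = "\<lambda>x. \<Sum>i<h n. a i * cyl n i x" and ?g = "\<lambda>x. \<Sum>i<h n. b i * cyl n i x"
  have gL: "?g \<in> L2_funs \<mu>" by (intro L2_sum L2_scale(1) cyl_L2)
  have "K.band_area K e g = K.band_area K ?e ?g"
    by (rule K.band_area_cong) (simp_all add: space_\<mu> e g level_expand)
  also have "\<dots> \<le> (\<Sum>i<h n. cmod (a i) * K.band_area K (cyl n i) ?g)"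
    by (intro K.band_area_sum_left cyl_L2 gL) simp
  also have "\<dots> \<le> (\<Sum>i<h n. cmod (a i) * (\<Sum>j<h n. cmod (b j) * K.band_area K (cyl n i) (cyl n j)))"
  proof (intro sum_mono mult_left_mono)
    fix i
    have "K.band_area K (cyl n i) ?g \<le> (\<Sum>j<h n. cmod (b j) * K.band_area K (cyl n j) (cyl n i))"
      unfolding K.band_area_commute[of K "cyl n i" ?g] by (intro K.band_area_sum_left cyl_L2) simp
    then show "K.band_area K (cyl n i) ?g \<le> (\<Sum>j<h n. cmod (b j) * K.band_area K (cyl n i) (cyl n j))"
      by (simp only: K.band_area_commute[of K _ "cyl n i"])
  qed simp
  finally show ?thesis by (simp only: sum_distrib_left)
qed

lemma Int_stable_cyl: "Int_stable (insert {} {{x\<in>X. x n = t} |n t. t < h n})"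
proof (rule Int_stableI)
  let ?E = "insert {} {{x\<in>X. x n = t} |n t. t < h n}"
  have *: "{x\<in>X. x n = t} \<inter> {x\<in>X. x m = s} \<in> {{}, {x\<in>X. x m = s}}" if "n \<le> m" for n m s t
  proof (cases "\<exists>x\<in>X. x n = t \<and> x m = s")
    case True
    then obtain x where x: "x \<in> X" "x n = t" "x m = s" by blast
    then have "y n = t" if "y \<in> X" "y m = s" for y using X_nested[OF that(1) x(1) _ \<open>n \<le> m\<close>] that by simp
    then have "{x\<in>X. x n = t} \<inter> {x\<in>X. x m = s} = {x\<in>X. x m = s}" by auto
    then show ?thesis by simp
  next
    case False
    then have "{x\<in>X. x n = t} \<inter> {x\<in>X. x m = s} = {}" by auto
    then show ?thesis by simp
  qed
  fix A B assume AB: "A \<in> ?E" "B \<in> ?E"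
  show "A \<inter> B \<in> ?E"
  proof (cases "A = {} \<or> B = {}")
    case False
    then obtain n t m s where A: "A = {x\<in>X. x n = t}" and B: "B = {x\<in>X. x m = s}" using AB by blast
    have "A \<inter> B \<in> {{}, A, B}"
      using *[of n m t s] *[of m n s t] unfolding A B by (cases "n \<le> m") (auto simp: Int_commute)
    then show ?thesis using AB by auto
  qed auto
qed

text \<open>Functions of two coordinates \<open>n\<close> and \<open>m\<close> are both functions of
  coordinate \<open>max n m\<close>. Hence functions of one coordinate form a class stable under the
  steps of \<open>cyclic_vector_exists\<close>, and one \<open>K\<close> for all pairs of indicators
  of a level is the right hypothesis.\<close>

lemma simple_spectrum_if:
  assumes small: "\<And>n \<epsilon>. 0 < \<epsilon> \<Longrightarrow> \<exists>K>0. \<forall>i<h n. \<forall>j<h n. K.band_area K (cyl n i) (cyl n j) < \<epsilon>"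
  shows "iceberg_simple_spectrum q \<alpha>"
proof -
  \<comment> \<open>An enumeration of all pairs of level and value; values not below the height give
    the zero function.\<close>
  define g :: "nat \<Rightarrow> (nat \<Rightarrow> nat) \<Rightarrow> complex"
    where "g k = indicator {x\<in>X. x (fst (prod_decode k)) = snd (prod_decode k)}" for k
  have g_level: "\<exists>m j. g k = indicator {x\<in>X. x m = j}" for k
    unfolding g_def by blast
  define V where "V = {e\<in>L2_funs \<mu>. \<exists>n (a :: nat \<Rightarrow> complex). \<forall>x\<in>X. e x = a (x n)}"
  have gL: "g k \<in> L2_funs \<mu>" for k
  proof -
    obtain m j where "g k = indicator {x\<in>X. x m = j}" using g_level by blast
    then show ?thesis using K.indicator_L2[OF coord_set[of "\<lambda>u. u = j" m]] by simp
  qed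
  have lift: "\<exists>b :: nat \<Rightarrow> complex. \<forall>x\<in>X. a (x n) = b (x m)" if "n \<le> m" for a n m
  proof -
    have "a (x n) = a (descend n (m - n) (x m))" if "x \<in> X" for x
      using descend_X[OF that, of n "m - n"] \<open>n \<le> m\<close> by simp
    then show ?thesis by (intro exI[of _ "\<lambda>u. a (descend n (m - n) u)"]) simp
  qed
  have common: "\<exists>n a b. (\<forall>x\<in>X. e x = a (x n)) \<and> (\<forall>x\<in>X. g k x = b (x n))" if "e \<in> V" for e k
  proof -
    obtain n a where a: "\<forall>x\<in>X. e x = a (x n)" using \<open>e \<in> V\<close> unfolding V_def by blast
    obtain m j where gk: "g k = indicator {x\<in>X. x m = j}" using g_level by blast
    have gk': "\<forall>x\<in>X. g k x = (\<lambda>u. if u = j then 1 else 0) (x m)" by (simp add: gk indicator_def)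
    obtain a' where "\<forall>x\<in>X. a (x n) = a' (x (max n m))" using lift[of n "max n m" a] by auto
    moreover obtain b' where "\<forall>x\<in>X. (\<lambda>u. if u = j then 1 else 0 :: complex) (x m) = b' (x (max n m))"
      using lift[of m "max n m" "\<lambda>u. if u = j then 1 else 0"] by auto
    ultimately show ?thesis using a gk' by (intro exI[of _ "max n m"] exI[of _ a'] exI[of _ b']) simp
  qed
  have "\<exists>e\<in>L2_funs \<mu>. \<forall>k. \<forall>\<epsilon>>0. K.near \<epsilon> (g k) e"
  proof (rule K.cyclic_vector_exists[where V = V])
    show "g k \<in> L2_funs \<mu>" for k by (rule gL)
    show "cmod (g k x) \<le> 1" for k x using g_level[of k] by (auto simp: indicator_def)
    show "(\<lambda>x. 0) \<in> V" unfolding V_def by (auto simp: L2_zero intro!: exI[of _ "\<lambda>_. 0"])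
    show "V \<subseteq> L2_funs \<mu>" by (auto simp: V_def)
    show "(\<lambda>x. e x + of_real l * g k x) \<in> V" if "e \<in> V" for e k l
    proof -
      obtain n a b where "\<forall>x\<in>X. e x = a (x n)" "\<forall>x\<in>X. g k x = b (x n)" using common[OF \<open>e \<in> V\<close>] by blast
      then have "\<exists>n (a :: nat \<Rightarrow> complex). \<forall>x\<in>X. e x + of_real l * g k x = a (x n)"
        by (intro exI[of _ n] exI[of _ "\<lambda>u. a u + of_real l * b u"]) simp
      moreover have "(\<lambda>x. e x + of_real l * g k x) \<in> L2_funs \<mu>"
        using that by (intro L2_add L2_scale(1) gL) (simp add: V_def)
      ultimately show ?thesis unfolding V_def by simp
    qed
    show "\<exists>K>0. K.band_area K e (g k) < \<delta>" if "e \<in> V" "0 < \<delta>" for e k \<delta>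
    proof -
      obtain n a b where ab: "\<And>x. x \<in> X \<Longrightarrow> e x = a (x n)" "\<And>x. x \<in> X \<Longrightarrow> g k x = b (x n)"
        using common[OF \<open>e \<in> V\<close>, of k] by blast
      define C where "C = (\<Sum>i<h n. \<Sum>j<h n. cmod (a i) * cmod (b j))"
      have C: "0 \<le> C" unfolding C_def by (intro sum_nonneg) auto
      define \<epsilon> where "\<epsilon> = \<delta> / (C + 1)"
      have \<epsilon>: "0 < \<epsilon>" using C \<open>0 < \<delta>\<close> by (simp add: \<epsilon>_def)
      obtain K where K: "0 < K" "\<And>i j. i < h n \<Longrightarrow> j < h n \<Longrightarrow> K.band_area K (cyl n i) (cyl n j) < \<epsilon>"
        using small[OF \<epsilon>, of n] by blast
      have "K.band_area K e (g k) \<le> (\<Sum>i<h n. \<Sum>j<h n. cmod (a i) * (cmod (b j) * K.band_area K (cyl n i) (cyl n j)))"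
        by (rule band_area_level[OF ab])
      also have "\<dots> \<le> (\<Sum>i<h n. \<Sum>j<h n. cmod (a i) * (cmod (b j) * \<epsilon>))"
        using K(2) by (intro sum_mono mult_left_mono) (auto intro: less_imp_le)
      also have "\<dots> = C * \<epsilon>" by (simp add: C_def sum_distrib_right mult.assoc)
      also have "\<dots> < (C + 1) * \<epsilon>" using \<epsilon> by simp
      also have "\<dots> = \<delta>" using C by (simp add: \<epsilon>_def)
      finally show ?thesis using K(1) by blast
    qed
  qed
  then obtain e where e: "e \<in> L2_funs \<mu>" "\<And>k \<epsilon>. 0 < \<epsilon> \<Longrightarrow> K.near \<epsilon> (g k) e" by blast
  let ?E = "insert {} {{x\<in>X. x n = t} |n t. t < h n}"
  have "L2_closed_span \<mu> (range (\<lambda>k. koopman_power T (iceberg_inv q \<alpha>) k e)) = L2_funs \<mu>"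
  proof (rule K.cyclic_of_generator[OF Int_stable_cyl _ _ _ e(1)])
    show "?E \<subseteq> Pow (space \<mu>)" by (auto simp: space_\<mu>)
    show "sets \<mu> = sigma_sets (space \<mu>) ?E" by (simp only: sets_\<mu> sets_restrict_eq space_\<mu>)
    have "x 0 < h 0" if "x \<in> X" for x using X_less[OF that] .
    then have "X = {x\<in>X. x 0 = 0}" by auto
    then have "X \<in> {{x\<in>X. x n = t} |n t. t < h n}" using h_pos by blast
    then show "space \<mu> \<in> ?E" by (simp add: space_\<mu>)
    fix A \<epsilon> assume A: "A \<in> ?E" and \<epsilon>: "0 < (\<epsilon> :: real)"
    show "K.near \<epsilon> (indicator A) e"
    proof (cases "A = {}")
      case True
      then have "indicator A = (\<lambda>x. 0 :: complex)" by auto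
      then show ?thesis using K.near_zero[OF \<epsilon>] by simp
    next
      case False
      then obtain n t where "A = {x\<in>X. x n = t}" using A by auto
      then have "indicator A = g (prod_encode (n, t))" by (simp add: g_def)
      then show ?thesis using e(2)[OF \<epsilon>] by simp
    qed
  qed
  then show ?thesis unfolding iceberg_simple_spectrum_def simple_spectrum_def using e(1) by blast
qed

end

section \<open>Almost sure behaviour\<close>

text \<open>A finite model of the rotations at levels below \<open>N\<close>. Its recursive product
  form lets averages be taken level by level, and entries outside the range are 0 so that truncated
  random arrays lie in it.\<close>

primrec all_rotations :: "(nat \<Rightarrow> nat) \<Rightarrow> nat \<Rightarrow> (nat \<Rightarrow> nat \<Rightarrow> nat) set" where
  "all_rotations q 0 = {\<lambda>_ _. 0}"
| "all_rotations q (Suc N) = (\<lambda>(r, b). r(N := b)) ` (all_rotations q N \<times> rotations (q N) (iceberg_height q N))"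

lemma finite_all_rotations: "finite (all_rotations q N)"
  by (induction N) (simp_all add: finite_rotations)

lemma all_rotations_iff:
  "r \<in> all_rotations q N \<longleftrightarrow>
    (\<forall>m y. if m < N \<and> y < q m then r m y < iceberg_height q m else r m y = 0)"
proof (induction N arbitrary: r)
  case 0
  then show ?case by (auto simp: fun_eq_iff)
next
  case (Suc N)
  show ?case
  proof
    assume "r \<in> all_rotations q (Suc N)"
    then obtain r' b where r: "r = r'(N := b)" "r' \<in> all_rotations q N" "b \<in> rotations (q N) (iceberg_height q N)"
      by auto
    show "\<forall>m y. if m < Suc N \<and> y < q m then r m y < iceberg_height q m else r m y = 0"
    proof (intro allI)
      fix m y
      have 1: "if m < N \<and> y < q m then r' m y < iceberg_height q m else r' m y = 0" using r(2) Suc by blast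
      have 2: "if y < q N then b y < iceberg_height q N else b y = 0" using r(3) by (simp add: rotations_def)
      show "if m < Suc N \<and> y < q m then r m y < iceberg_height q m else r m y = 0"
        using 1 2 by (cases "m = N") (auto simp: r(1) split: if_splits)
    qed
  next
    assume a: "\<forall>m y. if m < Suc N \<and> y < q m then r m y < iceberg_height q m else r m y = 0"
    have "r(N := \<lambda>_. 0) \<in> all_rotations q N"
      unfolding Suc
    proof (intro allI)
      fix m y
      have "if m < Suc N \<and> y < q m then r m y < iceberg_height q m else r m y = 0" using a by blast
      then show "if m < N \<and> y < q m then (r(N := \<lambda>_. 0)) m y < iceberg_height q m else (r(N := \<lambda>_. 0)) m y = 0"
        by (cases "m = N") (auto simp: less_Suc_eq split: if_splits)
    qed
    moreover have "r N \<in> rotations (q N) (iceberg_height q N)"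
      unfolding rotations_def
    proof (intro CollectI allI)
      fix y
      have "if N < Suc N \<and> y < q N then r N y < iceberg_height q N else r N y = 0" using a by blast
      then show "if y < q N then r N y < iceberg_height q N else r N y = 0" by simp
    qed
    ultimately have "(r(N := \<lambda>_. 0), r N) \<in> all_rotations q N \<times> rotations (q N) (iceberg_height q N)" by blast
    moreover have "r = (\<lambda>(r, b). r(N := b)) (r(N := \<lambda>_. 0), r N)" by simp
    ultimately show "r \<in> all_rotations q (Suc N)" unfolding all_rotations.simps by blast
  qed
qed

lemma all_rotations_less: "r \<in> all_rotations q N \<Longrightarrow> m < N \<Longrightarrow> y < q m \<Longrightarrow> r m y < iceberg_height q m"
  by (metis all_rotations_iff)

lemma inj_all_rotations:
  "inj_on (\<lambda>(r, b). r(N := b)) (all_rotations q N \<times> rotations (q N) (iceberg_height q N))"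
proof (rule inj_onI, clarify)
  fix r r' :: "nat \<Rightarrow> nat \<Rightarrow> nat" and b b' :: "nat \<Rightarrow> nat"
  assume r: "r \<in> all_rotations q N" "r' \<in> all_rotations q N" and eq: "r(N := b) = r'(N := b')"
  have z: "r N y = 0" "r' N y = 0" for y using r all_rotations_iff[of _ q N] by (metis less_irrefl)+
  have "r m = r' m" for m
  proof (cases "m = N")
    case True
    then show ?thesis using z by auto
  next
    case False
    then show ?thesis using fun_cong[OF eq, of m] by simp
  qed
  moreover have "b = b'" using fun_cong[OF eq, of N] by simp
  ultimately show "r = r' \<and> b = b'" by blast
qed

lemma sum_all_rotations:
  fixes F :: "(nat \<Rightarrow> nat \<Rightarrow> nat) \<Rightarrow> real"
  shows "(\<Sum>r\<in>all_rotations q (Suc N). F r) = (\<Sum>r\<in>all_rotations q N. \<Sum>b\<in>rotations (q N) (iceberg_height q N). F (r(N := b)))"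
  unfolding all_rotations.simps sum.reindex[OF inj_all_rotations]
  by (simp add: sum.cartesian_product comp_def case_prod_unfold)

lemma card_all_rotations:
  "card (all_rotations q (Suc N)) = card (all_rotations q N) * card (rotations (q N) (iceberg_height q N))"
  unfolding all_rotations.simps card_image[OF inj_all_rotations] by (rule card_cartesian_product)

lemma word_upd: "n + d \<le> N \<Longrightarrow> word q (r(N := b)) n c d = word q r n c d"
  by (induction d) auto

lemma word_upd_Suc: "word q (r(n + d := b)) n c (Suc d) = lift_word (iceberg_height q (n + d)) b (word q r n c d)"
  by (simp add: word_upd)

lemma height_pos: "(\<And>n. 1 \<le> q n) \<Longrightarrow> 0 < iceberg_height q n"
proof (induction n)
  case (Suc n)
  have "0 < q n" using Suc.prems[of n] by linarith
  then show ?case using Suc by simp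
qed simp

lemma sum_word_zero:
  assumes q: "\<And>n. 1 \<le> q n" and c: "(\<Sum>u<iceberg_height q n. c u) = 0"
    and r: "\<And>m y. m < n + d \<Longrightarrow> y < q m \<Longrightarrow> r m y < iceberg_height q m"
  shows "(\<Sum>u<iceberg_height q (n + d). word q r n c d u) = 0"
  using r
proof (induction d)
  case 0
  then show ?case using c by simp
next
  case (Suc d)
  have "(\<Sum>u<q (n + d) * iceberg_height q (n + d). lift_word (iceberg_height q (n + d)) (r (n + d)) (word q r n c d) u) = 0"
    by (rule sum_lift_word) (use Suc q in \<open>auto intro: height_pos\<close>)
  then show ?case by simp
qed

text \<open>The bound for the expected \<open>mean_area\<close> of complete words after
  \<open>d\<close> random levels: it starts at 1 by Parseval, then each level contributes one
  contraction and one edge error.\<close>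

primrec decay :: "(nat \<Rightarrow> nat) \<Rightarrow> nat \<Rightarrow> nat \<Rightarrow> real" where
  "decay q n 0 = 1"
| "decay q n (Suc d) = sqrt (2 / 3) * decay q n d + 2 / sqrt (real (q (n + d)))"

lemma mean_area_le_one:
  assumes h: "0 < h" and K: "h \<le> K" and G1: "\<And>u. cmod (G1 u) \<le> 1" and G2: "\<And>u. cmod (G2 u) \<le> 1"
  shows "mean_area K h h G1 G2 \<le> 1"
proof -
  let ?z = "root_unity K"
  have K0: "0 < K" using h K by simp
  have w: "(\<Sum>w<K. L2_nsq (unif h) (window h G h (?z w))) \<le> real K * real h" if G: "\<And>u. cmod (G u) \<le> 1" for G
  proof (rule sum_unif_nsq_le[OF _ h])
    fix s
    have "(\<Sum>w<K. (cmod (window h G h (?z w) s))\<^sup>2) \<le> real K * real (card {..<h})"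
      unfolding window_def by (rule root_unity_Parseval_le[OF K0, of _ 0]) (use K G in auto)
    then show "(\<Sum>w<K. (cmod (window h G h (?z w) s))\<^sup>2) \<le> real K * real h" by simp
  qed
  have "(\<Sum>w<K. L2_area (unif h) (window h G1 h (?z w)) (window h G2 h (?z w))) \<le>
      (\<Sum>w<K. L2_norm (unif h) (window h G1 h (?z w)) * L2_norm (unif h) (window h G2 h (?z w)))"
    by (intro sum_mono L2_area_le unif_L2)
  also have "\<dots> \<le> sqrt ((real K * real h) * (real K * real h))"
    by (intro sum_L2_norm_prod_le w G1 G2)
  also have "\<dots> = real K * real h" by (simp add: real_sqrt_mult)
  finally show ?thesis unfolding mean_area_def using K0 h by (simp add: divide_simps)
qed

lemma mean_area_nonneg: "0 \<le> mean_area K h n G1 G2"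
  unfolding mean_area_def by (intro divide_nonneg_nonneg sum_nonneg L2_area_nonneg unif_L2) auto

text \<open>\<open>K\<close> stays fixed during the induction while the word length grows up to at
  most \<open>K\<close>. With the lower levels fixed the word is deterministic and centered, so
  \<open>mean_area_average_full\<close> applies to the rotations of the next level.\<close>

lemma average_mean_area:
  assumes q: "\<And>n. 1 \<le> q n"
    and c1: "(\<Sum>u<iceberg_height q n. c1 u) = 0" "\<And>u. cmod (c1 u) \<le> 1"
    and c2: "(\<Sum>u<iceberg_height q n. c2 u) = 0" "\<And>u. cmod (c2 u) \<le> 1"
    and K: "iceberg_height q (n + d) \<le> K"
  shows "(\<Sum>r\<in>all_rotations q (n + d). mean_area K (iceberg_height q (n + d)) (iceberg_height q (n + d))
      (word q r n c1 d) (word q r n c2 d)) \<le> card (all_rotations q (n + d)) * decay q n d"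
  using K
proof (induction d)
  case 0
  have "(\<Sum>r\<in>all_rotations q n. mean_area K (iceberg_height q n) (iceberg_height q n) c1 c2) \<le> (\<Sum>r\<in>all_rotations q n. 1)"
    using 0 by (intro sum_mono mean_area_le_one height_pos q c1(2) c2(2)) simp
  then show ?case by simp
next
  case (Suc d)
  let ?h = "iceberg_height q (n + d)" and ?q = "q (n + d)" and ?A = "all_rotations q (n + d)"
  have hp: "0 < ?h" by (rule height_pos[OF q])
  have K': "?q * ?h \<le> K" using Suc.prems by simp
  have "1 * ?h \<le> ?q * ?h" by (rule mult_le_mono1[OF q])
  then have Kh: "?h \<le> K" using K' by linarith
  have "(\<Sum>r\<in>all_rotations q (n + Suc d). mean_area K (iceberg_height q (n + Suc d)) (iceberg_height q (n + Suc d))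
      (word q r n c1 (Suc d)) (word q r n c2 (Suc d))) =
    (\<Sum>r\<in>?A. \<Sum>b\<in>rotations ?q ?h. mean_area K (?q * ?h) (?q * ?h)
      (lift_word ?h b (word q r n c1 d)) (lift_word ?h b (word q r n c2 d)))"
    unfolding add_Suc_right sum_all_rotations word_upd_Suc iceberg_height.simps ..
  also have "\<dots> \<le> (\<Sum>r\<in>?A. card (rotations ?q ?h) *
      (sqrt (2 / 3) * mean_area K ?h ?h (word q r n c1 d) (word q r n c2 d) + 2 / sqrt ?q))"
  proof (rule sum_mono)
    fix r assume r: "r \<in> ?A"
    have z: "(\<Sum>u<?h. word q r n c d u) = 0" if "(\<Sum>u<iceberg_height q n. c u) = 0" for c
      by (rule sum_word_zero[OF q that all_rotations_less[OF r]])
    show "(\<Sum>b\<in>rotations ?q ?h. mean_area K (?q * ?h) (?q * ?h)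
      (lift_word ?h b (word q r n c1 d)) (lift_word ?h b (word q r n c2 d))) \<le> card (rotations ?q ?h) *
      (sqrt (2 / 3) * mean_area K ?h ?h (word q r n c1 d) (word q r n c2 d) + 2 / sqrt ?q)"
      by (rule mean_area_average_full[OF hp q K' z[OF c1(1)] word_bound z[OF c2(1)] word_bound]) (rule c1(2) c2(2))+
  qed
  also have "\<dots> = real (card (rotations ?q ?h)) *
      (sqrt (2 / 3) * (\<Sum>r\<in>?A. mean_area K ?h ?h (word q r n c1 d) (word q r n c2 d)) + real (card ?A) * (2 / sqrt ?q))"
    by (simp only: sum_distrib_left[symmetric] sum.distrib sum_constant)
  also have "\<dots> \<le> real (card (rotations ?q ?h)) *
      (sqrt (2 / 3) * (real (card ?A) * decay q n d) + real (card ?A) * (2 / sqrt ?q))"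
    by (intro mult_left_mono add_right_mono Suc.IH Kh) auto
  also have "\<dots> = card (all_rotations q (n + Suc d)) * decay q n (Suc d)"
    unfolding add_Suc_right card_all_rotations decay.simps of_nat_mult by (simp add: algebra_simps)
  finally show ?case .
qed

text \<open>The last level, where the window has only \<open>L\<close> blocks of the word: the area
  is kept rather than contracted, at the price of \<open>2 / sqrt L\<close>. Having the window much
  shorter than the word is what allows the comparison with \<open>T\<close>.\<close>

lemma average_mean_area_window:
  assumes q: "\<And>n. 1 \<le> q n"
    and c1: "(\<Sum>u<iceberg_height q n. c1 u) = 0" "\<And>u. cmod (c1 u) \<le> 1"
    and c2: "(\<Sum>u<iceberg_height q n. c2 u) = 0" "\<And>u. cmod (c2 u) \<le> 1"
    and L: "1 \<le> L" "L \<le> q (n + d)"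
  defines "K \<equiv> L * iceberg_height q (n + d)"
  shows "(\<Sum>r\<in>all_rotations q (Suc (n + d)). mean_area K (iceberg_height q (Suc (n + d))) K
      (word q r n c1 (Suc d)) (word q r n c2 (Suc d))) \<le>
    card (all_rotations q (Suc (n + d))) * (decay q n d + 2 / sqrt L)"
proof -
  let ?h = "iceberg_height q (n + d)" and ?q = "q (n + d)" and ?A = "all_rotations q (n + d)"
  have hp: "0 < ?h" by (rule height_pos[OF q])
  have Kh: "?h \<le> K" using mult_le_mono1[OF L(1), of ?h] by (simp add: K_def)
  have "(\<Sum>r\<in>all_rotations q (Suc (n + d)). mean_area K (iceberg_height q (Suc (n + d))) K
      (word q r n c1 (Suc d)) (word q r n c2 (Suc d))) =
    (\<Sum>r\<in>?A. \<Sum>b\<in>rotations ?q ?h. mean_area K (?q * ?h) (L * ?h)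
      (lift_word ?h b (word q r n c1 d)) (lift_word ?h b (word q r n c2 d)))"
    unfolding sum_all_rotations word_upd_Suc iceberg_height.simps K_def ..
  also have "\<dots> \<le> (\<Sum>r\<in>?A. card (rotations ?q ?h) *
      (mean_area K ?h ?h (word q r n c1 d) (word q r n c2 d) + 2 / sqrt L))"
  proof (rule sum_mono)
    fix r assume r: "r \<in> ?A"
    have z: "(\<Sum>u<?h. word q r n c d u) = 0" if "(\<Sum>u<iceberg_height q n. c u) = 0" for c
      by (rule sum_word_zero[OF q that all_rotations_less[OF r]])
    have KK: "L * ?h \<le> K" by (simp add: K_def)
    show "(\<Sum>b\<in>rotations ?q ?h. mean_area K (?q * ?h) (L * ?h)
      (lift_word ?h b (word q r n c1 d)) (lift_word ?h b (word q r n c2 d))) \<le> card (rotations ?q ?h) *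
      (mean_area K ?h ?h (word q r n c1 d) (word q r n c2 d) + 2 / sqrt L)"
      by (rule mean_area_average_window[OF hp L KK z[OF c1(1)] word_bound z[OF c2(1)] word_bound]) (rule c1(2) c2(2))+
  qed
  also have "\<dots> = real (card (rotations ?q ?h)) *
      ((\<Sum>r\<in>?A. mean_area K ?h ?h (word q r n c1 d) (word q r n c2 d)) + real (card ?A) * (2 / sqrt L))"
    by (simp only: sum_distrib_left[symmetric] sum.distrib sum_constant)
  also have "\<dots> \<le> real (card (rotations ?q ?h)) *
      (real (card ?A) * decay q n d + real (card ?A) * (2 / sqrt L))"
    by (intro mult_left_mono add_right_mono average_mean_area q c1 c2 Kh) auto
  also have "\<dots> = card (all_rotations q (Suc (n + d))) * (decay q n d + 2 / sqrt L)"
    unfolding card_all_rotations of_nat_mult by (simp add: algebra_simps)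
  finally show ?thesis .
qed

lemma contraction_tendsto_zero:
  fixes x \<epsilon> :: "nat \<Rightarrow> real"
  assumes \<rho>: "0 \<le> \<rho>" "\<rho> < 1" and x: "\<And>d. x (Suc d) = \<rho> * x d + \<epsilon> d" "\<And>d. 0 \<le> x d" and \<epsilon>: "\<epsilon> \<longlonglongrightarrow> 0"
  shows "x \<longlonglongrightarrow> 0"
proof (rule LIMSEQ_I)
  fix e :: real assume e: "0 < e"
  \<comment> \<open>For errors below \<open>\<delta>\<close> the value \<open>e / 2\<close> is a
    fixed point of the recursion, so the excess over it decays geometrically.\<close>
  define \<delta> where "\<delta> = (1 - \<rho>) * (e / 2)"
  have "0 < \<delta>" using e \<rho> by (simp add: \<delta>_def)
  then obtain D where D: "\<And>d. d \<ge> D \<Longrightarrow> \<epsilon> d < \<delta>"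
    using order_tendstoD(2)[OF \<epsilon>] by (auto simp: eventually_sequentially)
  have b: "x (D + k) \<le> \<rho> ^ k * x D + e / 2" for k
  proof (induction k)
    case 0
    then show ?case using e by simp
  next
    case (Suc k)
    have "x (D + Suc k) \<le> \<rho> * (\<rho> ^ k * x D + e / 2) + \<delta>"
      using mult_left_mono[OF Suc \<rho>(1)] D[of "D + k"] by (simp add: x(1))
    then show ?case by (simp add: \<delta>_def field_simps)
  qed
  have "(\<lambda>k. \<rho> ^ k * x D) \<longlonglongrightarrow> 0" using \<rho> by (intro tendsto_mult_left_zero LIMSEQ_power_zero) simp
  then obtain k0 where k0: "\<And>k. k \<ge> k0 \<Longrightarrow> \<rho> ^ k * x D < e / 2"
    using order_tendstoD(2)[of _ 0 sequentially "e / 2"] e by (auto simp: eventually_sequentially)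
  have "norm (x d - 0) < e" if "d \<ge> D + k0" for d
  proof -
    have d: "D + (d - D) = d" "k0 \<le> d - D" using that by auto
    have "x d < e" using b[of "d - D"] k0[OF d(2)] unfolding d(1) by linarith
    then show ?thesis using x(2)[of d] by simp
  qed
  then show "\<exists>no. \<forall>d\<ge>no. norm (x d - 0) < e" by blast
qed

lemma decay_tendsto:
  assumes q: "filterlim (\<lambda>n. real (q n)) at_top sequentially"
  shows "decay q n \<longlonglongrightarrow> 0"
proof (rule contraction_tendsto_zero[of "sqrt (2 / 3)"])
  show "decay q n (Suc d) = sqrt (2 / 3) * decay q n d + 2 / sqrt (real (q (n + d)))" for d by simp
  show "0 \<le> decay q n d" for d by (induction d) auto
  have "filterlim (\<lambda>d. real (q (n + d))) at_top sequentially"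
    using filterlim_compose[OF q filterlim_subseq[of "\<lambda>d. n + d"]] by (simp add: strict_mono_def)
  then show "(\<lambda>d. 2 / sqrt (real (q (n + d)))) \<longlonglongrightarrow> 0"
    by (intro tendsto_divide_0[OF tendsto_const] filterlim_at_top_imp_at_infinity filterlim_compose[OF sqrt_at_top])
qed auto

lemma word_cong:
  assumes q: "\<And>n. 1 \<le> q n" and r: "\<And>m y. m < n + d \<Longrightarrow> y < q m \<Longrightarrow> r m y = r' m y" and u: "u < iceberg_height q (n + d)"
  shows "word q r n c d u = word q r' n c d u"
  using r u
proof (induction d arbitrary: u)
  case (Suc d)
  let ?h = "iceberg_height q (n + d)"
  have hp: "0 < ?h" by (rule height_pos[OF q])
  have "u div ?h < q (n + d)" using Suc.prems(2) by (simp add: less_mult_imp_div_less)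
  then have "r (n + d) (u div ?h) = r' (n + d) (u div ?h)" using Suc.prems(1) by simp
  moreover have "nat ((int (u mod ?h) - int (r' (n + d) (u div ?h))) mod int ?h) < ?h"
    using hp by (simp add: nat_less_iff)
  ultimately show ?case using Suc.IH Suc.prems(1) by (simp add: lift_word_def)
qed simp

lemma mean_area_cong:
  assumes h: "0 < h" and "\<And>u. u < h \<Longrightarrow> G1 u = G1' u" "\<And>u. u < h \<Longrightarrow> G2 u = G2' u"
  shows "mean_area K h n G1 G2 = mean_area K h n G1' G2'"
proof -
  have "window h G1 n z = window h G1' n z" "window h G2 n z = window h G2' n z" for z
    unfolding window_def using assms by (auto intro!: ext sum.cong)
  then show ?thesis by (simp only: mean_area_def)
qed

section \<open>Truncated random rotations and Markov's inequality\<close>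

definition trunc_rotations :: "(nat \<Rightarrow> nat) \<Rightarrow> nat \<Rightarrow> (nat \<Rightarrow> nat \<Rightarrow> nat) \<Rightarrow> nat \<Rightarrow> nat \<Rightarrow> nat" where
  "trunc_rotations q N a m y = (if m < N \<and> y < q m then a m y else 0)"


context prob_space
begin

context
  fixes q :: "nat \<Rightarrow> nat" and \<alpha> :: "nat \<Rightarrow> nat \<Rightarrow> 'a \<Rightarrow> nat"
  assumes q: "\<And>n. 1 \<le> q n"
    and indep: "indep_vars (\<lambda>(n, y). count_space {..<iceberg_height q n}) (\<lambda>(n, y). \<alpha> n y) (SIGMA n:UNIV. {..<q n})"
    and uniform: "\<And>n y. y < q n \<Longrightarrow> distr M (count_space {..<iceberg_height q n}) (\<alpha> n y) = uniform_count_measure {..<iceberg_height q n}"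
begin

lemma rotation_rv: "y < q n \<Longrightarrow> \<alpha> n y \<in> measurable M (count_space {..<iceberg_height q n})"
  using indep unfolding indep_vars_def2 by auto

lemma rotation_less: "y < q n \<Longrightarrow> \<omega> \<in> space M \<Longrightarrow> \<alpha> n y \<omega> < iceberg_height q n"
  using measurable_space[OF rotation_rv] by simp

abbreviation "rnd N \<omega> \<equiv> trunc_rotations q N (\<lambda>m y. \<alpha> m y \<omega>)"

lemma rnd_in: "\<omega> \<in> space M \<Longrightarrow> rnd N \<omega> \<in> all_rotations q N"
  unfolding all_rotations_iff trunc_rotations_def using rotation_less by simp

text \<open>Independence gives every array the same probability \<open>p\<close>, a product that
  does not involve \<open>r\<close>. As the arrays exhaust the space, \<open>p\<close> must be the
  reciprocal of their number.\<close>

lemma rnd_uniform: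
  assumes r: "r \<in> all_rotations q N"
  shows "{\<omega>\<in>space M. rnd N \<omega> = r} \<in> events" "prob {\<omega>\<in>space M. rnd N \<omega> = r} = 1 / card (all_rotations q N)"
proof -
  let ?h = "iceberg_height q"
  define J where "J = (SIGMA m:{..<N}. {..<q m})"
  define p where "p = (\<Prod>(m, y)\<in>J. 1 / real (?h m))"
  define A where "A r = {\<omega>\<in>space M. rnd N \<omega> = r}" for r
  have main: "A r \<in> events \<and> prob (A r) = p" if r: "r \<in> all_rotations q N" for r
  proof -
    define E where "E = (\<lambda>(m, y). (\<alpha> m y) -` {r m y} \<inter> space M)"
    have rl: "r m y < ?h m" if "(m, y) \<in> J" for m y
      using that all_rotations_less[OF r] by (auto simp: J_def)
    have fin: "finite J" by (simp add: J_def)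
    have AE: "A r = space M \<inter> (\<Inter>j\<in>J. E j)"
    proof (intro set_eqI iffI)
      fix \<omega> assume "\<omega> \<in> A r"
      then have w: "\<omega> \<in> space M" "rnd N \<omega> = r" by (auto simp: A_def)
      have "\<alpha> m y \<omega> = r m y" if "(m, y) \<in> J" for m y
        using fun_cong[OF fun_cong[OF w(2), of m], of y] that by (auto simp: trunc_rotations_def J_def)
      then show "\<omega> \<in> space M \<inter> (\<Inter>j\<in>J. E j)" using w(1) by (auto simp: E_def)
    next
      fix \<omega> assume w: "\<omega> \<in> space M \<inter> (\<Inter>j\<in>J. E j)"
      have "rnd N \<omega> m y = r m y" for m y
      proof (cases "m < N \<and> y < q m")
        case True
        then have "\<omega> \<in> E (m, y)" using w by (auto simp: J_def)
        then show ?thesis using True by (simp add: E_def trunc_rotations_def)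
      next
        case False
        then have "r m y = 0" using r unfolding all_rotations_iff by metis
        then show ?thesis using False by (auto simp: trunc_rotations_def)
      qed
      then show "\<omega> \<in> A r" using w by (auto simp: A_def fun_eq_iff)
    qed
    have Eev: "E (m, y) \<in> events" "prob (E (m, y)) = 1 / real (?h m)" if "(m, y) \<in> J" for m y
    proof -
      have y: "y < q m" using that by (simp add: J_def)
      show "E (m, y) \<in> events"
        unfolding E_def using measurable_sets[OF rotation_rv[OF y], of "{r m y}"] rl[OF that] by simp
      have "measure (distr M (count_space {..<?h m}) (\<alpha> m y)) {r m y} = prob (E (m, y))"
        unfolding E_def using rl[OF that] by (subst measure_distr[OF rotation_rv[OF y]]) auto
      then show "prob (E (m, y)) = 1 / real (?h m)"
        unfolding uniform[OF y] using rl[OF that] by (subst (asm) measure_uniform_count_measure) auto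
    qed
    show ?thesis
    \<comment> \<open>The product rule for independent events asks for a nonempty index set;
      \<open>J\<close> is empty for \<open>N = 0\<close>.\<close>
    proof (cases "J = {}")
      case True
      then have "A r = space M" using AE by simp
      then show ?thesis using True by (simp add: p_def prob_space)
    next
      case False
      have Ej: "E j \<in> events" if "j \<in> J" for j using Eev(1) that by (cases j) auto
      have sub: "(\<Inter>j\<in>J. E j) \<in> events" using False fin Ej by (intro sets.finite_INT) auto
      have A': "A r = (\<Inter>j\<in>J. E j)" unfolding AE using sets.sets_into_space[OF sub] by blast
      have "prob (\<Inter>j\<in>J. E j) = (\<Prod>j\<in>J. prob (E j))"
      proof (rule indep_setsD[OF conjunct2[OF indep[unfolded indep_vars_def2]] _ False fin])
        show "J \<subseteq> (SIGMA n:UNIV. {..<q n})" by (auto simp: J_def)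
        show "\<forall>j\<in>J. E j \<in> {(case j of (n, y) \<Rightarrow> \<alpha> n y) -` A \<inter> space M |A. A \<in> sets (case j of (n, y) \<Rightarrow> count_space {..<?h n})}"
        proof
          fix j assume j: "j \<in> J"
          obtain m y where my: "j = (m, y)" by (cases j)
          have "{r m y} \<in> sets (count_space {..<?h m})" using rl j my by simp
          then show "E j \<in> {(case j of (n, y) \<Rightarrow> \<alpha> n y) -` A \<inter> space M |A. A \<in> sets (case j of (n, y) \<Rightarrow> count_space {..<?h n})}"
            unfolding my E_def by auto
        qed
      qed
      also have "\<dots> = p" unfolding p_def using Eev(2) by (intro prod.cong refl) auto
      finally show ?thesis using A' sub by simp
    qed
  qed
  have "prob (\<Union>r\<in>all_rotations q N. A r) = (\<Sum>r\<in>all_rotations q N. prob (A r))"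
    using main by (intro finite_measure_finite_Union finite_all_rotations) (auto simp: disjoint_family_on_def A_def)
  moreover have "(\<Union>r\<in>all_rotations q N. A r) = space M" using rnd_in by (auto simp: A_def)
  ultimately have "1 = card (all_rotations q N) * p" using main by (simp add: prob_space)
  then have "p = 1 / card (all_rotations q N)" by (auto simp: divide_simps mult.commute)
  then show "{\<omega>\<in>space M. rnd N \<omega> = r} \<in> events" "prob {\<omega>\<in>space M. rnd N \<omega> = r} = 1 / card (all_rotations q N)"
    using main[OF r] by (simp_all add: A_def)
qed

lemma rnd_Markov:
  assumes F: "\<And>r. 0 \<le> F r" and \<epsilon>: "0 < \<epsilon>"
  shows "{\<omega>\<in>space M. \<epsilon> \<le> F (rnd N \<omega>)} \<in> events"
    "prob {\<omega>\<in>space M. \<epsilon> \<le> F (rnd N \<omega>)} \<le> (\<Sum>r\<in>all_rotations q N. F r) / card (all_rotations q N) / \<epsilon>"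
proof -
  let ?R = "{r\<in>all_rotations q N. \<epsilon> \<le> F r}" and ?A = "\<lambda>r. {\<omega>\<in>space M. rnd N \<omega> = r}"
  have eq: "{\<omega>\<in>space M. \<epsilon> \<le> F (rnd N \<omega>)} = (\<Union>r\<in>?R. ?A r)" using rnd_in by auto
  have fin: "finite ?R" using finite_all_rotations by auto
  show "{\<omega>\<in>space M. \<epsilon> \<le> F (rnd N \<omega>)} \<in> events"
    unfolding eq using fin rnd_uniform(1) by (intro sets.finite_UN) auto
  have "prob (\<Union>r\<in>?R. ?A r) = (\<Sum>r\<in>?R. prob (?A r))"
    using rnd_uniform(1) by (intro finite_measure_finite_Union fin) (auto simp: disjoint_family_on_def)
  also have "\<dots> = (\<Sum>r\<in>?R. 1 / card (all_rotations q N))"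
    by (intro sum.cong refl rnd_uniform(2)) auto
  also have "\<dots> \<le> (\<Sum>r\<in>?R. F r / card (all_rotations q N) / \<epsilon>)"
  proof (rule sum_mono)
    fix r assume "r \<in> ?R"
    then have "1 \<le> F r / \<epsilon>" using \<epsilon> by simp
    then have "1 / real (card (all_rotations q N)) \<le> F r / \<epsilon> / real (card (all_rotations q N))"
      by (rule divide_right_mono) simp
    then show "1 / real (card (all_rotations q N)) \<le> F r / real (card (all_rotations q N)) / \<epsilon>"
      by (simp only: divide_divide_eq_left mult.commute)
  qed
  also have "\<dots> \<le> (\<Sum>r\<in>all_rotations q N. F r / card (all_rotations q N) / \<epsilon>)"
    using \<epsilon> F by (intro sum_mono2 finite_all_rotations) auto
  finally show "prob {\<omega>\<in>space M. \<epsilon> \<le> F (rnd N \<omega>)} \<le> (\<Sum>r\<in>all_rotations q N. F r) / card (all_rotations q N) / \<epsilon>"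
    unfolding eq by (simp only: sum_divide_distrib)
qed

text \<open>The event that the value is at least \<open>\<epsilon>\<close> at every index from
  \<open>N0\<close> on lies in each single event bounded by Markov, and these bounds tend to 0.
  Without a rate this yields no almost sure limit, but infinitely many good indices suffice for the
  criterion.\<close>

lemma rnd_frequently_small:
  assumes F: "\<And>N r. 0 \<le> F N r"
    and lim: "(\<lambda>N. (\<Sum>r\<in>all_rotations q (k N). F N r) / card (all_rotations q (k N))) \<longlonglongrightarrow> 0"
  shows "AE \<omega> in M. \<forall>\<epsilon>>0. \<forall>N0. \<exists>N\<ge>N0. F N (rnd (k N) \<omega>) < \<epsilon>"
proof -
  have small: "AE \<omega> in M. \<exists>N\<ge>N0. F N (rnd (k N) \<omega>) < \<epsilon>" if \<epsilon>: "0 < \<epsilon>" for \<epsilon> N0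
  proof -
    define E where "E N = {\<omega>\<in>space M. \<epsilon> \<le> F N (rnd (k N) \<omega>)}" for N
    let ?B = "\<Inter>N\<in>{N0..}. E N"
    have Eev: "E N \<in> events" for N unfolding E_def by (rule rnd_Markov(1)[OF F \<epsilon>])
    have Bev: "?B \<in> events" using Eev by (intro sets.countable_INT) auto
    have "prob ?B \<le> 0"
    proof (rule LIMSEQ_le_const)
      show "(\<lambda>N. (\<Sum>r\<in>all_rotations q (k N). F N r) / card (all_rotations q (k N)) / \<epsilon>) \<longlonglongrightarrow> 0"
        using tendsto_divide[OF lim tendsto_const, of \<epsilon>] \<epsilon> by simp
      have "prob ?B \<le> (\<Sum>r\<in>all_rotations q (k N). F N r) / card (all_rotations q (k N)) / \<epsilon>" if "N \<ge> N0" for N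
      proof -
        have "prob ?B \<le> prob (E N)" using that by (intro finite_measure_mono Eev) auto
        also have "\<dots> \<le> (\<Sum>r\<in>all_rotations q (k N). F N r) / card (all_rotations q (k N)) / \<epsilon>"
          unfolding E_def by (rule rnd_Markov(2)[OF F \<epsilon>])
        finally show ?thesis .
      qed
      then show "\<exists>N1. \<forall>N\<ge>N1. prob ?B \<le> (\<Sum>r\<in>all_rotations q (k N). F N r) / card (all_rotations q (k N)) / \<epsilon>"
        by blast
    qed
    then have "prob ?B = 0" using measure_nonneg[of M ?B] by linarith
    show ?thesis
    proof (rule AE_I[of _ _ ?B])
      show "{\<omega>\<in>space M. \<not> (\<exists>N\<ge>N0. F N (rnd (k N) \<omega>) < \<epsilon>)} \<subseteq> ?B"
        by (auto simp: E_def not_less)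
      show "emeasure M ?B = 0" using \<open>prob ?B = 0\<close> by (simp add: emeasure_eq_measure)
    qed (rule Bev)
  qed
  have "AE \<omega> in M. \<forall>j N0. \<exists>N\<ge>N0. F N (rnd (k N) \<omega>) < 1 / real (Suc j)"
    unfolding AE_all_countable by (intro allI small) simp
  then show ?thesis
  proof eventually_elim
    case (elim \<omega>)
    show ?case
    proof (intro allI impI)
      fix \<epsilon> :: real and N0 assume "0 < \<epsilon>"
      then obtain j where "1 / real (Suc j) < \<epsilon>" using reals_Archimedean[of \<epsilon>] by (auto simp: inverse_eq_divide)
      moreover obtain N where "N \<ge> N0" "F N (rnd (k N) \<omega>) < 1 / real (Suc j)" using elim by blast
      ultimately show "\<exists>N\<ge>N0. F N (rnd (k N) \<omega>) < \<epsilon>" by (intro exI[of _ N]) linarith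
    qed
  qed
qed

end

end


section \<open>Almost sure smallness of the band areas\<close>

definition ind :: "nat \<Rightarrow> nat \<Rightarrow> complex" where
  "ind i u = (if u = i then 1 else 0)"

definition centered_ind :: "nat \<Rightarrow> nat \<Rightarrow> nat \<Rightarrow> complex" where
  "centered_ind h i u = ind i u - 1 / of_nat h"

lemma centered_ind_le: assumes "0 < h" shows "cmod (centered_ind h i u) \<le> 1"
proof -
  have p: "0 < 1 / real h" "1 / real h \<le> 1" using assms by simp_all
  have e: "centered_ind h i u = of_real (if u = i then 1 - 1 / real h else - (1 / real h))"
    by (simp add: centered_ind_def ind_def)
  show ?thesis unfolding e norm_of_real using p by (cases "u = i") simp_all
qed

lemma sum_centered_ind: "i < h \<Longrightarrow> (\<Sum>u<h. centered_ind h i u) = 0"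
  by (simp add: centered_ind_def ind_def sum_subtractf)

context iceberg
begin

text \<open>The deterministic errors are collected: comparison with the shift at level
  \<open>N + 1\<close>, where \<open>K / h (Suc N)\<close> equals \<open>L / q N\<close>, and
  centering of the indicators at cost \<open>2 / L\<close>. Both are small when \<open>L\<close> is
  large but small against \<open>q N\<close>.\<close>

lemma band_area_cyl_le:
  fixes L n N :: nat
  assumes n: "n \<le> N" and L: "1 \<le> L" "L \<le> q N"
  defines "K \<equiv> L * h N" and "c \<equiv> centered_ind (h n)"
  assumes ij: "i < h n" "j < h n"
  shows "K.band_area K (cyl n i) (cyl n j) \<le>
    mean_area K (h (Suc N)) K (word q \<alpha> n (c i) (Suc (N - n))) (word q \<alpha> n (c j) (Suc (N - n))) +
    2 / L + 2 * sqrt (8 * (L / q N))"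
proof -
  define d where "d = N - n"
  have N: "n + d = N" "n + Suc d = Suc N" using n by (simp_all add: d_def)
  have K0: "0 < K" using h_pos[of N] L by (simp add: K_def)
  have i1: "cmod (ind i u) \<le> 1" for i u by (simp add: ind_def)
  have c1: "cmod (c i u) \<le> 1" for i u unfolding c_def by (rule centered_ind_le[OF h_pos])
  have c0: "(\<Sum>u<h n. c i u) = 0" if "i < h n" for i unfolding c_def by (rule sum_centered_ind[OF that])
  have cc: "cmod (1 / of_nat (h n)) \<le> 1" using h_pos[of n] by (simp add: norm_divide)
  have wc: "(\<lambda>u. word q \<alpha> n (ind i) d u - 1 / of_nat (h n)) = word q \<alpha> n (c i) d" for i
    unfolding c_def centered_ind_def[abs_def] word_diff ..
  have 1: "K.band_area K (cyl n i) (cyl n j) \<le>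
    mean_area K (h (Suc N)) K (word q \<alpha> n (ind i) (Suc d)) (word q \<alpha> n (ind j) (Suc d)) + 2 * sqrt (8 * K / h (Suc N))"
    using band_area_le[OF K0, of "ind i" "ind j" n "Suc d"] i1 unfolding N(2) cyl_def ind_def by simp
  have 2: "real (8 * K) / real (h (Suc N)) = 8 * (L / q N)"
    using h_pos[of N] q_ge_2[of N] by (simp add: K_def)
  have 3: "mean_area K (h (Suc N)) K (word q \<alpha> n (ind i) (Suc d)) (word q \<alpha> n (ind j) (Suc d)) \<le>
    mean_area K (h (Suc N)) K (word q \<alpha> n (c i) (Suc d)) (word q \<alpha> n (c j) (Suc d)) + 2 / L"
  proof -
    have z: "(\<Sum>u<h N. word q \<alpha> n (ind i) d u - 1 / of_nat (h n)) = 0" if "i < h n" for i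
      using sum_word[OF c0[OF that], of d] unfolding wc N(1) .
    have b: "cmod (word q \<alpha> n (ind i) d u - 1 / of_nat (h n)) \<le> 1" for i u
      using word_bound[of "c i" 1 q \<alpha> n d u, OF c1] unfolding fun_cong[OF wc, symmetric] .
    have "0 < q N" using q_ge_2[of N] by simp
    from mean_area_center[of "q N" "\<alpha> N" "h N" L "word q \<alpha> n (ind i) d" "1 / of_nat (h n)" "word q \<alpha> n (ind j) d" "1 / of_nat (h n)",
        OF \<alpha>_less this h_pos L(1) word_bound[OF i1] b cc z[OF ij(1)] word_bound[OF i1] b cc z[OF ij(2)]]
    show ?thesis unfolding wc by (simp add: N(1) K_def)
  qed
  show ?thesis using 1 3 unfolding 2 d_def[symmetric] by linarith
qed

end

theorem theorem46:
  fixes q :: "nat \<Rightarrow> nat" and M :: "'w measure" and \<alpha> :: "nat \<Rightarrow> nat \<Rightarrow> 'w \<Rightarrow> nat"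
  assumes q_ge_2: "\<forall>n. 2 \<le> q n"
    and growth: "filterlim (\<lambda>n. real (q n) / real (iceberg_height q n)) at_top sequentially"
    and prob: "prob_space M"
    and indep: "prob_space.indep_vars M (\<lambda>(n, y). count_space {..<iceberg_height q n}) (\<lambda>(n, y). \<alpha> n y)
                  (SIGMA n:UNIV. {..<q n})"
    and uniform: "\<forall>n. \<forall>y<q n. distr M (count_space {..<iceberg_height q n}) (\<alpha> n y)
                    = uniform_count_measure {..<iceberg_height q n}"
  shows "AE \<omega> in M. iceberg_simple_spectrum q (\<lambda>n y. \<alpha> n y \<omega>)"
proof -
  interpret prob_space M by (rule prob)
  let ?h = "iceberg_height q"
  have q1: "1 \<le> q n" for n using q_ge_2[rule_format, of n] by simp
  have hp: "0 < ?h n" for n by (rule height_pos[OF q1])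
  have uni: "distr M (count_space {..<?h n}) (\<alpha> n y) = uniform_count_measure {..<?h n}" if "y < q n" for n y
    using uniform that by blast
  note prob_facts = q1 indep uni
  have q_top: "filterlim (\<lambda>n. real (q n)) at_top sequentially"
  proof (rule filterlim_at_top_mono[OF growth], rule always_eventually, rule allI)
    fix n
    have "1 \<le> real (?h n)" using hp[of n] by simp
    then show "real (q n) / real (?h n) \<le> real (q n)"
      using mult_left_mono[of 1 "real (?h n)" "real (q n)"] by (simp add: divide_simps)
  qed
  have sqrt_top: "filterlim (\<lambda>n. sqrt (real (q n))) at_top sequentially"
    by (rule filterlim_compose[OF sqrt_at_top q_top])

  \<comment> \<open>The square root meets both requirements: \<open>L\<close> tends to infinity,
    which removes the edge and centering errors, and \<open>L / q\<close> tends to 0, which keeps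
    most orbits on the shift.\<close>
  define L where "L n = nat \<lfloor>sqrt (real (q n))\<rfloor>" for n
  have L1: "1 \<le> L n" for n
  proof -
    have "1 \<le> sqrt (real (q n))" using q1[of n] by simp
    then show ?thesis unfolding L_def by (simp add: le_nat_floor)
  qed
  have L_le: "real (L n) \<le> sqrt (real (q n))" for n
    unfolding L_def by (rule of_nat_floor) simp
  have L_ge: "sqrt (real (q n)) - 1 \<le> real (L n)" for n
    unfolding L_def by linarith
  have Lq: "L n \<le> q n" for n
  proof -
    have "sqrt (real (q n)) * 1 \<le> sqrt (real (q n)) * sqrt (real (q n))"
      using q1[of n] by (intro mult_left_mono) auto
    then have "real (L n) \<le> real (q n)" using L_le[of n] by simp
    then show ?thesis by simp
  qed
  have L_top: "filterlim (\<lambda>n. real (L n)) at_top sequentially"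
  proof (rule filterlim_at_top_mono[of "\<lambda>n. sqrt (real (q n)) + (- 1)"])
    show "filterlim (\<lambda>n. sqrt (real (q n)) + (- 1)) at_top sequentially"
      using filterlim_tendsto_add_at_top[OF tendsto_const[of "-1"] sqrt_top] by (simp add: add.commute)
  qed (use L_ge in auto)
  have L_inv: "(\<lambda>n. 2 / real (L n)) \<longlonglongrightarrow> 0"
    by (intro tendsto_divide_0[OF tendsto_const] filterlim_at_top_imp_at_infinity L_top)
  have L_sqrt: "(\<lambda>n. 2 / sqrt (real (L n))) \<longlonglongrightarrow> 0"
    by (intro tendsto_divide_0[OF tendsto_const] filterlim_at_top_imp_at_infinity filterlim_compose[OF sqrt_at_top L_top])
  have Lq0: "(\<lambda>n. real (L n) / real (q n)) \<longlonglongrightarrow> 0"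
  proof (rule tendsto_sandwich[of "\<lambda>_. 0" _ _ "\<lambda>n. 1 / sqrt (real (q n))"])
    show "(\<lambda>n. 1 / sqrt (real (q n))) \<longlonglongrightarrow> 0"
      by (intro tendsto_divide_0[OF tendsto_const] filterlim_at_top_imp_at_infinity sqrt_top)
    have "real (L n) / real (q n) \<le> 1 / sqrt (real (q n))" for n
    proof -
      have "real (L n) / real (q n) \<le> sqrt (real (q n)) / real (q n)"
        by (intro divide_right_mono L_le) simp
      also have "\<dots> = sqrt (real (q n)) / (sqrt (real (q n)) * sqrt (real (q n)))" by simp
      also have "\<dots> = 1 / sqrt (real (q n))" using q1[of n] by (simp del: real_sqrt_mult_self)
      finally show ?thesis .
    qed
    then show "\<forall>\<^sub>F n in sequentially. real (L n) / real (q n) \<le> 1 / sqrt (real (q n))" by simp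
  qed auto

  define c where "c n = centered_ind (?h n)" for n
  have c1: "cmod (c n i u) \<le> 1" for n i u unfolding c_def by (rule centered_ind_le[OF hp])
  have c0: "(\<Sum>u<?h n. c n i u) = 0" if "i < ?h n" for n i unfolding c_def by (rule sum_centered_ind[OF that])
  define A where "A n N r i j = mean_area (L N * ?h N) (?h (Suc N)) (L N * ?h N)
      (word q r n (c n i) (Suc (N - n))) (word q r n (c n j) (Suc (N - n)))" for n N r i j
  \<comment> \<open>All pairs of indicators of level \<open>n\<close> are added so that one good
    \<open>N\<close> serves them all. The value 0 for \<open>N < n\<close> is a filler; the index
    chosen below is at least \<open>n\<close>.\<close>
  define F where "F n N r = (if n \<le> N then \<Sum>i<?h n. \<Sum>j<?h n. A n N r i j else 0)" for n N r
  have F0: "0 \<le> F n N r" for n N r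
    unfolding F_def A_def by (auto intro!: sum_nonneg mean_area_nonneg)
  have lim: "(\<lambda>N. (\<Sum>r\<in>all_rotations q (Suc N). F n N r) / card (all_rotations q (Suc N))) \<longlonglongrightarrow> 0" for n
  proof -
    let ?C = "\<lambda>N. real (card (all_rotations q (Suc N)))"
    let ?b = "\<lambda>N. (real (?h n))\<^sup>2 * (decay q n (N - n) + 2 / sqrt (real (L N)))"
    have le: "(\<Sum>r\<in>all_rotations q (Suc N). F n N r) / ?C N \<le> ?b N" if nN: "n \<le> N" for N
    proof -
      have "all_rotations q (Suc N) \<noteq> {}" using rnd_in[OF prob_facts, of _ "Suc N"] not_empty by blast
      then have C: "0 < ?C N" by (simp only: of_nat_0_less_iff card_gt_0_iff finite_all_rotations simp_thms)
      have each: "(\<Sum>r\<in>all_rotations q (Suc N). A n N r i j) \<le> ?C N * (decay q n (N - n) + 2 / sqrt (real (L N)))"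
        if "i < ?h n" "j < ?h n" for i j
        using average_mean_area_window[OF q1 c0[OF that(1)] c1 c0[OF that(2)] c1 L1[of N], of "N - n"] Lq[of N] nN
        by (simp add: A_def)
      have "(\<Sum>r\<in>all_rotations q (Suc N). F n N r) = (\<Sum>i<?h n. \<Sum>j<?h n. \<Sum>r\<in>all_rotations q (Suc N). A n N r i j)"
      proof -
        have "(\<Sum>r\<in>all_rotations q (Suc N). F n N r) = (\<Sum>r\<in>all_rotations q (Suc N). \<Sum>i<?h n. \<Sum>j<?h n. A n N r i j)"
          using nN by (simp add: F_def)
        also have "\<dots> = (\<Sum>i<?h n. \<Sum>r\<in>all_rotations q (Suc N). \<Sum>j<?h n. A n N r i j)" by (rule sum.swap)
        also have "\<dots> = (\<Sum>i<?h n. \<Sum>j<?h n. \<Sum>r\<in>all_rotations q (Suc N). A n N r i j)"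
          by (rule sum.cong[OF refl], rule sum.swap)
        finally show ?thesis .
      qed
      also have "\<dots> \<le> (\<Sum>i<?h n. \<Sum>j<?h n. ?C N * (decay q n (N - n) + 2 / sqrt (real (L N))))"
        by (intro sum_mono each) auto
      also have "\<dots> = ?C N * ?b N" by (simp add: power2_eq_square)
      finally show ?thesis using C by (simp add: divide_simps mult.commute)
    qed
    have d: "(\<lambda>N. decay q n (N - n)) \<longlonglongrightarrow> 0"
      using LIMSEQ_offset[of "\<lambda>N. decay q n (N - n)" n 0] decay_tendsto[OF q_top, of n] by simp
    have b: "?b \<longlonglongrightarrow> 0"
      using tendsto_mult_left[OF tendsto_add[OF d L_sqrt], of "(real (?h n))\<^sup>2"] by simp
    show ?thesis
    proof (rule tendsto_sandwich[OF _ _ tendsto_const b])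
      show "\<forall>\<^sub>F N in sequentially. 0 \<le> (\<Sum>r\<in>all_rotations q (Suc N). F n N r) / ?C N"
        by (intro always_eventually allI divide_nonneg_nonneg sum_nonneg F0) simp
      show "\<forall>\<^sub>F N in sequentially. (\<Sum>r\<in>all_rotations q (Suc N). F n N r) / ?C N \<le> ?b N"
        using eventually_ge_at_top[of n] by eventually_elim (rule le)
    qed
  qed
  have "AE \<omega> in M. \<forall>\<epsilon>>0. \<forall>N0. \<exists>N\<ge>N0. F n N (trunc_rotations q (Suc N) (\<lambda>m y. \<alpha> m y \<omega>)) < \<epsilon>" for n
    by (rule rnd_frequently_small[OF prob_facts F0 lim])
  then have "AE \<omega> in M. \<forall>n. \<forall>\<epsilon>>0. \<forall>N0. \<exists>N\<ge>N0. F n N (trunc_rotations q (Suc N) (\<lambda>m y. \<alpha> m y \<omega>)) < \<epsilon>"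
    by (simp add: AE_all_countable)
  then show ?thesis
  proof (rule AE_mp, intro AE_I2 impI)
    fix \<omega> assume \<omega>: "\<omega> \<in> space M"
      and ev: "\<forall>n. \<forall>\<epsilon>>0. \<forall>N0. \<exists>N\<ge>N0. F n N (trunc_rotations q (Suc N) (\<lambda>m y. \<alpha> m y \<omega>)) < \<epsilon>"
    let ?a = "\<lambda>m y. \<alpha> m y \<omega>"
    interpret iceberg q ?a
    proof
      show "2 \<le> q n" for n using q_ge_2 by simp
      show "\<alpha> n y \<omega> < ?h n" if "y < q n" for n y by (rule rotation_less[OF prob_facts that \<omega>])
    qed
    show "iceberg_simple_spectrum q ?a"
    proof (rule simple_spectrum_if)
      fix n and \<epsilon> :: real assume \<epsilon>: "0 < \<epsilon>"
      have "(\<lambda>N. 2 / real (L N) + 2 * sqrt (8 * (real (L N) / real (q N)))) \<longlonglongrightarrow> 0 + 2 * sqrt (8 * 0)"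
        by (intro tendsto_intros L_inv Lq0)
      then have "\<forall>\<^sub>F N in sequentially. 2 / real (L N) + 2 * sqrt (8 * (real (L N) / real (q N))) < \<epsilon> / 2"
        by (rule order_tendstoD(2)) (use \<epsilon> in simp)
      then obtain N1 where N1: "\<And>N. N \<ge> N1 \<Longrightarrow> 2 / real (L N) + 2 * sqrt (8 * (real (L N) / real (q N))) < \<epsilon> / 2"
        by (auto simp: eventually_sequentially)
      obtain N where N: "N \<ge> max n N1" "F n N (trunc_rotations q (Suc N) ?a) < \<epsilon> / 2"
        using ev \<epsilon> half_gt_zero by blast
      have nN: "n \<le> N" using N(1) by simp
      let ?K = "L N * ?h N" and ?t = "trunc_rotations q (Suc N) ?a"
      have "K.band_area ?K (cyl n i) (cyl n j) < \<epsilon>" if ij: "i < ?h n" "j < ?h n" for i j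
      proof -
        \<comment> \<open>The averages concern arrays truncated after level \<open>N\<close>; on
          valid letters the word of level \<open>N + 1\<close> uses only entries that survive the
          truncation.\<close>
        have cut: "word q ?a n (c n i) (Suc (N - n)) u = word q ?t n (c n i) (Suc (N - n)) u" if "u < ?h (Suc N)" for i u
          by (rule word_cong[OF q1]) (use nN that in \<open>auto simp: trunc_rotations_def Suc_diff_le\<close>)
        have "K.band_area ?K (cyl n i) (cyl n j) \<le>
            mean_area ?K (?h (Suc N)) ?K (word q ?a n (c n i) (Suc (N - n))) (word q ?a n (c n j) (Suc (N - n))) +
            2 / L N + 2 * sqrt (8 * (L N / q N))"
          unfolding c_def by (rule band_area_cyl_le[OF nN L1 Lq ij])
        also have "mean_area ?K (?h (Suc N)) ?K (word q ?a n (c n i) (Suc (N - n))) (word q ?a n (c n j) (Suc (N - n))) = A n N ?t i j"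
          unfolding A_def by (rule mean_area_cong[OF hp cut cut])
        finally have 1: "K.band_area ?K (cyl n i) (cyl n j) \<le> A n N ?t i j + 2 / L N + 2 * sqrt (8 * (L N / q N))" .
        have "A n N ?t i j \<le> (\<Sum>j<?h n. A n N ?t i j)"
          using ij by (intro member_le_sum) (auto simp: A_def mean_area_nonneg)
        also have "\<dots> \<le> (\<Sum>i<?h n. \<Sum>j<?h n. A n N ?t i j)"
          using ij by (intro member_le_sum[of i _ "\<lambda>i. \<Sum>j<?h n. A n N ?t i j"]) (auto simp: A_def intro!: sum_nonneg mean_area_nonneg)
        also have "\<dots> = F n N ?t" using nN by (simp add: F_def)
        finally show ?thesis using 1 N(2) N1[of N] N(1) by simp
      qed
      moreover have "0 < ?K" using L1[of N] hp[of N] by simp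
      ultimately show "\<exists>K>0. \<forall>i<?h n. \<forall>j<?h n. K.band_area K (cyl n i) (cyl n j) < \<epsilon>" by blast
    qed
  qed
qed

end
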